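(* Let $K>0$ and equip $E_K$ with the metric $\|B_1-B_2\|=\sup_{t\in\mathbb{R}}\|B_1(t)-B_2(t)\|$. Then the four functions $\mathcal{I}_U,\ \mathcal{I}_L,\ \mathcal{I}^-_U,\ \mathcal{I}^-_L : E_K\to\mathbb{R}$ are uniformly continuous on $E_K$.
   Context: Let $d\ge 1$, $I$ the identity matrix, $J=\begin{pmatrix}0&-I\\ I&0\end{pmatrix}$ the standard $2d\times 2d$ symplectic matrix, $\mathrm{Sp}(2d)=\{M\in GL(\mathbb{R}^{2d}): M^TJM=J\}$, $\mathbb{U}$ the unit circle in $\mathbb{C}$, and $\mathrm{Sym}(2d,\mathbb{R})$ the real symmetric $2d\times 2d$ matrices. For $K>0$, $E_K=\{B\in C^0(\mathbb{R},\mathrm{Sym}(2d,\mathbb{R})): \|B\|=\sup_t\|B(t)\|\le K\}$ (operator norm). For $B\in E_K$, $\gamma=\gamma_B$ is the fundamental solution: $\dot\gamma(t)=JB(t)\gamma(t)$, $\gamma(0)=I$. Maslov-type index: for $\omega\in\mathbb{U}$ let $\mathrm{Sp}(2d)^0_\omega=\{M\in\mathrm{Sp}(2d):\det(M-\omega I)=0\}$, a codimension-one hypersurface co-oriented at $M$ by the direction $\frac{d}{dt}Me^{tJ}|_{t=0}$. For a continuous path $\gamma:[a,b]\to\mathrm{Sp}(2d)$ and $M\in\mathrm{Sp}(2d)$, $\iota(\omega M,\gamma,[a,b])\in\mathbb{Z}$ is the intersection number of the path $t\mapsto e^{-\epsilon J}\gamma(t)M^{-1}$, $t\in[a,b]$,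 with the co-oriented hypersurface $\mathrm{Sp}(2d)^0_\omega$, for $\epsilon>0$ sufficiently small. For a path on $[0,T]$ with $\gamma(0)=I$, $i_\omega(\gamma,[0,T])=\iota(\omega I,\gamma,[0,T])-\frac12\dim_{\mathbb{C}}\ker(I-\omega I)$; thus $i_1(\gamma,[0,T])=\iota(I,\gamma,[0,T])-d$. Mean indices: $\mathcal{I}_U(B)=\limsup_{l\to+\infty}\frac{i_1(\gamma,[0,l])}{l}$, $\mathcal{I}_L(B)=\liminf_{l\to+\infty}\frac{i_1(\gamma,[0,l])}{l}$, $\mathcal{I}^-_U(B)=\limsup_{l\to+\infty}\frac{i_1(\gamma,[0,-l])}{-l}$, $\mathcal{I}^-_L(B)=\liminf_{l\to+\infty}\frac{i_1(\gamma,[0,-l])}{-l}$, where $i_1(\gamma,[0,-l])$ is the index $i_1$ of the path $t\mapsto\gamma(-t)$, $t\in[0,l]$. *)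

theory Defs
  imports "HOL-Analysis.Analysis"
begin

section \<open>Linear symplectic algebra\<close>

text \<open>Real \<open>2d \<times> 2d\<close> matrices are indexed by \<open>'n + 'n\<close>, where \<open>d = CARD('n) \<ge> 1\<close>;
  \<open>Inl\<close> indexes the first block of \<open>d\<close> coordinates and \<open>Inr\<close> the second one.\<close>

type_synonym 'n bmat = "real ^ ('n + 'n) ^ ('n + 'n)"

definition Jmat :: "'n::finite bmat" where
  "Jmat = (\<chi> i j. case (i, j) of
      (Inl a, Inr b) \<Rightarrow> (if a = b then -1 else 0)
    | (Inr a, Inl b) \<Rightarrow> (if a = b then 1 else 0)
    | _ \<Rightarrow> 0)"

definition Sp :: "'n::finite bmat set" where
  "Sp = {M. transpose M ** Jmat ** M = Jmat}"

definition opnorm :: "real ^ 'm::finite ^ 'm \<Rightarrow> real" where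
  "opnorm A = onorm (\<lambda>v. A *v v)"

definition mexp :: "real ^ 'm::finite ^ 'm \<Rightarrow> real ^ 'm ^ 'm" where
  "mexp A = (\<Sum>k. (1 / fact k) *\<^sub>R (((**) A ^^ k) (mat 1)))"

definition cmat :: "real ^ 'm::finite ^ 'm \<Rightarrow> complex ^ 'm ^ 'm" where
  "cmat A = (\<chi> i j. complex_of_real (A $ i $ j))"


section \<open>Intersection number with the singular hypersurface\<close>

definition det_minus :: "complex \<Rightarrow> 'n::finite bmat \<Rightarrow> complex" where
  "det_minus \<omega> M = det (cmat M - mat \<omega>)"

definition Sp0 :: "complex \<Rightarrow> 'n::finite bmat set" where
  "Sp0 \<omega> = {M \<in> Sp. det_minus \<omega> M = 0}"

text \<open>Let \<open>D\<close> be the derivative of \<open>det (\<cdot> - \<omega> I)\<close> at \<open>N \<in> Sp0 \<omega>\<close>. The vector \<open>N J\<close> is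
  the velocity at \<open>t = 0\<close> of \<open>N exp (t J)\<close>, which co-orients the hypersurface. The condition
  \<open>D (N J) \<noteq> 0\<close> says that \<open>N\<close> lies in the regular part of the hypersurface (equivalently,
  that the kernel of \<open>N - \<omega> I\<close> is a complex line) and there the tangent space of
  \<open>Sp0 \<omega>\<close> is the kernel of \<open>D\<close> on the tangent space of \<open>Sp\<close> at \<open>N\<close>. Hence the last two
  conditions below express that the velocity \<open>X\<close> of \<open>\<xi>\<close> is congruent to \<open>c N J\<close> modulo this
  tangent space, with \<open>c \<noteq> 0\<close>, i.e. that the crossing is transverse, and \<open>\<sigma>\<close> is its sign
  relative to the co-orientation.\<close>

definition transverse_crossing ::
  "complex \<Rightarrow> (real \<Rightarrow> 'n::finite bmat) \<Rightarrow> real \<Rightarrow> int \<Rightarrow> bool" where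
  "transverse_crossing \<omega> \<xi> t \<sigma> \<longleftrightarrow>
     \<xi> t \<in> Sp0 \<omega> \<and>
     (let N = \<xi> t; D = frechet_derivative (det_minus \<omega>) (at N) in
        D (N ** Jmat) \<noteq> 0 \<and>
        (\<exists>X c. (\<xi> has_vector_derivative X) (at t) \<and>
               D (X - c *\<^sub>R (N ** Jmat)) = 0 \<and> c \<noteq> 0 \<and> real_of_int \<sigma> = sgn c))"

text \<open>A path in \<open>Sp\<close> whose endpoints avoid the hypersurface has intersection number \<open>m\<close> if, after
  a homotopy in \<open>Sp\<close> with fixed endpoints, it meets the hypersurface in finitely many transverse
  crossings whose signs add up to \<open>m\<close>. The composition with \<open>linepath a b\<close> only reparametrises
  \<open>\<eta>\<close> over \<open>{0..1}\<close>.\<close>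

definition has_intersection_number ::
  "complex \<Rightarrow> (real \<Rightarrow> 'n::finite bmat) \<Rightarrow> real \<Rightarrow> real \<Rightarrow> int \<Rightarrow> bool" where
  "has_intersection_number \<omega> \<eta> a b m \<longleftrightarrow>
     \<eta> a \<notin> Sp0 \<omega> \<and> \<eta> b \<notin> Sp0 \<omega> \<and>
     (\<exists>\<xi> \<sigma>. homotopic_paths Sp (\<eta> \<circ> linepath a b) \<xi> \<and>
        finite {t \<in> {0..1}. \<xi> t \<in> Sp0 \<omega>} \<and>
        (\<forall>t \<in> {t \<in> {0..1}. \<xi> t \<in> Sp0 \<omega>}. transverse_crossing \<omega> \<xi> t (\<sigma> t)) \<and>
        m = (\<Sum>t \<in> {t \<in> {0..1}. \<xi> t \<in> Sp0 \<omega>}. \<sigma> t))"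


section \<open>Maslov-type index\<close>

definition maslov_iota ::
  "complex \<Rightarrow> 'n::finite bmat \<Rightarrow> (real \<Rightarrow> 'n bmat) \<Rightarrow> real \<Rightarrow> real \<Rightarrow> int" where
  "maslov_iota \<omega> M \<gamma> a b =
     (THE m. \<forall>\<^sub>F \<epsilon> in at_right 0.
        has_intersection_number \<omega> (\<lambda>t. mexp ((- \<epsilon>) *\<^sub>R Jmat) ** \<gamma> t ** matrix_inv M) a b m)"

definition maslov_index :: "complex \<Rightarrow> (real \<Rightarrow> 'n::finite bmat) \<Rightarrow> real \<Rightarrow> real" where
  "maslov_index \<omega> \<gamma> T =
     real_of_int (maslov_iota \<omega> (mat 1) \<gamma> 0 T) -
     real (vec.dim {v :: complex ^ ('n + 'n). (mat 1 - mat \<omega>) *v v = 0}) / 2"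


section \<open>Linear Hamiltonian systems and mean indices\<close>

definition E_set :: "real \<Rightarrow> (real \<Rightarrow> 'n::finite bmat) set" where
  "E_set K = {B. continuous_on UNIV B \<and> (\<forall>t. transpose (B t) = B t) \<and> (\<forall>t. opnorm (B t) \<le> K)}"

text \<open>The value outside of \<open>E_set K\<close> is irrelevant; it is set to \<open>0\<close> because \<open>Metric_space\<close>
  requires the distance to be nonnegative everywhere.\<close>

definition E_dist :: "real \<Rightarrow> (real \<Rightarrow> 'n::finite bmat) \<Rightarrow> (real \<Rightarrow> 'n bmat) \<Rightarrow> real" where
  "E_dist K B1 B2 =
     (if B1 \<in> E_set K \<and> B2 \<in> E_set K then (SUP t. opnorm (B1 t - B2 t)) else 0)"

definition E_metric :: "real \<Rightarrow> (real \<Rightarrow> 'n::finite bmat) metric" where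
  "E_metric K = metric (E_set K, E_dist K)"

definition fund_sol :: "(real \<Rightarrow> 'n::finite bmat) \<Rightarrow> real \<Rightarrow> 'n bmat" where
  "fund_sol B =
     (THE \<gamma>. \<gamma> 0 = mat 1 \<and>
        (\<forall>t. (\<gamma> has_vector_derivative (Jmat ** B t ** \<gamma> t)) (at t)))"

text \<open>The mean indices are defined in the extended reals, so that their finiteness can be stated.\<close>

definition mean_index_U :: "(real \<Rightarrow> 'n::finite bmat) \<Rightarrow> ereal" where
  "mean_index_U B =
     Limsup at_top (\<lambda>l::real. ereal (maslov_index 1 (fund_sol B) l / l))"

definition mean_index_L :: "(real \<Rightarrow> 'n::finite bmat) \<Rightarrow> ereal" where
  "mean_index_L B =
     Liminf at_top (\<lambda>l::real. ereal (maslov_index 1 (fund_sol B) l / l))"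

definition mean_index_U_neg :: "(real \<Rightarrow> 'n::finite bmat) \<Rightarrow> ereal" where
  "mean_index_U_neg B =
     Limsup at_top (\<lambda>l::real. ereal (maslov_index 1 (\<lambda>t. fund_sol B (- t)) l / (- l)))"

definition mean_index_L_neg :: "(real \<Rightarrow> 'n::finite bmat) \<Rightarrow> ereal" where
  "mean_index_L_neg B =
     Liminf at_top (\<lambda>l::real. ereal (maslov_index 1 (\<lambda>t. fund_sol B (- t)) l / (- l)))"


section \<open>Basic facts\<close>

lemma Jmat_square: "Jmat ** Jmat = - (mat 1 :: 'n::finite bmat)"
proof -
  have "(Jmat ** Jmat) $ i $ j = (- (mat 1 :: 'n bmat)) $ i $ j" for i j :: "'n + 'n"
  proof -
    have "(Jmat ** Jmat) $ i $ j = (\<Sum>k\<in>UNIV. (Jmat::'n bmat) $ i $ k * Jmat $ k $ j)"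
      by (simp add: matrix_matrix_mult_def)
    also have "\<dots> = (\<Sum>a\<in>UNIV. (Jmat::'n bmat) $ i $ Inl a * Jmat $ Inl a $ j)
                   + (\<Sum>a\<in>UNIV. (Jmat::'n bmat) $ i $ Inr a * Jmat $ Inr a $ j)"
      unfolding UNIV_sum by (subst sum.union_disjoint) (auto simp: sum.reindex)
    also have "\<dots> = (- (mat 1 :: 'n bmat)) $ i $ j"
    proof -
      have 1: "(\<Sum>k\<in>UNIV. (if a = k then -1 else 0) * (if k = b then 1 else 0)) =
          (if a = b then -1 else (0::real))"
        and 2: "(\<Sum>k\<in>UNIV. (if a = k then 1 else 0) * (if k = b then -1 else 0)) =
          (if a = b then -1 else (0::real))" for a b :: 'n
        by (simp_all add: if_distrib[where f = "\<lambda>x. x * _"] cong: if_cong)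
      show ?thesis
        by (cases i; cases j) (simp_all add: Jmat_def mat_def 1 2)
    qed
    finally show ?thesis .
  qed
  then show ?thesis by (simp add: vec_eq_iff)
qed

lemma mexp_Jmat: "mexp (\<theta> *\<^sub>R Jmat) = cos \<theta> *\<^sub>R mat 1 + sin \<theta> *\<^sub>R (Jmat :: 'n::finite bmat)"
proof -
  have pow: "((**) (\<theta> *\<^sub>R (Jmat::'n bmat)) ^^ k) (mat 1) =
      (if even k then ((-1) ^ (k div 2) * \<theta> ^ k) *\<^sub>R mat 1
       else ((-1) ^ ((k - 1) div 2) * \<theta> ^ k) *\<^sub>R Jmat)" for k
  proof (induction k)
    case (Suc k)
    have step: "((**) (\<theta> *\<^sub>R (Jmat::'n bmat)) ^^ Suc k) (mat 1) =
        (\<theta> *\<^sub>R Jmat) ** ((**) (\<theta> *\<^sub>R Jmat) ^^ k) (mat 1)"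
      by simp
    show ?case
    proof (cases "even k")
      case True
      then show ?thesis
        unfolding step Suc.IH by (simp add: matrix_scalar_ac scalar_matrix_assoc[symmetric])
    next
      case False
      then obtain j where "k = 2 * j + 1" by (elim oddE)
      then show ?thesis
        unfolding step Suc.IH
        by (simp add: matrix_scalar_ac scalar_matrix_assoc[symmetric] Jmat_square)
    qed
  qed simp
  have "(1 / fact k) *\<^sub>R ((**) (\<theta> *\<^sub>R (Jmat::'n bmat)) ^^ k) (mat 1) =
      (cos_coeff k *\<^sub>R \<theta> ^ k) *\<^sub>R mat 1 + (sin_coeff k *\<^sub>R \<theta> ^ k) *\<^sub>R Jmat" for k
    by (simp add: pow cos_coeff_def sin_coeff_def)
  moreover have "(\<lambda>k. (cos_coeff k *\<^sub>R \<theta> ^ k) *\<^sub>R mat 1 + (sin_coeff k *\<^sub>R \<theta> ^ k) *\<^sub>R (Jmat::'n bmat))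
      sums (cos \<theta> *\<^sub>R mat 1 + sin \<theta> *\<^sub>R Jmat)"
    by (intro sums_add sums_scaleR_left cos_converges sin_converges)
  ultimately show ?thesis
    unfolding mexp_def by (simp add: sums_iff)
qed

lemma opnorm_pos: "0 \<le> opnorm A"
  unfolding opnorm_def by (simp add: onorm_pos_le matrix_vector_mul_bounded_linear)

lemma opnorm_eq_0_iff: "opnorm A = 0 \<longleftrightarrow> A = 0"
  unfolding opnorm_def
  by (simp add: onorm_eq_0 matrix_vector_mul_bounded_linear matrix_eq)

lemma opnorm_minus_commute: "opnorm (A - B) = opnorm (B - A)"
proof -
  have "(\<lambda>v. (A - B) *v v) = (\<lambda>v. - ((B - A) *v v))"
    by (simp add: matrix_vector_mult_diff_rdistrib fun_eq_iff)
  then show ?thesis unfolding opnorm_def by (simp add: onorm_neg)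
qed

lemma opnorm_triangle: "opnorm (A + B) \<le> opnorm A + opnorm B"
  unfolding opnorm_def matrix_vector_mult_add_rdistrib
  by (rule onorm_triangle) (rule matrix_vector_mul_bounded_linear)+

lemma Metric_space_E: "Metric_space (E_set K) (E_dist K :: (real \<Rightarrow> 'n::finite bmat) \<Rightarrow> _)"
proof -
  have bound: "opnorm (A t - B t) \<le> 2 * K"
    if "A \<in> E_set K" "B \<in> E_set K" for A B :: "real \<Rightarrow> 'n bmat" and t
  proof -
    have "opnorm (- B t) = opnorm (B t)"
      using opnorm_minus_commute[of 0 "B t"] by simp
    then show ?thesis
      using opnorm_triangle[of "A t" "- B t"] that
      by (simp add: E_set_def) (smt (verit))
  qed
  have bdd: "bdd_above (range (\<lambda>t. opnorm (A t - B t)))"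
    if "A \<in> E_set K" "B \<in> E_set K" for A B :: "real \<Rightarrow> 'n bmat"
    using bound[OF that] by (auto intro!: bdd_aboveI)
  have up: "opnorm (A t - B t) \<le> E_dist K A B"
    if "A \<in> E_set K" "B \<in> E_set K" for A B :: "real \<Rightarrow> 'n bmat" and t
    using that cSUP_upper[OF _ bdd[OF that]] by (auto simp: E_dist_def)
  show ?thesis
  proof
    fix A B :: "real \<Rightarrow> 'n bmat"
    show "0 \<le> E_dist K A B"
    proof (cases "A \<in> E_set K \<and> B \<in> E_set K")
      case True
      then show ?thesis using up[of A B 0] opnorm_pos[of "A 0 - B 0"] by linarith
    qed (auto simp: E_dist_def)
    show "E_dist K A B = E_dist K B A"
      by (simp add: E_dist_def opnorm_minus_commute conj_commute)
    show "E_dist K A B = 0 \<longleftrightarrow> A = B" if "A \<in> E_set K" "B \<in> E_set K"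
    proof
      assume *: "E_dist K A B = 0"
      have "opnorm (A t - B t) = 0" for t
        using up[OF that, of t] opnorm_pos[of "A t - B t"] * by linarith
      then show "A = B" by (simp add: opnorm_eq_0_iff fun_eq_iff)
    next
      assume "A = B"
      then show "E_dist K A B = 0"
        by (simp add: E_dist_def opnorm_eq_0_iff[THEN iffD2])
    qed
  next
    fix A B C :: "real \<Rightarrow> 'n bmat"
    assume m: "A \<in> E_set K" "B \<in> E_set K" "C \<in> E_set K"
    have "opnorm (A t - C t) \<le> E_dist K A B + E_dist K B C" for t
      using opnorm_triangle[of "A t - B t" "B t - C t"] up[OF m(1,2), of t] up[OF m(2,3), of t]
      by simp
    then have "(SUP t. opnorm (A t - C t)) \<le> E_dist K A B + E_dist K B C"
      by (intro cSUP_least) auto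
    then show "E_dist K A C \<le> E_dist K A B + E_dist K B C"
      using m by (simp add: E_dist_def)
  qed
qed

lemma mspace_E_metric [simp]: "mspace (E_metric K) = E_set K"
  and mdist_E_metric [simp]: "mdist (E_metric K) = E_dist K"
  unfolding E_metric_def
  by (simp_all add: Metric_space.mspace_metric Metric_space.mdist_metric Metric_space_E)

end

theory Submission
  imports Defs "HOL-Complex_Analysis.Complex_Analysis"
    "HOL-Computational_Algebra.Fundamental_Theorem_Algebra"
begin

text \<open>
  Write \<open>p(M) = det ((M + 1) + i J (M - 1))\<close>. This complex function has no zeros on \<open>Sp\<close>, so every
  path in \<open>Sp\<close> has a well-defined real angle, the change of the argument of \<open>p\<close> along it. The proof
  compares \<open>- \<pi>\<close> times the Maslov-type index with this angle, up to an error that depends only on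
  the dimension, and then studies the angle of the fundamental solution.

  \<^bold>\<open>Index and angle.\<close> Put \<open>G(q, M) = det (q (M + 1) + i J (M - 1))\<close>. For \<open>q > 0\<close> it has no zeros on
  \<open>Sp\<close> (\<open>pdet_nz\<close>), for \<open>q = 0\<close> it is a constant times the real number \<open>det (M - 1)\<close> and vanishes
  exactly on the singular hypersurface. Let \<open>\<xi>\<close> be a path with finitely many transverse crossings. The
  argument of \<open>G\<close> at \<open>q = 0\<close> is constant between crossings, and the derivative of \<open>G\<close> at a crossing of
  sign \<open>\<sigma>\<close> shows that it jumps there by \<open>- \<sigma> \<pi>\<close>. Deforming \<open>q = 0\<close> to \<open>q = 1\<close> gives the
  \<open>crossing_formula\<close>: \<open>- \<pi>\<close> times the sum of the signs is the angle of \<open>\<xi>\<close> plus two end terms.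
  Since \<open>G\<close> is a polynomial of degree at most \<open>2d\<close> in \<open>q\<close>, each end term is at most \<open>2d \<pi>\<close>.
  The angle is a homotopy invariant, so the intersection number is independent of the
  transverse representative, and it is also independent of the small \<open>\<epsilon>\<close> in the definition of the index
  (\<open>maslov_iota_bound\<close>).

  \<^bold>\<open>Existence of a transverse representative.\<close> In the Cayley chart at a point of \<open>Sp\<close>, which is a ball in
  the space of symmetric matrices, a defining function of the hypersurface is affine along every
  line in the direction of a rank-one matrix \<open>v v\<^sup>T\<close>. Such a line which is not
  contained in the hypersurface meets it at most once, and transversely. Symmetric matrices are sums of
  rank-one ones, so polygons made of such edges join all points of a small ball off the hypersurface;
  chart by chart every path can be replaced by them (\<open>deformable_path\<close>).

  \<^bold>\<open>The angle is a quasimorphism.\<close> An explicit homotopy of nonsingular matrices, polynomial in its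
  parameter, shows that multiplying a path by a fixed symplectic matrix changes its angle by a
  bounded amount (\<open>arg_change_product\<close>). Hence the angle of the fundamental solution on \<open>[0, s + t]\<close> is, up to
  a bounded error, the sum of the angles for the systems \<open>B\<close> on \<open>[0, s]\<close> and \<open>B(\<cdot> + s)\<close> on \<open>[0, t]\<close>.

  \<^bold>\<open>Conclusion.\<close> Fix a window length \<open>T\<close>. By a Gronwall estimate that is uniform on \<open>E_set K\<close>, coefficients
  that are sufficiently close have fundamental solutions whose angles differ by at most \<open>2 \<pi>\<close> over any window of
  length \<open>T\<close>. Cutting \<open>[0, l]\<close> into about \<open>l / T\<close> windows, the indices
  differ by at most a constant times \<open>l / T + 2\<close>, where the constant depends only on the dimension
  (\<open>maslov_index_comparison\<close>). After division by \<open>l\<close> the difference is asymptotically \<open>O(1 / T)\<close>, and \<open>T\<close> is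
  arbitrary: this is uniform continuity. Applying the same bound along a chain of small steps from \<open>0\<close> to \<open>B\<close> gives
  finiteness. The negative indices reduce to the positive ones by passing from \<open>B\<close> to
  \<open>t \<mapsto> - B(- t)\<close>.
\<close>

section \<open>Change of argument along a path\<close>

text \<open>The winding number about \<open>0\<close> is also meaningful for paths that are not closed; its real part is
  then the change of the argument divided by \<open>2 \<pi>\<close>.\<close>

definition arg_change :: "(real \<Rightarrow> complex) \<Rightarrow> real" where
  "arg_change p = 2 * pi * Re (winding_number p 0)"

text \<open>Two logarithms of proportional functions differ by a function with values in a translate of the discrete set
  \<open>2 \<pi> i \<int>\<close>, which is therefore constant on a connected set.\<close>

lemma continuous_logs_differ_by_constant:
  fixes g h :: "'a::topological_space \<Rightarrow> complex"
  assumes "connected S" "continuous_on S g" "continuous_on S h"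
    and eq: "\<And>x. x \<in> S \<Longrightarrow> exp (g x) = c * exp (h x)"
  obtains k where "\<And>x. x \<in> S \<Longrightarrow> g x = h x + k"
proof (cases "S = {}")
  case False
  then obtain x0 where "x0 \<in> S" by auto
  have c: "c \<noteq> 0" using eq[OF \<open>x0 \<in> S\<close>] by auto
  have ex: "exp (g x - h x) = c" if "x \<in> S" for x
    using eq[OF that] by (simp add: exp_diff)
  have "(\<lambda>x. g x - h x) constant_on S"
  proof (rule continuous_discrete_range_constant[OF assms(1)])
    show "continuous_on S (\<lambda>x. g x - h x)"
      using assms by (intro continuous_intros)
    fix x assume "x \<in> S"
    show "\<exists>e>0. \<forall>y. y \<in> S \<and> g y - h y \<noteq> g x - h x \<longrightarrow> e \<le> norm (g y - h y - (g x - h x))"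
    proof (intro exI[of _ "2*pi"] conjI allI impI)
      fix y assume y: "y \<in> S \<and> g y - h y \<noteq> g x - h x"
      have "exp (g y - h y) = exp (g x - h x)" using ex y \<open>x \<in> S\<close> by simp
      then obtain n :: int where n: "g y - h y = (g x - h x) + (of_int (2 * n) * pi) * \<i>"
        unfolding exp_eq by blast
      with y have "n \<noteq> 0" by auto
      then have "1 \<le> \<bar>real_of_int n\<bar>" by linarith
      then have "2 * pi \<le> norm ((of_int (2 * n) * pi) * \<i>)"
        by (simp add: norm_mult)
      then show "2 * pi \<le> norm (g y - h y - (g x - h x))"
        by (simp add: n)
    qed simp
  qed
  then obtain k where "\<And>x. x \<in> S \<Longrightarrow> g x - h x = k" unfolding constant_on_def by blast
  then show ?thesis by (intro that[of k]) (metis add.commute diff_add_cancel)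
qed (use that in blast)

lemma arg_change_eq:
  assumes g: "continuous_on {0..1} g" and p: "\<And>t. t \<in> {0..1} \<Longrightarrow> p t = exp (g t)"
  shows "arg_change p = Im (g 1) - Im (g 0)"
proof -
  have "continuous_on {0..1} (\<lambda>t. exp (g t))" by (intro continuous_intros g)
  then have cp: "continuous_on {0..1} p"
    using continuous_on_cong[of "{0..1}" "{0..1}" p "\<lambda>t. exp (g t)"] p by simp
  have "path p" "0 \<notin> path_image p" using cp p by (auto simp: path_def path_image_def)
  then obtain q where q: "path q"
      "pathfinish q - pathstart q = 2 * of_real pi * \<i> * winding_number p 0"
      "\<And>t. t \<in> {0..1} \<Longrightarrow> p t = 0 + exp (q t)"
    using winding_number_as_continuous_log by metis
  have "exp (g t) = 1 * exp (q t)" if "t \<in> {0..1}" for t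
    using p[OF that] q(3)[OF that] by simp
  then obtain k where k: "\<And>t. t \<in> {0..1} \<Longrightarrow> g t = q t + k"
    using continuous_logs_differ_by_constant[of "{0..1::real}" g q 1] g q(1) by (auto simp: path_def)
  have "g 1 - g 0 = 2 * of_real pi * \<i> * winding_number p 0"
    using k[of 1] k[of 0] q(2) by (simp add: pathfinish_def pathstart_def)
  then have "Im (g 1 - g 0) = arg_change p" by (simp add: arg_change_def)
  then show ?thesis by simp
qed

lemma nonvanishing_path_has_log:
  fixes p :: "real \<Rightarrow> complex"
  assumes "continuous_on {0..1::real} p" and "\<And>t. t \<in> {0..1} \<Longrightarrow> p t \<noteq> 0"
  obtains g where "continuous_on {0..1} g" "\<And>t. t \<in> {0..1} \<Longrightarrow> p t = exp (g t)"
  using continuous_logarithm_on_contractible[of "{0..1::real}" p] assms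
  by (metis convex_imp_contractible convex_real_interval(5))

lemma arg_change_mult:
  assumes "continuous_on {0..1} p" "\<And>t. t \<in> {0..1} \<Longrightarrow> p t \<noteq> 0"
    and "continuous_on {0..1} q" "\<And>t. t \<in> {0..1} \<Longrightarrow> q t \<noteq> 0"
  shows "arg_change (\<lambda>t. p t * q t) = arg_change p + arg_change q"
proof -
  obtain g h where "continuous_on {0..1} g" "\<And>t. t \<in> {0..1} \<Longrightarrow> p t = exp (g t)"
    "continuous_on {0..1} h" "\<And>t. t \<in> {0..1} \<Longrightarrow> q t = exp (h t)"
    using nonvanishing_path_has_log assms by metis
  then show ?thesis
    using arg_change_eq[of g p] arg_change_eq[of h q] arg_change_eq[of "\<lambda>t. g t + h t" "\<lambda>t. p t * q t"]
    by (simp add: exp_add continuous_on_add)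
qed

lemma arg_change_const: "c \<noteq> 0 \<Longrightarrow> arg_change (\<lambda>t. c) = 0"
  using arg_change_eq[of "\<lambda>_. Ln c" "\<lambda>t. c"] by simp

lemma arg_change_cmult:
  assumes "continuous_on {0..1} p" "\<And>t. t \<in> {0..1} \<Longrightarrow> p t \<noteq> 0" "c \<noteq> 0"
  shows "arg_change (\<lambda>t. c * p t) = arg_change p"
  using arg_change_mult[of "\<lambda>_. c" p] arg_change_const[of c] assms by simp

lemma arg_change_homotopic:
  assumes "homotopic_paths (- {0}) p q" shows "arg_change p = arg_change q"
  unfolding arg_change_def using winding_number_homotopic_paths[OF assms] by simp

text \<open>A nonvanishing function on a square has a continuous logarithm, so the changes of
  argument along the four edges add up to zero.\<close>

lemma arg_change_square:
  fixes F :: "real \<times> real \<Rightarrow> complex"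
  assumes cont: "continuous_on ({0..1} \<times> {0..1}) F" and nz: "\<And>x. x \<in> {0..1} \<times> {0..1} \<Longrightarrow> F x \<noteq> 0"
  shows "arg_change (\<lambda>t. F (1, t)) - arg_change (\<lambda>t. F (0, t))
       = arg_change (\<lambda>r. F (r, 1)) - arg_change (\<lambda>r. F (r, 0))"
proof -
  have "contractible ({0..1::real} \<times> {0..1::real})"
    by (intro convex_imp_contractible convex_Times convex_real_interval)
  then obtain g where g: "continuous_on ({0..1} \<times> {0..1}) g"
      and Fg: "\<And>x. x \<in> {0..1} \<times> {0..1} \<Longrightarrow> F x = exp (g x)"
    using continuous_logarithm_on_contractible cont nz by metis
  have v: "continuous_on {0..1} (\<lambda>t. g (r, t))" if "r \<in> {0..1}" for r
    by (rule continuous_on_compose2[OF g]) (use that in \<open>auto intro!: continuous_intros\<close>)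
  have h: "continuous_on {0..1} (\<lambda>r. g (r, t))" if "t \<in> {0..1}" for t
    by (rule continuous_on_compose2[OF g]) (use that in \<open>auto intro!: continuous_intros\<close>)
  show ?thesis
    using arg_change_eq[OF v[of 1], of "\<lambda>t. F (1,t)"] arg_change_eq[OF v[of 0], of "\<lambda>t. F (0,t)"]
      arg_change_eq[OF h[of 1], of "\<lambda>t. F (t,1)"] arg_change_eq[OF h[of 0], of "\<lambda>t. F (t,0)"] Fg
    by simp
qed

text \<open>A segment of a line is seen under an angle of at most \<open>\<pi>\<close> from a point outside of it.\<close>

lemma arg_change_linear_factor:
  assumes "\<And>t. t \<in> {0..1} \<Longrightarrow> complex_of_real t \<noteq> \<mu>"
  shows "\<bar>arg_change (\<lambda>t. complex_of_real t - \<mu>)\<bar> \<le> pi"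
proof -
  have mu: "\<mu> \<noteq> 0" using assms[of 0] by auto
  have nn: "1 - complex_of_real t / \<mu> \<notin> \<real>\<^sub>\<le>\<^sub>0" if t: "t \<in> {0..1}" for t
  proof
    assume "1 - complex_of_real t / \<mu> \<in> \<real>\<^sub>\<le>\<^sub>0"
    then obtain x where x: "1 - complex_of_real t / \<mu> = of_real x" "x \<le> 0"
      by (auto elim: nonpos_Reals_cases)
    then have "complex_of_real t / \<mu> = of_real (1 - x)" by (simp add: algebra_simps)
    then have e: "complex_of_real t = of_real (1 - x) * \<mu>" using mu by (simp add: field_simps)
    have "1 - x \<noteq> 0" using x(2) by simp
    then have "complex_of_real (1 - x) \<noteq> 0" by (metis of_real_eq_0_iff)
    then have "\<mu> = complex_of_real t / of_real (1 - x)"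
      using e by (simp add: nonzero_eq_divide_eq mult.commute)
    then have "\<mu> = of_real (t / (1 - x))" by simp
    moreover have "t / (1 - x) \<in> {0..1}" using t x(2) by (auto simp: divide_simps)
    ultimately show False using assms by metis
  qed
  let ?g = "\<lambda>t. Ln (1 - complex_of_real t / \<mu>) + Ln (- \<mu>)"
  have "continuous_on {0..1} ?g"
    by (intro continuous_intros) (use nn mu in auto)
  moreover have "complex_of_real t - \<mu> = exp (?g t)" if "t \<in> {0..1}" for t
  proof -
    have "1 - complex_of_real t / \<mu> \<noteq> 0" using nn[OF that] by force
    then show ?thesis using mu by (simp add: exp_add algebra_simps)
  qed
  ultimately have "arg_change (\<lambda>t. complex_of_real t - \<mu>) = Im (?g 1) - Im (?g 0)"
    by (rule arg_change_eq)
  also have "\<dots> = Im (Ln (1 - 1 / \<mu>))" by simp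
  finally show ?thesis
    using mpi_less_Im_Ln[of "1 - 1/\<mu>"] Im_Ln_le_pi[of "1 - 1/\<mu>"] nn[of 1] by force
qed

text \<open>A polynomial splits into linear factors, each of which contributes at most \<open>\<pi>\<close>.\<close>

lemma arg_change_poly_bound:
  fixes p :: "complex poly"
  assumes "\<And>t. t \<in> {0..1} \<Longrightarrow> poly p (complex_of_real t) \<noteq> 0"
  shows "\<bar>arg_change (\<lambda>t. poly p (complex_of_real t))\<bar> \<le> degree p * pi"
  using assms
proof (induction "degree p" arbitrary: p)
  case 0
  then obtain c where "p = [:c:]" by (metis degree_eq_zeroE)
  then show ?case using 0(2)[of 0] arg_change_const[of c] by simp
next
  case (Suc n)
  then have "\<not> constant (poly p)" by (simp add: constant_degree)
  then obtain \<mu> where "poly p \<mu> = 0" using fundamental_theorem_of_algebra by blast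
  then obtain q where q: "p = [:-\<mu>, 1:] * q" by (auto simp: poly_eq_0_iff_dvd elim: dvdE)
  have "p \<noteq> 0" using Suc.hyps(2) by auto
  then have "q \<noteq> 0" using q by auto
  then have dq: "n = degree q"
    using Suc.hyps(2) degree_mult_eq[of "[:-\<mu>, 1:]" q] unfolding q by simp
  have pq: "poly p z = (z - \<mu>) * poly q z" for z by (simp add: q algebra_simps)
  have nq: "\<And>t. t \<in> {0..1} \<Longrightarrow> poly q (complex_of_real t) \<noteq> 0"
    and nm: "\<And>t. t \<in> {0..1} \<Longrightarrow> complex_of_real t - \<mu> \<noteq> 0"
    using Suc.prems unfolding pq by auto
  have "arg_change (\<lambda>t. poly p (complex_of_real t))
      = arg_change (\<lambda>t. complex_of_real t - \<mu>) + arg_change (\<lambda>t. poly q (complex_of_real t))"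
    unfolding pq by (rule arg_change_mult) (use nq nm in \<open>auto intro!: continuous_intros\<close>)
  moreover have "\<bar>arg_change (\<lambda>t. complex_of_real t - \<mu>)\<bar> \<le> pi"
    by (rule arg_change_linear_factor) (use nm in fastforce)
  moreover have "\<bar>arg_change (\<lambda>t. poly q (complex_of_real t))\<bar> \<le> degree q * pi"
    by (rule Suc.hyps(1)[OF dq nq])
  ultimately show ?case using dq Suc.hyps(2) by (simp flip: Suc.hyps(2) add: algebra_simps)
qed

lemma arg_change_poly_bound':
  fixes p :: "complex poly"
  assumes "degree p \<le> n" "\<And>t. t \<in> {0..1} \<Longrightarrow> poly p (complex_of_real t) \<noteq> 0"
  shows "\<bar>arg_change (\<lambda>t. poly p (complex_of_real t))\<bar> \<le> n * pi"
proof -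
  have "real (degree p) * pi \<le> n * pi" using assms(1) by (intro mult_right_mono) auto
  then show ?thesis using arg_change_poly_bound[OF assms(2)] by linarith
qed

text \<open>Together with the bound for polynomials this controls the change of argument of
  a determinant along any line of matrices by the size of the matrix.\<close>

lemma det_affine_poly:
  fixes A B :: "complex ^ 'm ^ 'm"
  obtains p where "degree p \<le> CARD('m)" "\<And>z. poly p z = det (\<chi> i j. A $ i $ j + z * B $ i $ j)"
proof
  let ?p = "\<Sum>\<sigma> | \<sigma> permutes (UNIV::'m set). [:of_int (sign \<sigma>):] *
      (\<Prod>i\<in>UNIV. [:A $ i $ \<sigma> i, B $ i $ \<sigma> i:])"
  show "degree ?p \<le> CARD('m)"
  proof (rule degree_sum_le)
    fix \<sigma> :: "'m \<Rightarrow> 'm"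
    have "degree (\<Prod>i\<in>UNIV. [:A $ i $ \<sigma> i, B $ i $ \<sigma> i:]) \<le> (\<Sum>i\<in>(UNIV::'m set). degree [:A $ i $ \<sigma> i, B $ i $ \<sigma> i:])"
      using degree_prod_sum_le[of UNIV "\<lambda>i. [:A $ i $ \<sigma> i, B $ i $ \<sigma> i:]"] by (simp add: o_def)
    also have "\<dots> \<le> (\<Sum>i\<in>(UNIV::'m set). 1)" by (intro sum_mono) simp
    finally show "degree ([:of_int (sign \<sigma>):] * (\<Prod>i\<in>UNIV. [:A $ i $ \<sigma> i, B $ i $ \<sigma> i:])) \<le> CARD('m)"
      using degree_mult_le[of "[:of_int (sign \<sigma>):]" "\<Prod>i\<in>UNIV. [:A $ i $ \<sigma> i, B $ i $ \<sigma> i:]"] by simp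
  qed simp
  show "poly ?p z = det (\<chi> i j. A $ i $ j + z * B $ i $ j)" for z
    unfolding det_def poly_sum poly_mult poly_prod by simp
qed

section \<open>Complexified symplectic matrices and the Cayley pencil\<close>

lemma matrix_diff_ldistrib: "A ** (B - C) = A ** B - A ** (C :: 'a::ring_1 ^ 'm ^ 'n)"
  by (simp add: matrix_matrix_mult_def vec_eq_iff right_diff_distrib sum_subtractf)

lemma matrix_diff_rdistrib: "(A - B) ** C = A ** C - B ** (C :: 'a::ring_1 ^ 'm ^ 'n)"
  by (simp add: matrix_matrix_mult_def vec_eq_iff left_diff_distrib sum_subtractf)

lemma matrix_add_rdistrib: "(A + B) ** C = A ** C + B ** (C :: 'a::ring_1 ^ 'm ^ 'n)"
  by (simp add: matrix_matrix_mult_def vec_eq_iff distrib_right sum.distrib)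

lemma matrix_minus_left: "(- A) ** C = - (A ** (C :: 'a::ring_1 ^ 'm ^ 'n))"
  by (simp add: matrix_matrix_mult_def vec_eq_iff sum_negf)

lemma matrix_minus_right: "A ** (- C) = - (A ** (C :: 'a::ring_1 ^ 'm ^ 'n))"
  by (simp add: matrix_matrix_mult_def vec_eq_iff sum_negf)

lemmas matrix_ring_simps = matrix_diff_ldistrib matrix_diff_rdistrib matrix_add_ldistrib
  matrix_add_rdistrib matrix_minus_left matrix_minus_right

lemma mat_mult_nth: "(mat c ** A) $ i $ j = c * A $ i $ (j :: 'm::finite)" for A :: "'a::semiring_1 ^ 'm ^ 'm"
  by (simp add: matrix_matrix_mult_def mat_def if_distrib if_distribR cong: if_cong)

lemma mat_vector_mult: "mat c *v x = c *s (x :: 'a::semiring_1 ^ 'm)"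
  by (simp add: vec_eq_iff matrix_vector_mult_def mat_def if_distrib if_distribR cong: if_cong)

lemma det_nz_iff_kernel: "det A \<noteq> 0 \<longleftrightarrow> (\<forall>x. A *v x = 0 \<longrightarrow> x = 0)" for A :: "'a::field ^ 'm ^ 'm"
  by (simp add: invertible_det_nz[symmetric] invertible_left_inverse matrix_left_invertible_ker)

lemma det_zero_kernel:
  fixes A :: "'a::field ^ 'm ^ 'm"
  assumes "det A = 0" obtains v where "v \<noteq> 0" "A *v v = 0"
  using assms det_nz_iff_kernel by blast

lemma continuous_on_vec_nth2:
  fixes A :: "'b::topological_space \<Rightarrow> 'a::topological_space ^ 'm ^ 'n"
  shows "continuous_on S A \<Longrightarrow> continuous_on S (\<lambda>x. A x $ i $ j)"
  by (intro continuous_intros)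

lemma continuous_on_matrix_mult [continuous_intros]:
  fixes A :: "'b::topological_space \<Rightarrow> 'a::real_normed_field ^ 'm ^ 'n" and B :: "_ \<Rightarrow> 'a ^ 'k ^ 'm"
  assumes "continuous_on S A" "continuous_on S B"
  shows "continuous_on S (\<lambda>x. A x ** B x)"
  unfolding matrix_matrix_mult_def
  by (intro continuous_intros continuous_on_vec_nth2 assms)

lemma continuous_on_det [continuous_intros]:
  fixes A :: "'b::topological_space \<Rightarrow> 'a::real_normed_field ^ 'm ^ 'm"
  assumes "continuous_on S A"
  shows "continuous_on S (\<lambda>x. det (A x))"
  unfolding det_def by (intro continuous_intros continuous_on_vec_nth2 assms)

lemma continuous_on_mat [continuous_intros]:
  fixes f :: "'b::topological_space \<Rightarrow> 'a::real_normed_field"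
  assumes "continuous_on S f"
  shows "continuous_on S (\<lambda>x. mat (f x) :: 'a ^ 'm ^ 'm)"
proof -
  have "continuous_on S (\<lambda>x. if i = j then f x else 0)" for i j :: 'm
    using assms by (cases "i = j") auto
  then show ?thesis unfolding mat_def by (intro continuous_on_vec_lambda)
qed

lemma continuous_on_cmat [continuous_intros]:
  "continuous_on S A \<Longrightarrow> continuous_on S (\<lambda>x. cmat (A x))"
  unfolding cmat_def by (intro continuous_intros continuous_on_vec_nth2)

lemma cmat_mult: "cmat (A ** B) = cmat A ** cmat B"
  by (simp add: cmat_def vec_eq_iff matrix_matrix_mult_def)

lemma cmat_mat [simp]: "cmat (mat c) = mat (complex_of_real c)"
  by (simp add: cmat_def vec_eq_iff mat_def)

lemma cmat_diff: "cmat (A - B) = cmat A - cmat B" by (simp add: cmat_def vec_eq_iff)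
lemma cmat_scaleR: "cmat (r *\<^sub>R A) = mat (of_real r) ** cmat A"
  by (simp add: cmat_def vec_eq_iff mat_mult_nth)

lemma det_cmat: "det (cmat A) = complex_of_real (det A)"
  by (simp add: det_def cmat_def)

lemma transpose_Jmat: "transpose Jmat = - (Jmat :: 'n::finite bmat)"
proof -
  have "transpose Jmat $ i $ j = - (Jmat :: 'n bmat) $ i $ j" for i j
    by (cases i; cases j) (auto simp: transpose_def Jmat_def)
  then show ?thesis by (simp add: vec_eq_iff)
qed

text \<open>The matrix \<open>i J\<close>. It is a Hermitian involution, and \<open>x \<bullet> (Ji *v x)\<close> is the indefinite Hermitian (Krein) form
  that is preserved by symplectic matrices. The matrices \<open>(mat 1 + Ji) / 2\<close> and \<open>(mat 1 - Ji) / 2\<close> are the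
  projections onto its positive and negative subspaces.\<close>

definition Ji :: "complex ^ ('n::finite + 'n) ^ ('n + 'n)" where
  "Ji = mat \<i> ** cmat Jmat"

lemma Ji_square: "Ji *v (Ji *v x) = (x :: complex ^ ('n::finite + 'n))"
proof -
  have "Ji *v (Ji *v x) = \<i> *s (cmat Jmat *v (\<i> *s (cmat Jmat *v x)))"
    by (simp add: Ji_def mat_vector_mult flip: matrix_vector_mul_assoc)
  also have "\<dots> = - (cmat (Jmat ** Jmat) *v x)"
    by (simp add: vector_scalar_commute cmat_mult vec_eq_iff flip: matrix_vector_mul_assoc)
  also have "\<dots> = x"
    by (simp add: Jmat_square cmat_def matrix_vector_mult_def vec_eq_iff mat_def sum_negf
        if_distrib if_distribR cong: if_cong)
  finally show ?thesis .
qed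

lemma det_Ji: "det (Ji :: complex ^ ('n::finite + 'n) ^ ('n + 'n)) \<noteq> 0"
  unfolding det_nz_iff_kernel using Ji_square by (metis matrix_vector_mult_0_right)

text \<open>The conjugate transpose, which is the adjoint for the real inner product on complex vectors (the
  real part of the Hermitian product).\<close>

definition adj :: "complex ^ 'm ^ 'm \<Rightarrow> complex ^ 'm ^ 'm" where
  "adj A = (\<chi> i j. cnj (A $ j $ i))"

lemma inner_matrix_vector: "x \<bullet> (A *v y) = (adj A *v x) \<bullet> y" for A :: "complex ^ 'm ^ 'm"
proof -
  have c: "a \<bullet> (b * c) = (cnj b * a) \<bullet> c" for a b c :: complex
    by (simp add: inner_complex_def algebra_simps)
  have "x \<bullet> (A *v y) = (\<Sum>i\<in>UNIV. \<Sum>j\<in>UNIV. x $ i \<bullet> (A $ i $ j * y $ j))"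
    by (simp add: inner_vec_def matrix_vector_mult_def inner_sum_right)
  also have "\<dots> = (\<Sum>j\<in>UNIV. \<Sum>i\<in>UNIV. (cnj (A $ i $ j) * x $ i) \<bullet> y $ j)"
    unfolding c by (rule sum.swap)
  also have "\<dots> = (adj A *v x) \<bullet> y"
    by (simp add: inner_vec_def matrix_vector_mult_def inner_sum_left adj_def)
  finally show ?thesis .
qed

lemma adj_Ji: "adj Ji = (Ji :: complex ^ ('n::finite + 'n) ^ ('n + 'n))"
proof -
  have *: "Jmat $ j $ i = - (Jmat :: 'n bmat) $ i $ j" for i j
    using arg_cong[OF transpose_Jmat, of "\<lambda>A. A $ i $ j"] by (simp add: transpose_def)
  have "adj (Ji :: complex ^ ('n + 'n) ^ ('n + 'n)) $ i $ j = Ji $ i $ j" for i j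
    using *[of j i] unfolding adj_def Ji_def by (simp add: mat_mult_nth cmat_def)
  then show ?thesis by (simp add: vec_eq_iff)
qed

lemma inner_Ji: "x \<bullet> (Ji *v y) = (Ji *v x) \<bullet> y"
  using inner_matrix_vector[of x Ji y] by (simp add: adj_Ji)

lemma Sp_mult: "M \<in> Sp \<Longrightarrow> N \<in> Sp \<Longrightarrow> M ** N \<in> Sp"
  unfolding Sp_def by (simp add: matrix_transpose_mul) (metis matrix_mul_assoc)

lemma mat_1_in_Sp: "mat 1 \<in> Sp" by (simp add: Sp_def)

lemma Sp_inj:
  assumes M: "M \<in> Sp" and "cmat M *v x = 0" shows "x = 0"
proof -
  have "Ji *v x = 0"
  proof -
    have "cmat Jmat *v x = cmat (transpose M ** Jmat ** M) *v x"
      using M by (simp add: Sp_def)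
    also have "\<dots> = 0" using assms(2)
      by (simp add: cmat_mult flip: matrix_vector_mul_assoc)
    finally show ?thesis by (simp add: Ji_def flip: matrix_vector_mul_assoc)
  qed
  then show ?thesis using Ji_square[of x] by simp
qed

lemma Sp_form:
  assumes M: "M \<in> Sp"
  shows "(cmat M *v x) \<bullet> (Ji *v (cmat M *v x)) = x \<bullet> (Ji *v x)"
proof -
  have a: "adj (cmat M) = cmat (transpose M)" by (simp add: adj_def cmat_def transpose_def)
  have "(cmat M *v x) \<bullet> (Ji *v (cmat M *v x)) = (Ji *v (cmat M *v x)) \<bullet> (cmat M *v x)"
    by (rule inner_commute)
  also have "\<dots> = (cmat (transpose M) *v (Ji *v (cmat M *v x))) \<bullet> x"
    by (simp only: inner_matrix_vector a)
  also have "cmat (transpose M) *v (Ji *v (cmat M *v x)) = \<i> *s (cmat (transpose M ** Jmat ** M) *v x)"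
    by (simp add: Ji_def mat_vector_mult vector_scalar_commute cmat_mult flip: matrix_vector_mul_assoc)
  also have "\<dots> = Ji *v x" using M
    by (simp add: Sp_def Ji_def mat_vector_mult flip: matrix_vector_mul_assoc)
  finally show ?thesis by (simp add: inner_commute)
qed

text \<open>The parameter \<open>q\<close> interpolates between \<open>Ji ** (M - mat 1)\<close>, which detects the eigenvalue \<open>1\<close> of \<open>M\<close>, and the
  matrix \<open>(mat 1 + Ji) ** M + (mat 1 - Ji)\<close> at \<open>q = 1\<close>, which is nonsingular for every symplectic \<open>M\<close>.\<close>

definition pencil :: "complex \<Rightarrow> 'n::finite bmat \<Rightarrow> complex ^ ('n + 'n) ^ ('n + 'n)" where
  "pencil q M = mat q ** (cmat M + mat 1) + Ji ** (cmat M - mat 1)"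

definition pdet :: "complex \<Rightarrow> 'n::finite bmat \<Rightarrow> complex" where
  "pdet q M = det (pencil q M)"

lemma pencil_mv: "pencil q M *v x = q *s (cmat M *v x + x) + Ji *v (cmat M *v x - x)"
  by (simp add: pencil_def matrix_vector_mult_add_rdistrib mat_vector_mult
      matrix_vector_mult_diff_rdistrib flip: matrix_vector_mul_assoc)

text \<open>If \<open>q (y + x) + i J (y - x) = 0\<close> with \<open>y = M x\<close>, pair this with \<open>y + x\<close>. The second summand contributes the
  difference of the Krein forms of \<open>y\<close> and \<open>x\<close>, which is zero as \<open>M\<close> preserves the form; hence
  \<open>y + x = 0\<close>.\<close>

lemma pdet_nz:
  assumes M: "M \<in> Sp" and q: "q > 0"
  shows "pdet (complex_of_real q) M \<noteq> 0"
  unfolding pdet_def det_nz_iff_kernel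
proof (intro allI impI)
  fix x assume 0: "pencil (complex_of_real q) M *v x = 0"
  define y where "y = cmat M *v x"
  have sc: "complex_of_real q *s z = q *\<^sub>R z" for z :: "complex ^ ('a + 'a)"
    by (simp add: vec_eq_iff scaleR_conv_of_real[where 'a=complex])
  have e: "q *\<^sub>R (y + x) + Ji *v (y - x) = 0" using 0 unfolding pencil_mv y_def sc .
  have "(y + x) \<bullet> (Ji *v (y - x)) = y \<bullet> (Ji *v y) - x \<bullet> (Ji *v x) + (x \<bullet> (Ji *v y) - y \<bullet> (Ji *v x))"
    by (simp add: algebra_simps inner_add_left inner_diff_left inner_diff_right)
  also have "\<dots> = 0" using Sp_form[OF M, of x] inner_Ji[of x y]
    by (simp add: y_def inner_commute)
  finally have "q * ((y + x) \<bullet> (y + x)) = (y + x) \<bullet> (q *\<^sub>R (y + x) + Ji *v (y - x))"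
    by (simp add: inner_add_right)
  then have s: "y + x = 0" using e q by simp
  then have "Ji *v (y - x) = 0" using e by simp
  then have "y - x = 0" using Ji_square[of "y - x"] by simp
  then show "x = 0" using s by (simp add: vec_eq_iff)
qed

lemma pdet_poly:
  fixes M :: "'n::finite bmat"
  obtains p where "degree p \<le> CARD('n + 'n)" "\<And>q. poly p q = pdet q M"
proof -
  obtain p where p: "degree p \<le> CARD('n + 'n)"
    "\<And>z. poly p z = det (\<chi> i j. (Ji ** (cmat M - mat 1)) $ i $ j + z * (cmat M + mat 1) $ i $ j)"
    using det_affine_poly by blast
  have "poly p q = pdet q M" for q
    unfolding p(2) pdet_def pencil_def
    by (rule arg_cong[where f = det]) (simp add: vec_eq_iff mat_mult_nth)
  with p(1) show ?thesis using that by blast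
qed

lemma pdet_0: "pdet 0 M = det (Ji :: complex ^ ('n + 'n) ^ ('n + 'n)) * complex_of_real (det (M - mat 1))"
  for M :: "'n::finite bmat"
proof -
  have "pencil 0 M = Ji ** cmat (M - mat 1)" by (simp add: pencil_def cmat_diff)
  then show ?thesis by (simp add: pdet_def det_mul det_cmat)
qed

lemma det_minus_1: "det_minus 1 M = complex_of_real (det (M - mat 1))"
  by (simp add: det_minus_def cmat_diff flip: det_cmat)

lemma Sp0_1: "M \<in> Sp0 1 \<longleftrightarrow> M \<in> Sp \<and> det (M - mat 1) = 0"
  by (simp add: Sp0_def det_minus_1)

lemma pdet_0_nz: "M \<in> Sp \<Longrightarrow> M \<notin> Sp0 1 \<Longrightarrow> pdet 0 M \<noteq> 0"
  by (simp add: pdet_0 Sp0_1 det_Ji)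

lemma pdet_nz':
  assumes "M \<in> Sp" "q \<ge> 0" "M \<notin> Sp0 1 \<or> q > 0"
  shows "pdet (complex_of_real q) M \<noteq> 0"
  using assms pdet_nz[of M q] pdet_0_nz[of M] by (cases "q = 0") auto

lemma continuous_on_pdet [continuous_intros]:
  "continuous_on S f \<Longrightarrow> continuous_on S A \<Longrightarrow> continuous_on S (\<lambda>x. pdet (f x) (A x))"
  unfolding pdet_def pencil_def by (intro continuous_intros)

text \<open>The perturbation \<open>exp (- \<epsilon> J)\<close> that moves the ends of a path off the singular hypersurface.\<close>

definition rot :: "real \<Rightarrow> 'n::finite bmat" where
  "rot \<epsilon> = mexp ((- \<epsilon>) *\<^sub>R Jmat)"

lemma rot_eq: "rot \<epsilon> = cos \<epsilon> *\<^sub>R mat 1 - sin \<epsilon> *\<^sub>R Jmat"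
  unfolding rot_def mexp_Jmat by simp

lemma transpose_scaleR_diff: "transpose (a *\<^sub>R A - b *\<^sub>R B) = a *\<^sub>R transpose A - b *\<^sub>R transpose B"
  by (simp add: transpose_def vec_eq_iff)

lemma rot_in_Sp: "rot \<epsilon> \<in> Sp"
proof -
  have "transpose (rot \<epsilon>) ** Jmat ** rot \<epsilon> = (cos \<epsilon> * cos \<epsilon> + sin \<epsilon> * sin \<epsilon>) *\<^sub>R (Jmat :: 'a bmat)"
    by (simp add: rot_eq transpose_scaleR_diff transpose_Jmat matrix_ring_simps
        matrix_scalar_ac Jmat_square scaleR_add_left scaleR_diff_right del: sin_cos_squared_add3
        flip: scalar_matrix_assoc matrix_mul_assoc)
  then show ?thesis by (simp add: Sp_def sin_cos_squared_add3)
qed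

lemma rot_0: "rot 0 = mat 1" by (simp add: rot_eq)

lemma continuous_on_rot [continuous_intros]:
  fixes f :: "'b::t2_space \<Rightarrow> real"
  shows
  "continuous_on S f \<Longrightarrow> continuous_on S (\<lambda>x. rot (f x))"
  unfolding rot_eq by (intro continuous_intros)

lemma cmat_rot_mv: "cmat (rot \<epsilon>) *v x = complex_of_real (cos \<epsilon>) *s x + (\<i> * complex_of_real (sin \<epsilon>)) *s (Ji *v x)"
proof -
  have "cmat Jmat *v x = (- \<i>) *s (Ji *v x)"
    by (simp add: Ji_def mat_vector_mult vec_eq_iff flip: matrix_vector_mul_assoc)
  then show ?thesis
    by (simp add: rot_eq cmat_diff cmat_scaleR matrix_vector_mult_diff_rdistrib mat_vector_mult
        vec_eq_iff algebra_simps flip: matrix_vector_mul_assoc)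
qed

text \<open>The pencil at \<open>q = 1\<close> is \<open>(mat 1 + Ji) ** M + (mat 1 - Ji)\<close>. The matrix \<open>exp (- \<epsilon> J)\<close> acts on the range of \<open>mat 1 + Ji\<close> as
  multiplication by \<open>exp (i \<epsilon>)\<close>, so that it only multiplies one of the two blocks by a phase and
  the determinant by a constant.\<close>

lemma pdet_1_rot:
  obtains c where "\<And>M :: 'n::finite bmat. pdet 1 (rot \<epsilon> ** M) = c * pdet 1 M"
proof -
  define E :: "complex ^ ('n + 'n) ^ ('n + 'n)" where
    "E = mat (exp (\<i> * \<epsilon>) / 2) ** (mat 1 + Ji) + mat (1/2) ** (mat 1 - Ji)"
  have "pencil 1 (rot \<epsilon> ** M) *v x = (E ** pencil 1 M) *v x" for M :: "'n bmat" and x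
    unfolding pencil_mv matrix_vector_mul_assoc[symmetric, of E] E_def cmat_mult
      matrix_vector_mul_assoc[symmetric, of "cmat (rot \<epsilon>)"] cmat_rot_mv
    by (simp add: pencil_mv matrix_vector_mult_add_rdistrib matrix_vector_mult_diff_rdistrib mat_vector_mult
        vector_scalar_commute Ji_square flip: matrix_vector_mul_assoc)
       (simp add: vec_eq_iff exp_Euler algebra_simps add_divide_distrib vector_scalar_commute Ji_square cos_of_real sin_of_real)
  then have "pencil 1 (rot \<epsilon> ** M) = E ** pencil 1 M" for M :: "'n bmat"
    using matrix_eq by blast
  then have "pdet 1 (rot \<epsilon> ** M) = det E * pdet 1 M" for M :: "'n bmat"
    by (simp add: pdet_def det_mul)
  then show ?thesis using that by blast
qed

text \<open>The equation \<open>exp (- \<epsilon> J) M x = x\<close>, written in terms of the half angle, says that \<open>x\<close> is in the kernel of the pencil of \<open>M\<close> at the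
  imaginary parameter \<open>q = i tan (\<epsilon> / 2)\<close>. As a polynomial in \<open>q\<close> which does not vanish at \<open>q = 1\<close>, the determinant
  of the pencil has isolated zeros.\<close>

lemma rot_off_Sp0:
  fixes M :: "'n::finite bmat"
  assumes M: "M \<in> Sp"
  shows "\<forall>\<^sub>F \<epsilon> in at_right 0. rot \<epsilon> ** M \<notin> Sp0 1"
proof -
  obtain p where p: "\<And>q. poly p q = pdet q M" using pdet_poly by blast
  have "p \<noteq> 0" using p[of 1] pdet_nz[OF M, of 1] by auto
  then have fin: "finite {z. poly p z = 0}" by (rule poly_roots_finite)
  have cl: "closed ({z. poly p z = 0} - {0})" using fin by (intro finite_imp_closed) auto
  then have "open (- ({z. poly p z = 0} - {0}))" by (rule open_Compl)
  then have ev: "\<forall>\<^sub>F z in at 0. poly p z \<noteq> 0"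
    unfolding eventually_at_topological by (intro exI[of _ "- ({z. poly p z = 0} - {0})"]) auto
  have "((\<lambda>\<epsilon>::real. \<i> * complex_of_real (tan (\<epsilon>/2))) \<longlongrightarrow> \<i> * of_real (tan (0/2))) (at_right 0)"
    by (intro tendsto_intros) auto
  moreover have small: "\<forall>\<^sub>F \<epsilon>::real in at_right 0. 0 < \<epsilon> \<and> \<epsilon> < 1"
    by (auto simp: eventually_at_right_field intro: exI[of _ 1])
  have tanpos: "tan (\<epsilon>/2) > 0" "cos (\<epsilon>/2) > 0" if "0 < \<epsilon>" "\<epsilon> < 1" for \<epsilon> :: real
    using that pi_gt3 by (auto intro!: tan_gt_zero cos_gt_zero)
  moreover have "\<forall>\<^sub>F \<epsilon>::real in at_right 0. \<i> * complex_of_real (tan (\<epsilon>/2)) \<noteq> 0"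
    using small by eventually_elim (use tanpos in force)
  ultimately have "filterlim (\<lambda>\<epsilon>::real. \<i> * complex_of_real (tan (\<epsilon>/2))) (at 0) (at_right 0)"
    by (simp add: filterlim_at)
  from eventually_compose_filterlim[OF ev this] small show ?thesis
  proof eventually_elim
    case (elim \<epsilon>)
    define C S where "C = complex_of_real (cos (\<epsilon>/2))" and "S = complex_of_real (sin (\<epsilon>/2))"
    define q where "q = \<i> * complex_of_real (tan (\<epsilon>/2))"
    have C: "C \<noteq> 0" using tanpos[of \<epsilon>] elim by (simp add: C_def)
    have q: "C * q = \<i> * S" using tanpos[of \<epsilon>] elim by (simp add: C_def S_def q_def tan_def)
    have cs: "complex_of_real (cos \<epsilon>) = C * C - S * S" "complex_of_real (sin \<epsilon>) = 2 * S * C"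
      and one: "C * C + S * S = 1"
      using cos_double[of "\<epsilon>/2"] sin_double[of "\<epsilon>/2"] sin_cos_squared_add[of "\<epsilon>/2"]
      by (simp_all add: C_def S_def power2_eq_square flip: of_real_mult of_real_diff of_real_add) 
         (simp_all add: add.commute)
    have "det (cmat (rot \<epsilon> ** M - mat 1)) \<noteq> 0"
      unfolding det_nz_iff_kernel
    proof (intro allI impI)
      fix x assume 0: "cmat (rot \<epsilon> ** M - mat 1) *v x = 0"
      define y where "y = cmat M *v x"
      have 1: "C * C *s y - S * S *s y + (2 * \<i> * S * C) *s (Ji *v y) - x = 0"
        using 0 by (simp add: cmat_diff cmat_mult matrix_vector_mult_diff_rdistrib cmat_rot_mv cs y_def
            vec_eq_iff algebra_simps flip: matrix_vector_mul_assoc)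
      have jx: "x = C * C *s y - S * S *s y + (2 * \<i> * S * C) *s (Ji *v y)"
        using 1 by (simp add: algebra_simps)
      have "C *s (pencil q M *v x) = (\<i> * S) *s (y + x) + C *s (Ji *v (y - x))"
        by (simp add: pencil_mv y_def[symmetric] vec_eq_iff algebra_simps q[symmetric])
      also have "\<dots> = 0"
      proof -
        have "Ji *v x = (C * C - S * S) *s (Ji *v y) + (2 * \<i> * S * C) *s y"
          unfolding jx by (simp add: algebra_simps vector_scalar_commute Ji_square vec_eq_iff)
        then have "(Ji *v x) $ i = (C * C - S * S) * (Ji *v y) $ i + (2 * \<i> * S * C) * y $ i" for i
          using arg_cong[of "Ji *v x" _ "\<lambda>v. v $ i"] by (simp add: left_diff_distrib)
        moreover have "((\<i> * S) *s (y + x) + C *s (Ji *v (y - x))) $ i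
            = (\<i> * S) * (y $ i + x $ i) + C * ((Ji *v y) $ i - (Ji *v x) $ i)" for i
          by (simp add: matrix_vector_mult_diff_distrib distrib_left right_diff_distrib)
        moreover have "x $ i = (C * C - S * S) * y $ i + (2 * \<i> * S * C) * (Ji *v y) $ i" for i
          using arg_cong[OF jx, of "\<lambda>v. v $ i"] by (simp add: algebra_simps)
        moreover have "(\<i> * S) * (a + ((C * C - S * S) * a + (2 * \<i> * S * C) * b)) +
              C * (b - ((C * C - S * S) * b + (2 * \<i> * S * C) * a)) = 0" for a b
        proof -
          have "(\<i> * S) * (a + ((C * C - S * S) * a + (2 * \<i> * S * C) * b)) +
              C * (b - ((C * C - S * S) * b + (2 * \<i> * S * C) * a))
              = (1 - (C * C + S * S)) * (\<i> * S * a + C * b)"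
            by (simp add: algebra_simps)
          then show ?thesis using one by simp
        qed
        ultimately show ?thesis by (simp add: vec_eq_iff)
      qed
      finally have "pencil q M *v x = 0" using C by (simp add: vec_eq_iff)
      moreover have "pdet q M \<noteq> 0" using elim p by (simp add: q_def)
      ultimately show "x = 0" unfolding pdet_def det_nz_iff_kernel by blast
    qed
    then show ?case by (simp add: det_cmat Sp0_1)
  qed
qed

section \<open>Derivative of the determinant at a singular matrix\<close>

lemma bounded_bilinear_matrix_mult:
  "bounded_bilinear ((**) :: 'a::{euclidean_space,real_normed_field} ^ 'm ^ 'n \<Rightarrow> 'a ^ 'k ^ 'm \<Rightarrow> 'a ^ 'k ^ 'n)"
proof -
  have "bilinear ((**) :: 'a ^ 'm ^ 'n \<Rightarrow> 'a ^ 'k ^ 'm \<Rightarrow> 'a ^ 'k ^ 'n)"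
    unfolding bilinear_def
    by (auto intro!: linearI simp: vec_eq_iff matrix_matrix_mult_def sum.distrib algebra_simps
        scaleR_sum_right)
  then show ?thesis by (simp add: bilinear_conv_bounded_bilinear)
qed

lemma bounded_linear_cmat: "bounded_linear (cmat :: real ^ 'm ^ 'm \<Rightarrow> _)"
  unfolding linear_conv_bounded_linear[symmetric]
  by (rule linearI) (simp_all add: cmat_def vec_eq_iff scaleR_conv_of_real[where 'a=complex])

lemma bounded_linear_mat: "bounded_linear (mat :: 'a::{euclidean_space,real_normed_field} \<Rightarrow> 'a ^ 'm ^ 'm)"
  unfolding linear_conv_bounded_linear[symmetric]
  by (rule linearI) (simp_all add: mat_def vec_eq_iff)

lemma det_differentiable:
  "det differentiable (at (Y :: 'a::{euclidean_space,real_normed_field} ^ 'm ^ 'm))"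
proof -
  have n: "((\<lambda>A. A $ i $ j) has_derivative (\<lambda>H. H $ i $ j)) (at Y)" for i j
    by (rule bounded_linear_imp_has_derivative)
       (rule bounded_linear_compose[OF bounded_linear_vec_nth bounded_linear_vec_nth])
  have "(\<lambda>A :: 'a ^ 'm ^ 'm. \<Sum>p | p permutes UNIV. of_int (sign p) * (\<Prod>i\<in>UNIV. A $ i $ p i)) differentiable (at Y)"
    unfolding differentiable_def
    by (rule exI, rule has_derivative_sum, rule has_derivative_mult, rule has_derivative_const,
        rule has_derivative_prod, rule n)
  then show ?thesis unfolding det_def[abs_def] .
qed

lemma left_kernel_det_zero:
  fixes A :: "'a::field ^ 'm ^ 'm"
  assumes "transpose A *v w = 0" "w \<noteq> 0" shows "det A = 0"
  using assms det_nz_iff_kernel[of "transpose A"] by (auto simp: det_transpose)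

lemma scaleR_mv: "(t *\<^sub>R A) *v x = t *\<^sub>R (A *v x)" for A :: "'a::real_normed_field ^ 'm ^ 'n"
  by (simp add: matrix_vector_mult_def vec_eq_iff scaleR_sum_right)

text \<open>By Jacobi's formula the derivative is the trace of the adjugate times \<open>H\<close>, and the adjugate of a singular matrix with
  right kernel vector \<open>v\<close> and left kernel vector \<open>w\<close> is a multiple of \<open>v w\<^sup>T\<close>. The proof avoids adjugates: the
  derivative is zero in the directions \<open>H\<close> with \<open>H v = 0\<close> or \<open>w\<^sup>T H = 0\<close>, because the
  determinant remains zero along these lines, and any \<open>H\<close> is congruent to a multiple of a fixed matrix modulo
  such directions.\<close>

lemma det_derivative_at_singular:
  fixes Y :: "complex ^ 'm ^ 'm"
  assumes D: "(det has_derivative D) (at Y)"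
    and v: "Y *v v = 0" "v \<noteq> 0" and w: "transpose Y *v w = 0" "w \<noteq> 0"
  obtains \<kappa> where "\<And>H. D H = \<kappa> * (\<Sum>i\<in>UNIV. w $ i * (H *v v) $ i)"
proof -
  have dir: "((\<lambda>t. det (Y + t *\<^sub>R H)) has_vector_derivative D H) (at 0)" for H
  proof -
    have "((\<lambda>t. Y + t *\<^sub>R H) has_derivative (\<lambda>t. t *\<^sub>R H)) (at 0)"
      by (auto intro!: derivative_eq_intros)
    moreover have "(det has_derivative D) (at (Y + 0 *\<^sub>R H))" using D by simp
    ultimately have "((\<lambda>t. det (Y + t *\<^sub>R H)) has_derivative (\<lambda>t. D (t *\<^sub>R H))) (at 0)"
      by (rule has_derivative_compose)
    then show ?thesis
      using has_derivative_bounded_linear[OF D]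
      by (simp add: has_vector_derivative_def linear_simps(5))
  qed
  have zero: "D H = 0" if "\<And>t. det (Y + t *\<^sub>R H) = 0" for H
  proof -
    have "((\<lambda>t. 0) has_vector_derivative D H) (at (0::real))" using dir[of H] that by simp
    moreover have "((\<lambda>t. 0) has_vector_derivative (0::complex)) (at (0::real))"
      by (rule has_vector_derivative_const)
    ultimately show ?thesis by (rule vector_derivative_unique_at)
  qed
  \<comment> \<open>The derivative is taken over the reals. It is complex linear because the determinant is a
    polynomial along every complex line.\<close>
  have scal: "D (mat c ** H) = c * D H" for c H
  proof -
    obtain p where p: "\<And>z. poly p z = det (\<chi> i j. Y $ i $ j + z * H $ i $ j)"
      using det_affine_poly by blast
    have "D (mat c ** H) = c * poly (pderiv p) 0" for c
    proof -
      have "(poly p has_field_derivative poly (pderiv p) (c * of_real 0)) (at (c * of_real 0))"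
        by (rule poly_DERIV)
      moreover have "((\<lambda>t. c * of_real t) has_vector_derivative c) (at 0)"
        by (auto intro!: derivative_eq_intros)
      ultimately have "(poly p \<circ> (\<lambda>t. c * of_real t) has_vector_derivative c * poly (pderiv p) 0) (at 0)"
        by (metis field_vector_diff_chain_at mult.commute mult_zero_right of_real_0)
      moreover have "(poly p \<circ> (\<lambda>t. c * of_real t)) = (\<lambda>t. det (Y + t *\<^sub>R (mat c ** H)))"
        unfolding o_def p
        by (rule ext, rule arg_cong[where f = det])
           (simp add: vec_eq_iff mat_mult_nth scaleR_conv_of_real[where 'a=complex])
      ultimately show ?thesis using vector_derivative_unique_at dir by metis
    qed
    from this[of c] this[of 1] show ?thesis by simp
  qed
  have add: "D (A + B) = D A + D B" for A B
    using has_derivative_bounded_linear[OF D] by (simp add: linear_simps(1))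
  obtain k where k: "v $ k \<noteq> 0" using v(2) by (auto simp: vec_eq_iff)
  obtain l where l: "w $ l \<noteq> 0" using w(2) by (auto simp: vec_eq_iff)
  define outer where "outer = (\<lambda>u. \<chi> i j. (u :: complex ^ 'm) $ i * (if j = k then 1 / v $ k else 0))"
  have outer_v: "outer u *v v = u" for u
    using k by (simp add: outer_def matrix_vector_mult_def vec_eq_iff if_distrib if_distribR cong: if_cong)
  define w' where "w' = (\<chi> i. if i = l then 1 / w $ l else (0::complex))"
  have "D H = D (outer w') * (\<Sum>i\<in>UNIV. w $ i * (H *v v) $ i)" for H
  proof -
    define u where "u = H *v v"
    define b where "b = (\<Sum>i\<in>UNIV. w $ i * u $ i)"
    have "D (H - outer u) = 0"
    proof (rule zero)
      fix t :: real
      have "(Y + t *\<^sub>R (H - outer u)) *v v = 0"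
        by (simp add: matrix_vector_mult_add_rdistrib v scaleR_mv
            matrix_vector_mult_diff_rdistrib outer_v flip: u_def)
      then show "det (Y + t *\<^sub>R (H - outer u)) = 0" using v(2) det_nz_iff_kernel by blast
    qed
    moreover have "D (outer (u - b *s w')) = 0"
    proof (rule zero)
      fix t :: real
      have 1: "(\<Sum>i\<in>UNIV. (u $ i - b * w' $ i) * w $ i) = 0"
      proof -
        have "(\<Sum>i\<in>UNIV. b * w' $ i * w $ i) = (\<Sum>i\<in>UNIV. if i = l then b else 0)"
          by (rule sum.cong) (use l in \<open>auto simp: w'_def\<close>)
        also have "\<dots> = (\<Sum>i\<in>UNIV. u $ i * w $ i)" by (simp add: b_def mult.commute)
        finally show ?thesis unfolding left_diff_distrib sum_subtractf by simp
      qed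
      have "transpose (outer (u - b *s w')) *v w = (\<chi> j. (\<Sum>i\<in>UNIV. (u $ i - b * w' $ i) * w $ i) * (if j = k then 1 / v $ k else 0))"
        unfolding vec_eq_iff
      proof
        fix j
        have "(transpose (outer (u - b *s w')) *v w) $ j
            = (\<Sum>i\<in>UNIV. (u $ i - b * w' $ i) * w $ i * (if j = k then 1 / v $ k else 0))"
          unfolding matrix_vector_mult_def transpose_def outer_def
          by (simp only: vec_lambda_beta, rule sum.cong[OF refl]) simp
        then show "(transpose (outer (u - b *s w')) *v w) $ j
          = (\<chi> j. (\<Sum>i\<in>UNIV. (u $ i - b * w' $ i) * w $ i) * (if j = k then 1 / v $ k else 0)) $ j"
          by (simp only: sum_distrib_right vec_lambda_beta)
      qed
      also have "\<dots> = 0" unfolding 1 by (simp add: vec_eq_iff)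
      finally have 2: "(transpose (outer (u - b *s w')) *v w) $ j = 0" for j
        by (metis zero_index)
      have "(transpose (Y + t *\<^sub>R outer (u - b *s w')) *v w) $ j
          = (transpose Y *v w) $ j + t *\<^sub>R ((transpose (outer (u - b *s w')) *v w) $ j)" for j
        by (simp add: matrix_vector_mult_def transpose_def sum.distrib scaleR_sum_right algebra_simps
            del: transpose_matrix_vector)
      then have "transpose (Y + t *\<^sub>R outer (u - b *s w')) *v w = 0"
        unfolding vec_eq_iff using w(1) 2 by (simp del: transpose_matrix_vector)
      then show "det (Y + t *\<^sub>R outer (u - b *s w')) = 0" using w(2) left_kernel_det_zero by blast
    qed
    moreover have "D (mat b ** outer w') = b * D (outer w')" by (rule scal)
    moreover have "H = (H - outer u) + (outer (u - b *s w') + mat b ** outer w')"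
      by (simp add: vec_eq_iff outer_def mat_mult_nth algebra_simps)
    ultimately show ?thesis using add[of "H - outer u" "outer (u - b *s w') + mat b ** outer w'"]
        add[of "outer (u - b *s w')" "mat b ** outer w'"]
      by (simp add: b_def u_def mult.commute)
  qed
  then show ?thesis using that by blast
qed

section \<open>Transverse crossings and the pencil determinant\<close>

definition cvec :: "real ^ 'm \<Rightarrow> complex ^ 'm" where
  "cvec v = (\<chi> i. complex_of_real (v $ i))"

lemma cmat_cvec: "cmat A *v cvec v = cvec (A *v v)"
  by (simp add: cmat_def cvec_def matrix_vector_mult_def vec_eq_iff)

lemma cvec_sum: "(\<Sum>i\<in>UNIV. cvec v $ i * cvec w $ i) = complex_of_real (v \<bullet> w)"
  by (simp add: cvec_def inner_vec_def)

lemma cvec_0_iff: "cvec v = 0 \<longleftrightarrow> v = 0" by (simp add: cvec_def vec_eq_iff)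

lemma inner_real_matrix: "x \<bullet> (A *v y) = (transpose A *v x) \<bullet> y" for A :: "real ^ 'm ^ 'm"
  using dot_lmul_matrix[of x A y] by simp

lemma pencil_0: "pencil 0 M = mat \<i> ** cmat (Jmat ** (M - mat 1))"
  by (simp add: pencil_def Ji_def cmat_mult cmat_diff matrix_mul_assoc)

lemma Ji_form:
  "(\<Sum>i\<in>UNIV. cvec v $ i * ((Ji ** cmat A) *v cvec v) $ i) = \<i> * complex_of_real (v \<bullet> (Jmat *v (A *v v)))"
proof -
  have "(Ji ** cmat A) *v cvec v = \<i> *s cvec (Jmat *v (A *v v))"
    by (simp add: Ji_def mat_vector_mult cmat_cvec flip: matrix_vector_mul_assoc)
  then have "(\<Sum>i\<in>UNIV. cvec v $ i * ((Ji ** cmat A) *v cvec v) $ i)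
      = \<i> * (\<Sum>i\<in>UNIV. cvec v $ i * cvec (Jmat *v (A *v v)) $ i)"
    by (simp add: sum_distrib_left algebra_simps)
  then show ?thesis unfolding cvec_sum .
qed

text \<open>A fixed vector \<open>v\<close> of a symplectic \<open>N\<close> yields the left kernel vector \<open>J v\<close> of \<open>N - 1\<close>, so that \<open>v\<close> is both
  a left and a right kernel vector of \<open>Ji ** (N - mat 1)\<close>. This expresses the derivatives of \<open>pdet\<close> and of
  \<open>det_minus 1\<close> at \<open>N\<close> by the same quadratic form in \<open>v\<close>, which is negative in the co-orienting direction \<open>N ** Jmat\<close>.\<close>

lemma det_derivatives_at_fixed_vector:
  fixes N :: "'n::finite bmat"
  assumes "N \<in> Sp0 1"
  obtains D \<kappa> v where "(det has_derivative D) (at (pencil 0 N))" "v \<noteq> 0" "N *v v = v"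
    "v \<bullet> (Jmat *v ((N ** Jmat) *v v)) = - (v \<bullet> v)"
    "D = (\<lambda>H. \<kappa> * (\<Sum>i\<in>UNIV. cvec v $ i * (H *v cvec v) $ i))"
    "frechet_derivative (det_minus 1) (at N)
       = (\<lambda>A. \<kappa> * \<i> * complex_of_real (v \<bullet> (Jmat *v (A *v v))) / det (Ji :: complex ^ ('n + 'n) ^ ('n + 'n)))"
proof -
  have NSp: "transpose N ** Jmat ** N = Jmat" and "det (N - mat 1) = 0" using assms by (auto simp: Sp0_1 Sp_def)
  then obtain v where v0: "v \<noteq> 0" and "(N - mat 1) *v v = 0" using det_zero_kernel by blast
  then have Nv: "N *v v = v" by (simp add: matrix_vector_mult_diff_rdistrib)
  have NJv: "transpose N *v (Jmat *v v) = Jmat *v v"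
  proof -
    have "transpose N *v (Jmat *v (N *v v)) = (transpose N ** Jmat ** N) *v v"
      by (simp add: matrix_vector_mul_assoc matrix_mul_assoc del: transpose_matrix_vector)
    then show ?thesis unfolding Nv NSp .
  qed
  define Y where "Y = pencil 0 N"
  obtain D where D: "(det has_derivative D) (at Y)"
    using det_differentiable unfolding differentiable_def by blast
  have Yv: "Y *v cvec v = 0"
    by (simp add: Y_def pencil_0 cmat_cvec mat_vector_mult matrix_vector_mult_diff_rdistrib Nv
        flip: matrix_vector_mul_assoc) (simp add: cvec_def vec_eq_iff)
  have tr: "transpose (Jmat ** (N - mat 1)) *v v = 0"
  proof -
    have "transpose (Jmat ** (N - mat 1)) = - ((transpose N - mat 1) ** Jmat)"
    proof -
      have "transpose (N - mat 1) = transpose N - mat 1"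
        by (auto simp: transpose_def mat_def vec_eq_iff)
      then show ?thesis by (simp add: matrix_transpose_mul transpose_Jmat matrix_minus_right)
    qed
    then have "transpose (Jmat ** (N - mat 1)) *v v = - ((transpose N - mat 1) *v (Jmat *v v))"
      by (simp add: matrix_vector_mul_assoc del: transpose_matrix_vector)
         (simp add: vec_eq_iff matrix_vector_mult_def sum_negf)
    also have "\<dots> = 0"
      unfolding matrix_vector_mult_diff_rdistrib NJv by simp
    finally show ?thesis .
  qed
  have trY: "transpose Y *v cvec v = 0"
  proof -
    have "transpose Y = mat \<i> ** cmat (transpose (Jmat ** (N - mat 1)))"
      unfolding Y_def pencil_0 by (simp add: vec_eq_iff transpose_def mat_mult_nth) (simp add: cmat_def)
    then have "transpose Y *v cvec v = mat \<i> *v cvec (transpose (Jmat ** (N - mat 1)) *v v)"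
      by (simp only: matrix_vector_mul_assoc[symmetric] cmat_cvec)
    then show ?thesis unfolding tr by (simp add: cvec_def mat_vector_mult vec_eq_iff del: transpose_matrix_vector)
  qed
  obtain \<kappa> where DH: "\<And>H. D H = \<kappa> * (\<Sum>i\<in>UNIV. cvec v $ i * (H *v cvec v) $ i)"
    using det_derivative_at_singular[OF D Yv _ trY] v0 cvec_0_iff by metis
  have DJ: "D (Ji ** cmat A) = \<kappa> * \<i> * complex_of_real (v \<bullet> (Jmat *v (A *v v)))" for A
    unfolding DH Ji_form by simp
  have DNeq: "frechet_derivative (det_minus 1) (at N) A = D (Ji ** cmat A) / det (Ji :: complex ^ ('n + 'n) ^ ('n + 'n))" for A
  proof -
    have "((\<lambda>M. Ji ** (cmat M - mat 1)) has_derivative (\<lambda>A. Ji ** cmat A)) (at N)"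
      by (auto intro!: derivative_eq_intros bounded_linear.has_derivative[OF bounded_linear_cmat]
          bounded_linear.has_derivative[OF bounded_bilinear.bounded_linear_right[OF bounded_bilinear_matrix_mult]])
    moreover have "(det has_derivative D) (at (Ji ** (cmat N - mat 1)))"
      using D by (simp add: Y_def pencil_def)
    ultimately have "((\<lambda>M. det (Ji ** (cmat M - mat 1))) has_derivative (\<lambda>A. D (Ji ** cmat A))) (at N)"
      by (rule has_derivative_compose)
    then have "((\<lambda>M. det (Ji ** (cmat M - mat 1)) / det (Ji :: complex ^ ('n + 'n) ^ ('n + 'n))) has_derivative (\<lambda>A. D (Ji ** cmat A) / det (Ji :: complex ^ ('n + 'n) ^ ('n + 'n)))) (at N)"
      by (rule bounded_linear.has_derivative[OF bounded_linear_divide])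
    moreover have "(\<lambda>M :: 'n bmat. det (Ji ** (cmat M - mat 1)) / det (Ji :: complex ^ ('n + 'n) ^ ('n + 'n))) = det_minus 1"
      by (rule ext) (simp add: det_mul det_minus_def det_Ji)
    ultimately show ?thesis using frechet_derivative_at by metis
  qed
  define b where "b = v \<bullet> v"
  have b: "b > 0" using v0 by (simp add: b_def)
  have NJ: "v \<bullet> (Jmat *v ((N ** Jmat) *v v)) = - b"
  proof -
    have tJ: "transpose Jmat *v x = - (Jmat *v x)" for x :: "real ^ ('n + 'n)"
      unfolding transpose_Jmat by (simp add: vec_eq_iff matrix_vector_mult_def sum_negf)
    have JJ: "Jmat *v (Jmat *v x) = - x" for x :: "real ^ ('n + 'n)"
    proof -
      have "Jmat *v (Jmat *v x) = (- mat 1) *v x" by (simp add: matrix_vector_mul_assoc Jmat_square)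
      then show ?thesis by (simp add: vec_eq_iff matrix_vector_mult_def mat_def sum_negf if_distrib if_distribR cong: if_cong)
    qed
    have "v \<bullet> (Jmat *v ((N ** Jmat) *v v)) = (transpose N *v (transpose Jmat *v v)) \<bullet> (Jmat *v v)"
      by (simp only: inner_real_matrix matrix_vector_mul_assoc[symmetric])
    also have "\<dots> = - ((transpose N *v (Jmat *v v)) \<bullet> (Jmat *v v))"
    proof -
      have "transpose N *v (- z) = - (transpose N *v z)" for z
        by (simp add: vec_eq_iff matrix_vector_mult_def sum_negf del: transpose_matrix_vector)
      then show ?thesis unfolding tJ by (simp only: inner_minus_left)
    qed
    also have "\<dots> = - ((Jmat *v v) \<bullet> (Jmat *v v))" unfolding NJv ..
    also have "(Jmat *v v) \<bullet> (Jmat *v v) = (transpose Jmat *v (Jmat *v v)) \<bullet> v"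
      by (simp only: inner_real_matrix)
    also have "\<dots> = b" unfolding tJ JJ b_def by simp
    finally show ?thesis .
  qed
  show ?thesis
  proof (rule that[OF D[unfolded Y_def] v0 Nv NJ[unfolded b_def]])
    show "D = (\<lambda>H. \<kappa> * (\<Sum>i\<in>UNIV. cvec v $ i * (H *v cvec v) $ i))" using DH by blast
    show "frechet_derivative (det_minus 1) (at N)
       = (\<lambda>A. \<kappa> * \<i> * complex_of_real (v \<bullet> (Jmat *v (A *v v))) / det (Ji :: complex ^ ('n + 'n) ^ ('n + 'n)))"
      by (rule ext) (simp only: DNeq DJ)
  qed
qed

text \<open>This is where the co-orientation enters: modulo the constant \<open>\<kappa>\<close>, increasing \<open>q\<close> moves \<open>pdet\<close> in the positive real
  direction, and moving along the path moves it in the imaginary direction given by \<open>- c\<close>.\<close>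

lemma transverse_crossing_derivative:
  fixes \<xi> :: "real \<Rightarrow> 'n::finite bmat"
  assumes "transverse_crossing 1 \<xi> t0 \<sigma>"
  obtains \<kappa> c where "\<kappa> \<noteq> 0" "c \<noteq> 0" "real_of_int \<sigma> = sgn c"
    "((\<lambda>x. pdet (complex_of_real (fst x)) (\<xi> (snd x))) has_derivative
       (\<lambda>h. \<kappa> * (2 * complex_of_real (fst h) - \<i> * complex_of_real (c * snd h)))) (at (0, t0))"
proof -
  define N where "N = \<xi> t0"
  define DN where "DN = frechet_derivative (det_minus 1) (at N)"
  obtain X c where N: "N \<in> Sp0 1" and reg: "DN (N ** Jmat) \<noteq> 0"
    and X: "(\<xi> has_vector_derivative X) (at t0)" and Xc: "DN (X - c *\<^sub>R (N ** Jmat)) = 0"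
    and c: "c \<noteq> 0" "real_of_int \<sigma> = sgn c"
    using assms unfolding transverse_crossing_def Let_def N_def DN_def by blast
  obtain D \<kappa> v where D: "(det has_derivative D) (at (pencil 0 N))" and v0: "v \<noteq> 0" and Nv: "N *v v = v"
    and NJ': "v \<bullet> (Jmat *v ((N ** Jmat) *v v)) = - (v \<bullet> v)"
    and Deq: "D = (\<lambda>H. \<kappa> * (\<Sum>i\<in>UNIV. cvec v $ i * (H *v cvec v) $ i))"
    and DNeq': "DN = (\<lambda>A. \<kappa> * \<i> * complex_of_real (v \<bullet> (Jmat *v (A *v v))) / det (Ji :: complex ^ ('n + 'n) ^ ('n + 'n)))"
    using det_derivatives_at_fixed_vector[OF N] unfolding DN_def by blast
  have DH: "D H = \<kappa> * (\<Sum>i\<in>UNIV. cvec v $ i * (H *v cvec v) $ i)" for H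
    by (simp only: Deq)
  have DJ: "D (Ji ** cmat A) = \<kappa> * \<i> * complex_of_real (v \<bullet> (Jmat *v (A *v v)))" for A
    unfolding DH Ji_form by simp
  have DNeq: "DN A = \<kappa> * \<i> * complex_of_real (v \<bullet> (Jmat *v (A *v v))) / det (Ji :: complex ^ ('n + 'n) ^ ('n + 'n))" for A
    by (simp only: DNeq')
  define b where "b = v \<bullet> v"
  have b: "b > 0" using v0 by (simp add: b_def)
  have NJ: "v \<bullet> (Jmat *v ((N ** Jmat) *v v)) = - b" using NJ' by (simp add: b_def)
  have \<kappa>: "\<kappa> \<noteq> 0" using reg unfolding DNeq by auto
  have Xv: "v \<bullet> (Jmat *v (X *v v)) = - c * b"
  proof -
    have "v \<bullet> (Jmat *v ((X - c *\<^sub>R (N ** Jmat)) *v v)) = 0"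
      using Xc \<kappa> det_Ji[where 'n='n] unfolding DNeq by simp
    then show ?thesis
      by (simp add: matrix_vector_mult_diff_rdistrib matrix_vector_mult_diff_distrib inner_diff_right NJ
          scaleR_matrix_vector_assoc[symmetric] matrix_vector_mult_scaleR)
  qed
  have "((\<lambda>x. pdet (complex_of_real (fst x)) (\<xi> (snd x))) has_derivative
       (\<lambda>h. D (mat (complex_of_real (fst h)) ** (cmat N + mat 1) + Ji ** cmat (snd h *\<^sub>R X)))) (at (0, t0))"
  proof -
    have dd: "(det has_derivative D) (at (pencil (complex_of_real (fst (0::real, t0))) (\<xi> (snd (0::real, t0)))))"
      using D by (simp add: N_def)
    have x: "((\<lambda>x::real\<times>real. \<xi> (snd x)) has_derivative (\<lambda>h. snd h *\<^sub>R X)) (at (0,t0))"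
    proof -
      have "(\<xi> has_derivative (\<lambda>s. s *\<^sub>R X)) (at (snd (0::real, t0)))"
        using X by (simp add: has_vector_derivative_def)
      from has_derivative_compose[OF has_derivative_snd[OF has_derivative_ident] this] show ?thesis
        by simp
    qed
    have cx: "((\<lambda>x::real\<times>real. cmat (\<xi> (snd x))) has_derivative (\<lambda>h. cmat (snd h *\<^sub>R X))) (at (0,t0))"
      by (rule bounded_linear.has_derivative[OF bounded_linear_cmat x])
    have m: "((\<lambda>x::real\<times>real. mat (complex_of_real (fst x)) :: complex ^ ('n + 'n) ^ ('n + 'n)) has_derivative (\<lambda>h. mat (complex_of_real (fst h)))) (at (0,t0))"
      by (rule bounded_linear.has_derivative[OF bounded_linear_mat]) (auto intro!: derivative_eq_intros)
    have 1: "((\<lambda>x::real\<times>real. mat (complex_of_real (fst x)) ** (cmat (\<xi> (snd x)) + mat 1)) has_derivative 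
      (\<lambda>h. mat (complex_of_real (fst h)) ** (cmat N + mat 1))) (at (0,t0))"
    proof -
      have "((\<lambda>x::real\<times>real. cmat (\<xi> (snd x)) + mat 1) has_derivative (\<lambda>h. cmat (snd h *\<^sub>R X) + 0)) (at (0,t0))"
        by (intro has_derivative_add cx has_derivative_const)
      from bounded_bilinear.FDERIV[OF bounded_bilinear_matrix_mult m this]
      show ?thesis by (simp add: N_def)
    qed
    have 2: "((\<lambda>x::real\<times>real. Ji ** (cmat (\<xi> (snd x)) - mat 1)) has_derivative 
      (\<lambda>h. Ji ** cmat (snd h *\<^sub>R X))) (at (0,t0))"
    proof -
      have "((\<lambda>x::real\<times>real. cmat (\<xi> (snd x)) - mat 1) has_derivative (\<lambda>h. cmat (snd h *\<^sub>R X) - 0)) (at (0,t0))"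
        by (intro has_derivative_diff cx has_derivative_const)
      from bounded_linear.has_derivative[OF bounded_bilinear.bounded_linear_right[OF bounded_bilinear_matrix_mult] this]
      show ?thesis by simp
    qed
    from has_derivative_add[OF 1 2]
    have "((\<lambda>x::real\<times>real. pencil (complex_of_real (fst x)) (\<xi> (snd x))) has_derivative
      (\<lambda>h. mat (complex_of_real (fst h)) ** (cmat N + mat 1) + Ji ** cmat (snd h *\<^sub>R X))) (at (0,t0))"
      by (simp add: pencil_def)
    from has_derivative_compose[OF this dd] show ?thesis unfolding pdet_def .
  qed
  moreover have "D (mat (complex_of_real r) ** (cmat N + mat 1) + Ji ** cmat (s *\<^sub>R X))
      = (\<kappa> * complex_of_real b) * (2 * complex_of_real r - \<i> * complex_of_real (c * s))" for r s
  proof -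
    have "D (mat (complex_of_real r) ** (cmat N + mat 1)) = \<kappa> * (2 * complex_of_real r * complex_of_real b)"
    proof -
      have "(mat (complex_of_real r) ** (cmat N + mat 1)) *v cvec v = (2 * complex_of_real r) *s cvec v"
        by (simp add: matrix_vector_mult_add_rdistrib cmat_cvec Nv mat_vector_mult vec_eq_iff flip: matrix_vector_mul_assoc)
      then have "D (mat (complex_of_real r) ** (cmat N + mat 1)) = \<kappa> * (\<Sum>i\<in>UNIV. cvec v $ i * ((2 * complex_of_real r) * cvec v $ i))"
        unfolding DH by simp
      also have "\<dots> = \<kappa> * ((2 * complex_of_real r) * (\<Sum>i\<in>UNIV. cvec v $ i * cvec v $ i))"
        by (simp add: sum_distrib_left algebra_simps)
      finally show ?thesis unfolding cvec_sum b_def .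
    qed
    moreover have "D (Ji ** cmat (s *\<^sub>R X)) = - \<kappa> * \<i> * complex_of_real (s * c * b)"
      unfolding DJ scaleR_matrix_vector_assoc[symmetric] matrix_vector_mult_scaleR by (simp add: Xv)
    moreover have "D (A + B) = D A + D B" for A B
      using has_derivative_bounded_linear[OF D] by (simp add: linear_simps(1))
    ultimately show ?thesis by (simp add: algebra_simps)
  qed
  ultimately have "((\<lambda>x. pdet (complex_of_real (fst x)) (\<xi> (snd x))) has_derivative
       (\<lambda>h. (\<kappa> * complex_of_real b) * (2 * complex_of_real (fst h) - \<i> * complex_of_real (c * snd h)))) (at (0, t0))"
    by simp
  then show ?thesis using that[of "\<kappa> * complex_of_real b" c] \<kappa> b c by simp
qed

section \<open>The crossing formula\<close>

lemma dense_real_cofinite_01: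
  assumes "finite C" "openin (top_of_set {0..1}) T" "a \<in> T"
  shows "\<exists>z::real. z \<in> T \<and> z \<notin> C"
proof -
  obtain U where U: "open U" "T = {0..1} \<inter> U" using assms(2) by (auto simp: openin_open)
  obtain e where e: "e > 0" "ball a e \<subseteq> U" using U assms(3) by (auto simp: open_contains_ball)
  have a: "0 \<le> a" "a \<le> 1" using U assms(3) by auto
  have "{max 0 (a - e) <..< min 1 (a + e)} \<subseteq> T"
    using e(2) a unfolding U by (auto simp: ball_def dist_real_def subset_iff abs_if)
  moreover have "infinite {max 0 (a - e) <..< min 1 (a + e)}"
    using e(1) a by (simp add: infinite_Ioo_iff)
  ultimately have "infinite T" using infinite_super by blast
  then show ?thesis using assms(1) by (metis finite_subset subsetI)
qed

text \<open>Up to the factor \<open>\<kappa>\<close>, near \<open>(0, t0)\<close> the function \<open>F\<close> is close to \<open>2 q - i c (t - t0)\<close> and thus has values in the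
  slit plane on the punctured half disc \<open>q \<ge> 0\<close>. On the diameter \<open>q = 0\<close> its values are real multiples of
  one number, which the derivative forces to be imaginary relative to \<open>\<kappa>\<close>. Therefore the argument there is
  exactly \<open>\<plusminus> \<pi> / 2\<close>, with opposite signs on the two sides of \<open>t0\<close>.\<close>

lemma transverse_zero_log_jump:
  fixes F :: "real \<times> real \<Rightarrow> complex" and r :: "real \<Rightarrow> real"
  assumes F': "(F has_derivative (\<lambda>h. \<kappa> * (2 * complex_of_real (fst h) - \<i> * complex_of_real (c * snd h)))) (at (0, t0))"
    and F0: "F (0, t0) = 0" and \<kappa>: "\<kappa> \<noteq> 0" and c: "c \<noteq> 0"
    and r: "\<And>t. F (0, t) = \<theta> * complex_of_real (r t)"
    and d: "d > 0"
  shows "\<exists>\<delta>>0. \<delta> \<le> d \<and> (\<forall>Q g. continuous_on Q g \<longrightarrow> (\<forall>x\<in>Q. F x = exp (g x)) \<longrightarrow>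
       {x. 0 \<le> fst x \<and> dist x (0, t0) < \<delta> \<and> x \<noteq> (0, t0) \<and> F x \<noteq> 0} \<subseteq> Q \<longrightarrow>
       (\<exists>k. \<forall>t. t \<noteq> t0 \<and> dist t t0 < \<delta> \<longrightarrow> Im (g (0, t)) = k - sgn c * sgn (t - t0) * pi / 2))"
proof -
  define f where "f = (\<lambda>x. F x / \<kappa>)"
  \<comment> \<open>With this tolerance the error of the linear approximation can neither move a value to the
    negative half line nor, on the diameter, change the sign of its imaginary part.\<close>
  define \<epsilon> where "\<epsilon> = min (1/2) (\<bar>c\<bar>/4)"
  have \<epsilon>: "\<epsilon> > 0" "\<epsilon> \<le> 1/2" "\<epsilon> \<le> \<bar>c\<bar>/4" using c by (auto simp: \<epsilon>_def)
  have nk: "norm \<kappa> * \<epsilon> > 0" using \<kappa> \<epsilon> by simp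
  then obtain \<delta>0 where \<delta>0: "\<delta>0 > 0" and est00: "\<And>x. norm (x - (0, t0)) < \<delta>0 \<Longrightarrow>
      norm (F x - F (0, t0) - \<kappa> * (2 * complex_of_real (fst (x - (0,t0))) - \<i> * complex_of_real (c * snd (x - (0,t0)))))
        \<le> (norm \<kappa> * \<epsilon>) * norm (x - (0, t0))"
    using F' unfolding has_derivative_at_alt by blast
  define \<delta> where "\<delta> = min \<delta>0 d"
  have \<delta>: "\<delta> > 0" "\<delta> \<le> d" and est0: "\<And>x. norm (x - (0, t0)) < \<delta> \<Longrightarrow>
      norm (F x - F (0, t0) - \<kappa> * (2 * complex_of_real (fst (x - (0,t0))) - \<i> * complex_of_real (c * snd (x - (0,t0)))))
        \<le> (norm \<kappa> * \<epsilon>) * norm (x - (0, t0))"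
    using \<delta>0 d est00 by (auto simp: \<delta>_def)
  have est: "norm (f (q, t) - (2 * complex_of_real q - \<i> * complex_of_real (c * (t - t0)))) \<le> \<epsilon> * (\<bar>q\<bar> + \<bar>t - t0\<bar>)"
    if "dist (q, t) (0, t0) < \<delta>" for q t
  proof -
    have "norm (F (q, t) - \<kappa> * (2 * complex_of_real q - \<i> * complex_of_real (c * (t - t0)))) \<le> (norm \<kappa> * \<epsilon>) * norm ((q, t) - (0, t0))"
      using est0[of "(q, t)"] that F0 by (simp add: dist_norm)
    also have "F (q, t) - \<kappa> * (2 * complex_of_real q - \<i> * complex_of_real (c * (t - t0)))
        = \<kappa> * (f (q, t) - (2 * complex_of_real q - \<i> * complex_of_real (c * (t - t0))))"
      using \<kappa> by (simp add: f_def right_diff_distrib)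
    finally have "norm (f (q, t) - (2 * complex_of_real q - \<i> * complex_of_real (c * (t - t0)))) \<le> \<epsilon> * norm ((q, t) - (0, t0))"
      using \<kappa> by (simp add: norm_mult)
    also have "\<dots> \<le> \<epsilon> * (\<bar>q\<bar> + \<bar>t - t0\<bar>)"
      using \<epsilon>(1) norm_Pair_le[of q "t - t0"] by (intro mult_left_mono) auto
    finally show ?thesis .
  qed
  define H where "H = {x. 0 \<le> fst x \<and> dist x (0, t0) < \<delta> \<and> x \<noteq> (0::real, t0)}"
  have nonneg: "f x \<notin> \<real>\<^sub>\<le>\<^sub>0" if x: "x \<in> H" for x
  proof
    assume neg: "f x \<in> \<real>\<^sub>\<le>\<^sub>0"
    obtain q t where qt: "x = (q, t)" by force
    have q: "q \<ge> 0" "x \<noteq> (0, t0)" "dist (q, t) (0, t0) < \<delta>" using x by (auto simp: H_def qt)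
    have le: "Re (f x) \<le> 0" "Im (f x) = 0" using neg by (auto simp: complex_nonpos_Reals_iff)
    have "2 * q - Re (f x) \<le> \<epsilon> * (\<bar>q\<bar> + \<bar>t - t0\<bar>)"
      using abs_Re_le_cmod[of "f (q, t) - (2 * complex_of_real q - \<i> * complex_of_real (c * (t - t0)))"] est[OF q(3)]
      by (simp add: qt)
    moreover have "\<bar>c * (t - t0)\<bar> \<le> \<epsilon> * (\<bar>q\<bar> + \<bar>t - t0\<bar>)"
      using abs_Im_le_cmod[of "f (q, t) - (2 * complex_of_real q - \<i> * complex_of_real (c * (t - t0)))"] est[OF q(3)] le(2)
      by (simp add: qt)
    moreover have "\<epsilon> * (\<bar>q\<bar> + \<bar>t - t0\<bar>) \<le> 1/2 * (\<bar>q\<bar> + \<bar>t - t0\<bar>)"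
      "\<epsilon> * (\<bar>q\<bar> + \<bar>t - t0\<bar>) \<le> \<bar>c\<bar>/4 * (\<bar>q\<bar> + \<bar>t - t0\<bar>)"
      using \<epsilon> by (intro mult_right_mono; simp)+
    ultimately have 1: "2 * q \<le> 1/2 * (q + \<bar>t - t0\<bar>)" and 2: "\<bar>c\<bar> * \<bar>t - t0\<bar> \<le> \<bar>c\<bar> * (1/4 * (q + \<bar>t - t0\<bar>))"
      using le(1) q(1) by (auto simp: abs_mult)
    from 2 have 3: "\<bar>t - t0\<bar> \<le> 1/4 * (q + \<bar>t - t0\<bar>)" using c by (simp only: mult_le_cancel_left)
    define a where "a = \<bar>t - t0\<bar>"
    have a: "a \<ge> 0" "3 * q \<le> a" "3 * a \<le> q" using 1 3 by (auto simp: a_def)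
    then have q0: "q = 0" and "a = 0" using q(1) by auto
    then have "t = t0" by (simp add: a_def)
    then show False using q(2) qt q0 by simp
  qed
  have connH: "connected H"
  proof -
    have "starlike H"
      unfolding starlike_def
    proof (intro bexI[of _ "(\<delta>/2, t0)"] ballI subsetI)
      show "(\<delta>/2, t0) \<in> H" using \<delta> by (auto simp: H_def dist_Pair_Pair)
      fix x y assume x: "x \<in> H" and y: "y \<in> closed_segment (\<delta>/2, t0) x"
      then obtain u where u: "0 \<le> u" "u \<le> 1" "y = (1 - u) *\<^sub>R (\<delta>/2, t0) + u *\<^sub>R x"
        by (auto simp: closed_segment_def)
      have "closed_segment (\<delta>/2, t0) x \<subseteq> ball (0, t0) \<delta>"
        using x \<delta> by (intro closed_segment_subset convex_ball) (auto simp: H_def dist_Pair_Pair dist_commute)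
      then have d: "dist y (0, t0) < \<delta>" using y by (auto simp: dist_commute)
      have fy: "fst y = (1 - u) * (\<delta>/2) + u * fst x" using u by (simp add: fst_add)
      have fx: "fst x \<ge> 0" using x by (simp add: H_def)
      have "fst y \<ge> 0" using fy fx u \<delta> by simp
      moreover have "y \<noteq> (0, t0)"
      proof (cases "u = 1")
        case True then show ?thesis using u x by (simp add: H_def flip: zero_prod_def)
      next
        case False
        then have "fst y > 0" unfolding fy using u \<delta> fx by (intro add_pos_nonneg) auto
        then show ?thesis by auto
      qed
      ultimately show "y \<in> H" using d by (simp add: H_def)
    qed
    then show ?thesis using starlike_imp_connected by blast
  qed
  have fr: "f (0, t) = (\<theta> / \<kappa>) * complex_of_real (r t)" for t by (simp add: f_def r)
  define \<mu> where "\<mu> = \<theta> / \<kappa>"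
  \<comment> \<open>The curve \<open>t \<mapsto> F (0, t)\<close> stays on the real line spanned by \<open>\<theta>\<close>, hence so does its
    derivative \<open>- i c \<kappa>\<close>.\<close>
  have Re\<mu>: "Re \<mu> = 0"
  proof -
    have "(F has_derivative (\<lambda>h. \<kappa> * (2 * complex_of_real (fst h) - \<i> * complex_of_real (c * snd h)))) (at (Pair 0 t0))"
      using F' by simp
    moreover have "(Pair (0::real) has_derivative (\<lambda>h. (0, h))) (at t0)"
      by (auto intro!: derivative_eq_intros)
    ultimately have "((\<lambda>t. F (0, t)) has_derivative (\<lambda>h. \<kappa> * (2 * complex_of_real (fst (0, h)) - \<i> * complex_of_real (c * snd (0::real, h))))) (at t0)"
      using has_derivative_compose by blast
    then have "((\<lambda>t. F (0, t)) has_vector_derivative (\<kappa> * (- \<i> * c))) (at t0)"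
      by (simp add: has_vector_derivative_def scaleR_conv_of_real algebra_simps)
    then have "((\<lambda>t. Im (cnj \<mu> / \<kappa> * F (0, t))) has_vector_derivative Im (cnj \<mu> / \<kappa> * (\<kappa> * (- \<i> * c)))) (at t0)"
      by (intro bounded_linear.has_vector_derivative[OF bounded_linear_compose[OF bounded_linear_Im bounded_linear_mult_right]])
    moreover have "(\<lambda>t. Im (cnj \<mu> / \<kappa> * F (0, t))) = (\<lambda>t. 0)"
    proof
      fix t
      have "cnj \<mu> / \<kappa> * F (0, t) = (\<mu> * cnj \<mu>) * complex_of_real (r t)"
        by (simp add: r \<mu>_def mult_ac)
      also have "\<dots> = complex_of_real ((cmod \<mu>)\<^sup>2 * r t)"
        unfolding complex_norm_square[symmetric] by simp
      finally have "cnj \<mu> / \<kappa> * F (0, t) = complex_of_real ((cmod \<mu>)\<^sup>2 * r t)" .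
      then show "Im (cnj \<mu> / \<kappa> * F (0, t)) = 0" by simp
    qed
    moreover have "((\<lambda>t. 0::real) has_vector_derivative 0) (at t0)" by (rule has_vector_derivative_const)
    ultimately have "Im (cnj \<mu> / \<kappa> * (\<kappa> * (- \<i> * c))) = 0" using vector_derivative_unique_at by metis
    moreover have "cnj \<mu> / \<kappa> * (\<kappa> * (- \<i> * c)) = - \<i> * c * cnj \<mu>" using \<kappa> by simp
    ultimately show ?thesis using c by simp
  qed
  have arg_f: "Im (Ln (f (0, t))) = - sgn c * sgn (t - t0) * pi / 2" if t: "t \<noteq> t0" "dist t t0 < \<delta>" for t
  proof -
    have d: "dist (0::real, t) (0, t0) < \<delta>" using t by (simp add: dist_Pair_Pair)
    then have "f (0, t) \<notin> \<real>\<^sub>\<le>\<^sub>0" using t by (intro nonneg) (simp add: H_def)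
    then have nz: "f (0, t) \<noteq> 0" by auto
    have re: "Re (f (0, t)) = 0" unfolding fr \<mu>_def[symmetric] using Re\<mu> by simp
    have "\<bar>Im (f (0, t)) + c * (t - t0)\<bar> \<le> \<epsilon> * \<bar>t - t0\<bar>"
      using abs_Im_le_cmod[of "f (0, t) - (2 * complex_of_real 0 - \<i> * complex_of_real (c * (t - t0)))"] est[OF d]
      by simp
    also have "\<dots> \<le> \<bar>c\<bar>/4 * \<bar>t - t0\<bar>" using \<epsilon> by (intro mult_right_mono) auto
    also have "\<dots> < \<bar>c * (t - t0)\<bar>" using c t by (simp add: abs_mult)
    finally have *: "\<bar>Im (f (0, t)) + c * (t - t0)\<bar> < \<bar>c * (t - t0)\<bar>" .
    show ?thesis
    proof (cases "c * (t - t0) > 0")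
      case True
      then have "Im (f (0, t)) < 0" using * by linarith
      moreover have "sgn c * sgn (t - t0) = 1" using True by (simp flip: sgn_mult)
      ultimately show ?thesis using Im_Ln_eq_pi_half(2)[OF nz] re by simp
    next
      case False
      moreover have "c * (t - t0) \<noteq> 0" using c t by simp
      ultimately have n: "c * (t - t0) < 0" by linarith
      then have "Im (f (0, t)) > 0" using * by linarith
      moreover have "sgn c * sgn (t - t0) = -1" using n by (simp flip: sgn_mult)
      ultimately show ?thesis using Im_Ln_eq_pi_half(1)[OF nz] re by simp
    qed
  qed
  show ?thesis
  proof (rule exI[of _ \<delta>], intro conjI \<delta> allI impI)
    fix Q g
    assume g: "continuous_on Q g" and "\<forall>x\<in>Q. F x = exp (g x)"
      and sub: "{x. 0 \<le> fst x \<and> dist x (0, t0) < \<delta> \<and> x \<noteq> (0, t0) \<and> F x \<noteq> 0} \<subseteq> Q"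
    then have Fg: "F x = exp (g x)" if "x \<in> Q" for x using that by blast
    have Fnz: "F x \<noteq> 0" if "x \<in> H" for x using nonneg[OF that] by (auto simp: f_def)
    have HQ: "H \<subseteq> Q" using sub Fnz by (auto simp: H_def)
    have Fc: "continuous_on H F"
      by (rule continuous_on_cong[THEN iffD2, OF refl, of _ _ "\<lambda>x. exp (g x)"])
         (use HQ g Fg in \<open>auto intro!: continuous_on_exp intro: continuous_on_subset\<close>)
    obtain k where k: "\<And>x. x \<in> H \<Longrightarrow> g x = Ln (f x) + k"
    proof (rule continuous_logs_differ_by_constant[OF connH, of g "\<lambda>x. Ln (f x)" \<kappa>])
      show "continuous_on H g" using g HQ continuous_on_subset by blast
      show "continuous_on H (\<lambda>x. Ln (f x))"
        by (rule continuous_on_Ln') (use nonneg Fc \<kappa> in \<open>auto simp: f_def intro!: continuous_intros\<close>)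
      show "exp (g x) = \<kappa> * exp (Ln (f x))" if "x \<in> H" for x
        using Fg[of x] that HQ Fnz[OF that] \<kappa> by (auto simp: f_def)
    qed blast
    show "\<exists>k. \<forall>t. t \<noteq> t0 \<and> dist t t0 < \<delta> \<longrightarrow> Im (g (0, t)) = k - sgn c * sgn (t - t0) * pi / 2"
    proof (intro exI[of _ "Im k"] allI impI)
      fix t assume t: "t \<noteq> t0 \<and> dist t t0 < \<delta>"
      then have "(0, t) \<in> H" by (simp add: H_def dist_Pair_Pair)
      from k[OF this] arg_f[of t] t show "Im (g (0, t)) = Im k - sgn c * sgn (t - t0) * pi / 2"
        by simp
    qed
  qed
qed

definition end_angle :: "'n::finite bmat \<Rightarrow> real" where
  "end_angle M = arg_change (\<lambda>s. pdet (complex_of_real (1 - s)) M)"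

lemma end_angle_bound:
  fixes M :: "'n::finite bmat"
  assumes "M \<in> Sp" "M \<notin> Sp0 1"
  shows "\<bar>end_angle M\<bar> \<le> CARD('n + 'n) * pi"
proof -
  obtain p where p: "degree p \<le> CARD('n + 'n)" "\<And>q. poly p q = pdet q M" using pdet_poly by blast
  have nz: "pdet (complex_of_real (1 - s)) M \<noteq> 0" if "s \<in> {0..1}" for s
    using pdet_nz'[of M "1 - s"] assms that by auto
  let ?p = "pcompose p [:1, -1:]"
  have e: "poly ?p (complex_of_real s) = pdet (complex_of_real (1 - s)) M" for s
    by (simp add: poly_pcompose p(2))
  have "degree ?p \<le> CARD('n + 'n)" using p(1) by (simp add: degree_pcompose)
  from arg_change_poly_bound'[OF this, unfolded e, OF nz] show ?thesis
    unfolding end_angle_def .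
qed

definition crossings :: "(real \<Rightarrow> 'n::finite bmat) \<Rightarrow> real set" where
  "crossings \<xi> = {t \<in> {0..1}. \<xi> t \<in> Sp0 1}"

text \<open>The function \<open>G(q, \<xi> t)\<close> has a continuous logarithm on the square \<open>[0, 1] \<times> [0, 1]\<close> with the points \<open>(0, t)\<close>, \<open>t\<close> a
  crossing, removed. On the remaining part of the edge \<open>q = 0\<close> its imaginary part is locally constant,
  since \<open>G\<close> is a real multiple of a constant there, and it jumps by \<open>- \<sigma> \<pi>\<close> at each crossing. The other three edges
  give the right-hand side.\<close>

lemma crossing_formula:
  fixes \<xi> :: "real \<Rightarrow> 'n::finite bmat"
  assumes path: "path \<xi>" and Sp: "path_image \<xi> \<subseteq> Sp"
    and ends: "\<xi> 0 \<notin> Sp0 1" "\<xi> 1 \<notin> Sp0 1"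
    and fin: "finite (crossings \<xi>)"
    and trans: "\<And>t. t \<in> crossings \<xi> \<Longrightarrow> transverse_crossing 1 \<xi> t (\<sigma> t)"
  shows "- pi * real_of_int (\<Sum>t \<in> crossings \<xi>. \<sigma> t)
    = arg_change (\<lambda>t. pdet 1 (\<xi> t)) + end_angle (\<xi> 1) - end_angle (\<xi> 0)"
proof -
  define C where "C = crossings \<xi>"
  have C: "C \<subseteq> {0..1}" "0 \<notin> C" "1 \<notin> C" "finite C" using ends fin by (auto simp: C_def crossings_def)
  have cont: "continuous_on {0..1} \<xi>" using path by (simp add: path_def)
  have inSp: "\<xi> t \<in> Sp" if "t \<in> {0..1}" for t using Sp that by (auto simp: path_image_def)
  define F where "F = (\<lambda>x :: real \<times> real. pdet (complex_of_real (fst x)) (\<xi> (snd x)))"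
  define Q where "Q = {x :: real \<times> real. fst x \<in> {0..1} \<and> snd x \<in> {0..1} \<and> (fst x > 0 \<or> \<xi> (snd x) \<notin> Sp0 1)}"
  have Fnz: "F x \<noteq> 0" if "x \<in> Q" for x
    using that pdet_nz'[of "\<xi> (snd x)" "fst x"] inSp by (auto simp: Q_def F_def)
  have Fc: "continuous_on ({0..1} \<times> {0..1}) F"
    unfolding F_def
    by (intro continuous_intros continuous_on_compose2[OF cont]) auto
  have QI: "Q \<subseteq> {0..1} \<times> {0..1}" by (auto simp: Q_def)
  have "starlike Q"
    unfolding starlike_def
  proof (intro bexI[of _ "(1, 1/2)"] ballI subsetI)
    show "(1, 1/2) \<in> Q" by (simp add: Q_def)
    fix x y assume x: "x \<in> Q" and y: "y \<in> closed_segment (1, 1/2) x"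
    then obtain u where u: "0 \<le> u" "u \<le> 1" "y = (1 - u) *\<^sub>R (1, 1/2) + u *\<^sub>R x"
      by (auto simp: closed_segment_def)
    show "y \<in> Q"
    proof (cases "u = 1")
      case False
      have "closed_segment (1, 1/2) x \<subseteq> {0..1} \<times> {0..1}"
        by (intro closed_segment_subset convex_Times convex_real_interval) (use x in \<open>auto simp: Q_def mem_Times_iff\<close>)
      then have 1: "y \<in> {0..1} \<times> {0..1}" using y by blast
      have "fst y = (1 - u) + u * fst x" using u by simp
      moreover have "u * fst x \<ge> 0" using x u by (simp add: Q_def)
      ultimately have "fst y > 0" using False u by simp
      then show ?thesis using 1 by (simp add: Q_def mem_Times_iff)
    qed (use u x in \<open>simp flip: zero_prod_def\<close>)
  qed
  then have "contractible Q" by (rule starlike_imp_contractible)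
  then obtain g where g: "continuous_on Q g" "\<And>x. x \<in> Q \<Longrightarrow> F x = exp (g x)"
    using continuous_logarithm_on_contractible[of Q F] Fnz continuous_on_subset[OF Fc QI] by blast
  define u where "u = (\<lambda>t. Im (g (0, t)))"
  define \<theta> where "\<theta> = det (Ji :: complex ^ ('n + 'n) ^ ('n + 'n))"
  define r where "r = (\<lambda>t. det (\<xi> t - mat 1))"
  have Fr: "F (0, t) = \<theta> * complex_of_real (r t)" for t
    by (simp add: F_def \<theta>_def r_def pdet_0)
  have inQ0: "(0, t) \<in> Q \<longleftrightarrow> t \<in> {0..1} - C" for t by (auto simp: Q_def C_def crossings_def)
  \<comment> \<open>The sum of the signs of the crossings before \<open>t\<close>. The relation \<open>R\<close> says that the argument plus
    \<open>\<pi>\<close> times this sum agrees at two points; it holds locally, and so globally by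
    connectedness.\<close>
  define j where "j = (\<lambda>t. \<Sum>s\<in>{s\<in>C. s < t}. \<sigma> s)"
  define R where "R = (\<lambda>x y. u x + pi * real_of_int (j x) = u y + pi * real_of_int (j y))"
  have "R 0 1"
  proof (rule connected_equivalence_relation_gen[where S = "{0..1::real}" and P = "\<lambda>t. t \<notin> C"])
    show "\<exists>z. z \<in> T \<and> z \<notin> C" if "openin (top_of_set {0..1}) T" "a \<in> T" for T a
      using dense_real_cofinite_01 that C by blast
    fix a :: real assume a: "a \<in> {0..1}"
    show "\<exists>T. openin (top_of_set {0..1}) T \<and> a \<in> T \<and> (\<forall>x\<in>T. \<forall>y\<in>T. x \<notin> C \<and> y \<notin> C \<longrightarrow> R x y)"
    proof (cases "a \<in> C")
      case False
      then have aQ: "a \<in> {0..1} - C" using a by simp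
      have "continuous_on ({0..1} - C) u"
        unfolding u_def
      proof (intro continuous_on_Im continuous_on_compose2[OF g(1)])
        show "continuous_on ({0..1} - C) (Pair (0::real))" by (intro continuous_intros)
        show "Pair 0 ` ({0..1} - C) \<subseteq> Q" using inQ0 by blast
      qed
      then obtain d1 where d1: "d1 > 0" "\<And>t. t \<in> {0..1} - C \<Longrightarrow> dist t a < d1 \<Longrightarrow> dist (u t) (u a) < pi"
        using aQ pi_gt_zero unfolding continuous_on_iff by blast
      have "open (- C)" using C(4) by (simp add: finite_imp_closed open_Compl)
      then obtain d2 where d2: "d2 > 0" "ball a d2 \<subseteq> - C" using False by (meson ComplI open_contains_ball)
      have const: "R t a" if "t \<in> {0..1}" "dist t a < min d1 d2" for t
      proof -
        have tQ: "t \<in> {0..1} - C" using that d2 by (auto simp: dist_commute subset_iff)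
        have "exp (g (0, t) - g (0, a)) = complex_of_real (r t / r a)"
        proof -
          have "exp (g (0, t)) = \<theta> * complex_of_real (r t)" "exp (g (0, a)) = \<theta> * complex_of_real (r a)"
            using g(2)[of "(0,t)"] g(2)[of "(0,a)"] tQ aQ inQ0 Fr by auto
          moreover have "\<theta> \<noteq> 0" by (simp add: \<theta>_def det_Ji)
          ultimately show ?thesis by (simp add: exp_diff)
        qed
        then have "Im (exp (g (0, t) - g (0, a))) = 0" by simp
        then have "sin (u t - u a) = 0" by (simp add: Im_exp u_def)
        moreover have "\<bar>u t - u a\<bar> < pi" using d1(2)[OF tQ] that by (simp add: dist_real_def)
        ultimately have "u t = u a" using sin_eq_0_pi[of "u t - u a"] by auto
        moreover have "{s\<in>C. s < t} = {s\<in>C. s < a}"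
        proof -
          have "s < t \<longleftrightarrow> s < a" if "s \<in> C" for s
          proof -
            have "\<not> dist s a < d2" using that d2(2) by (auto simp: dist_commute subset_iff)
            then show ?thesis using \<open>dist t a < min d1 d2\<close> by (auto simp: dist_real_def)
          qed
          then show ?thesis by blast
        qed
        ultimately show ?thesis by (simp add: R_def j_def)
      qed
      show ?thesis
      proof (intro exI[of _ "{0..1} \<inter> ball a (min d1 d2)"] conjI ballI impI)
        show "openin (top_of_set {0..1}) ({0..1} \<inter> ball a (min d1 d2))" by (simp add: openin_open_Int)
        show "a \<in> {0..1} \<inter> ball a (min d1 d2)" using a d1 d2 by simp
        fix x y assume "x \<in> {0..1} \<inter> ball a (min d1 d2)" "y \<in> {0..1} \<inter> ball a (min d1 d2)"
        then show "R x y" using const[of x] const[of y] by (auto simp: R_def dist_commute)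
      qed
    next
      case True
      have a01: "0 < a" "a < 1" using a True C(2,3) by (metis atLeastAtMost_iff less_eq_real_def)+
      have "transverse_crossing 1 \<xi> a (\<sigma> a)" using trans True by (simp add: C_def)
      from transverse_crossing_derivative[OF this]
      obtain \<kappa> c where kc: "\<kappa> \<noteq> 0" "c \<noteq> 0" "real_of_int (\<sigma> a) = sgn c"
         "(F has_derivative (\<lambda>h. \<kappa> * (2 * complex_of_real (fst h) - \<i> * complex_of_real (c * snd h)))) (at (0, a))"
        unfolding F_def by blast
      have F0: "F (0, a) = 0" using True by (simp add: Fr r_def C_def crossings_def Sp0_1)
      have "open (- (C - {a}))" using C(4) by (intro open_Compl finite_imp_closed) simp
      then obtain d2 where d2: "d2 > 0" "ball a d2 \<subseteq> - (C - {a})" by (meson ComplI DiffD2 insertI1 open_contains_ball)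
      define d where "d = min d2 (min a (1 - a))"
      have d: "d > 0" "d \<le> d2" "d \<le> a" "d \<le> 1 - a" using d2 a01 by (auto simp: d_def)
      from transverse_zero_log_jump[OF kc(4) F0 kc(1,2) Fr d(1)]
      obtain \<delta>' where \<delta>': "\<delta>' > 0" and \<delta>'d: "\<delta>' \<le> d" and jump':
        "\<forall>Q g. continuous_on Q g \<longrightarrow> (\<forall>x\<in>Q. F x = exp (g x)) \<longrightarrow>
           {x. 0 \<le> fst x \<and> dist x (0, a) < \<delta>' \<and> x \<noteq> (0, a) \<and> F x \<noteq> 0} \<subseteq> Q \<longrightarrow>
           (\<exists>k. \<forall>t. t \<noteq> a \<and> dist t a < \<delta>' \<longrightarrow> Im (g (0, t)) = k - sgn c * sgn (t - a) * pi / 2)"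
        by blast
      have "\<exists>k. \<forall>t. t \<noteq> a \<and> dist t a < \<delta>' \<longrightarrow> Im (g (0, t)) = k - sgn c * sgn (t - a) * pi / 2"
      proof (rule jump'[rule_format, OF g])
        show "{x. 0 \<le> fst x \<and> dist x (0, a) < \<delta>' \<and> x \<noteq> (0, a) \<and> F x \<noteq> 0} \<subseteq> Q"
        proof
          fix x assume x: "x \<in> {x. 0 \<le> fst x \<and> dist x (0, a) < \<delta>' \<and> x \<noteq> (0, a) \<and> F x \<noteq> 0}"
          have "dist (fst x) 0 < d" "dist (snd x) a < d"
            using x \<delta>'d dist_fst_le[of x "(0,a)"] dist_snd_le[of x "(0,a)"] by auto
          then have b: "fst x \<in> {0..1}" "snd x \<in> {0..1}" using d x a01 by (auto simp: dist_real_def)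
          have "\<xi> (snd x) \<notin> Sp0 1" if "fst x = 0"
          proof
            assume "\<xi> (snd x) \<in> Sp0 1"
            then have "F (0, snd x) = 0" by (simp add: Fr r_def Sp0_1)
            then show False using x that by (metis (mono_tags, lifting) mem_Collect_eq prod.collapse)
          qed
          then show "x \<in> Q" using b by (auto simp: Q_def)
        qed
      qed
      then obtain k where k: "\<And>t. t \<noteq> a \<Longrightarrow> dist t a < \<delta>' \<Longrightarrow> u t = k - sgn c * sgn (t - a) * pi / 2"
        unfolding u_def by blast
      have jt: "j t = j a + (if a < t then \<sigma> a else 0)" if "dist t a < \<delta>'" for t
      proof -
        have s: "s < t \<longleftrightarrow> s < a" if "s \<in> C - {a}" for s
        proof -
          have "\<not> dist s a < d2" using that d2(2) by (auto simp: dist_commute subset_iff)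
          then show ?thesis using \<open>dist t a < \<delta>'\<close> \<delta>'d d by (auto simp: dist_real_def)
        qed
        show ?thesis
        proof (cases "a < t")
          case True
          then have "{s\<in>C. s < t} = insert a {s\<in>C. s < a}" using s \<open>a \<in> C\<close> by force
          then show ?thesis using True C(4) by (simp add: j_def)
        next
          case False
          then have "{s\<in>C. s < t} = {s\<in>C. s < a}" using s by force
          then show ?thesis using False by (simp add: j_def)
        qed
      qed
      have Rk: "u t + pi * real_of_int (j t) = k + pi * real_of_int (j a) + sgn c * pi / 2" if "t \<noteq> a" "dist t a < \<delta>'" for t
        using k[OF that] jt[OF that(2)] that(1) kc(3) by (cases "a < t") (auto simp: algebra_simps)
      show ?thesis
      proof (intro exI[of _ "{0..1} \<inter> ball a \<delta>'"] conjI ballI impI)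
        show "openin (top_of_set {0..1}) ({0..1} \<inter> ball a \<delta>')" by (simp add: openin_open_Int)
        show "a \<in> {0..1} \<inter> ball a \<delta>'" using a \<delta>' by simp
        fix x y assume "x \<in> {0..1} \<inter> ball a \<delta>'" "y \<in> {0..1} \<inter> ball a \<delta>'" "x \<notin> C \<and> y \<notin> C"
        moreover from this have "x \<noteq> a" "y \<noteq> a" using True by auto
        ultimately show "R x y" using Rk[of x] Rk[of y] by (simp add: R_def dist_commute)
      qed
    qed
  qed (use C in \<open>auto simp: R_def\<close>)
  moreover have "{s\<in>C. s < 0} = {}" "{s\<in>C. s < 1} = C"
    using C by (force, (metis (mono_tags, lifting) Collect_cong Collect_mem_eq atLeastAtMost_iff less_eq_real_def subsetD))
  ultimately have u10: "u 1 - u 0 = - pi * real_of_int (\<Sum>t\<in>C. \<sigma> t)"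
    by (simp add: R_def j_def)
  have "arg_change (\<lambda>t. pdet 1 (\<xi> t)) = Im (g (1, 1)) - Im (g (1, 0))"
  proof (rule arg_change_eq)
    show "continuous_on {0..1} (\<lambda>t. g (1, t))"
      by (rule continuous_on_compose2[OF g(1)]) (auto intro!: continuous_intros simp: Q_def)
    show "pdet 1 (\<xi> t) = exp (g (1, t))" if "t \<in> {0..1}" for t
      using g(2)[of "(1, t)"] that by (simp add: Q_def F_def)
  qed
  moreover have "end_angle (\<xi> t) = Im (g (0, t)) - Im (g (1, t))" if "t \<in> {0, 1}" for t
  proof -
    have t: "t \<in> {0..1}" "\<xi> t \<notin> Sp0 1" using that ends by auto
    have "end_angle (\<xi> t) = Im (g (1 - 1, t)) - Im (g (1 - 0, t))"
      unfolding end_angle_def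
    proof (rule arg_change_eq)
      show "continuous_on {0..1} (\<lambda>s. g (1 - s, t))"
        by (rule continuous_on_compose2[OF g(1)]) (use t in \<open>auto intro!: continuous_intros simp: Q_def\<close>)
      show "pdet (complex_of_real (1 - s)) (\<xi> t) = exp (g (1 - s, t))" if "s \<in> {0..1}" for s
        using g(2)[of "(1 - s, t)"] that t by (auto simp: Q_def F_def)
    qed
    then show ?thesis by simp
  qed
  ultimately show ?thesis using u10 by (simp add: u_def C_def)
qed

section \<open>Transverse paths\<close>

definition transverse_path :: "(real \<Rightarrow> 'n::finite bmat) \<Rightarrow> bool" where
  "transverse_path \<xi> \<longleftrightarrow> path \<xi> \<and> path_image \<xi> \<subseteq> Sp \<and> \<xi> 0 \<notin> Sp0 1 \<and> \<xi> 1 \<notin> Sp0 1 \<and>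
     finite (crossings \<xi>) \<and> (\<forall>t \<in> crossings \<xi>. \<exists>\<sigma>. transverse_crossing 1 \<xi> t \<sigma>)"

lemma transverse_path_off_Sp0:
  assumes "path \<xi>" "path_image \<xi> \<subseteq> Sp - Sp0 1"
  shows "transverse_path \<xi>"
proof -
  have "\<xi> t \<in> Sp - Sp0 1" if "t \<in> {0..1}" for t using assms(2) that unfolding path_image_def by blast
  then have "crossings \<xi> = {}" "\<xi> 0 \<notin> Sp0 1" "\<xi> 1 \<notin> Sp0 1" by (auto simp: crossings_def)
  then show ?thesis using assms by (auto simp: transverse_path_def)
qed

lemma det_minus_differentiable: "det_minus \<omega> differentiable (at (N :: 'n::finite bmat))"
proof -
  have "((\<lambda>M :: 'n bmat. cmat M - mat \<omega>) has_derivative (\<lambda>A. cmat A - 0)) (at N)"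
    by (intro has_derivative_diff has_derivative_const bounded_linear.has_derivative[OF bounded_linear_cmat]
        has_derivative_ident)
  then have "(\<lambda>M :: 'n bmat. cmat M - mat \<omega>) differentiable (at N)" unfolding differentiable_def by blast
  from differentiable_compose[OF det_differentiable this]
  have "(\<lambda>M :: 'n bmat. det (cmat M - mat \<omega>)) differentiable (at N)" .
  then show ?thesis by (simp add: det_minus_def[abs_def])
qed

text \<open>An affine change of time multiplies the velocity by \<open>k > 0\<close>, which preserves the sign of the crossing.\<close>

lemma transverse_crossing_reparametrize:
  assumes t: "transverse_crossing \<omega> \<xi> (k * t + b) \<sigma>" and k: "k > 0"
    and ev: "\<forall>\<^sub>F s in nhds t. \<zeta> s = \<xi> (k * s + b)"
  shows "transverse_crossing \<omega> \<zeta> t \<sigma>"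
proof -
  define N where "N = \<xi> (k * t + b)"
  define D where "D = frechet_derivative (det_minus \<omega>) (at N)"
  have linD: "linear D" unfolding D_def by (rule linear_frechet_derivative[OF det_minus_differentiable])
  obtain X c where N: "N \<in> Sp0 \<omega>" "D (N ** Jmat) \<noteq> 0" and X: "(\<xi> has_vector_derivative X) (at (k * t + b))"
    and c: "D (X - c *\<^sub>R (N ** Jmat)) = 0" "c \<noteq> 0" "real_of_int \<sigma> = sgn c"
    using t unfolding transverse_crossing_def Let_def N_def D_def by blast
  have N': "\<zeta> t = N" using eventually_nhds_x_imp_x[OF ev] by (simp add: N_def)
  have "((\<lambda>s. k * s + b) has_real_derivative k) (at t)" by (auto intro!: derivative_eq_intros)
  from vector_diff_chain_at[OF this[unfolded has_real_derivative_iff_has_vector_derivative] X]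
  have "((\<lambda>s. \<xi> (k * s + b)) has_vector_derivative k *\<^sub>R X) (at t)" by (simp add: o_def)
  then have "(\<zeta> has_vector_derivative k *\<^sub>R X) (at t)"
    by (subst has_vector_derivative_cong_ev) (use ev N' in \<open>auto elim!: eventually_mono simp: N_def\<close>)
  moreover have "D (k *\<^sub>R X - (k * c) *\<^sub>R (N ** Jmat)) = 0"
  proof -
    have "k *\<^sub>R X - (k * c) *\<^sub>R (N ** Jmat) = k *\<^sub>R (X - c *\<^sub>R (N ** Jmat))" by (simp add: scaleR_diff_right)
    then show ?thesis using c(1) linear_cmul[OF linD] by simp
  qed
  moreover have "k * c \<noteq> 0" "real_of_int \<sigma> = sgn (k * c)" using c k by (auto simp: sgn_mult)
  ultimately show ?thesis
    unfolding transverse_crossing_def Let_def N' using N D_def by blast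
qed

lemma transverse_path_join:
  assumes 1: "transverse_path \<xi>" and 2: "transverse_path \<zeta>" and j: "pathfinish \<xi> = pathstart \<zeta>"
  shows "transverse_path (\<xi> +++ \<zeta>)"
proof -
  let ?p = "\<xi> +++ \<zeta>"
  have half: "?p (1/2) \<notin> Sp0 1" using 1 by (simp add: joinpaths_def transverse_path_def)
  have left: "?p t = \<xi> (2 * t)" if "t \<le> 1/2" for t using that by (simp add: joinpaths_def)
  have right: "?p t = \<zeta> (2 * t - 1)" if "t > 1/2" for t using that by (simp add: joinpaths_def)
  have sub: "t < 1/2 \<and> 2 * t \<in> crossings \<xi> \<or> t > 1/2 \<and> 2 * t - 1 \<in> crossings \<zeta>" if "t \<in> crossings ?p" for t
  proof -
    have "?p t \<in> Sp0 1" using that by (simp add: crossings_def)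
    then have "t \<noteq> 1/2" using half by metis
    then consider "t < 1/2" | "t > 1/2" by linarith
    then show ?thesis
      by cases (use that left right in \<open>auto simp: crossings_def\<close>)
  qed
  have "crossings ?p \<subseteq> (\<lambda>s. s / 2) ` crossings \<xi> \<union> (\<lambda>s. (s + 1) / 2) ` crossings \<zeta>"
  proof (intro subsetI)
    fix t assume "t \<in> crossings ?p"
    from sub[OF this] show "t \<in> (\<lambda>s. s / 2) ` crossings \<xi> \<union> (\<lambda>s. (s + 1) / 2) ` crossings \<zeta>"
      using image_eqI[of t "\<lambda>s. s / 2" "2 * t"] image_eqI[of t "\<lambda>s. (s + 1) / 2" "2 * t - 1"] by auto
  qed
  then have "finite (crossings ?p)" using 1 2 by (meson finite_Un finite_imageI finite_subset transverse_path_def)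
  moreover have "\<exists>\<sigma>. transverse_crossing 1 ?p t \<sigma>" if t: "t \<in> crossings ?p" for t
    using sub[OF t]
  proof (elim disjE conjE)
    assume "t < 1/2" "2 * t \<in> crossings \<xi>"
    then obtain \<sigma> where s: "transverse_crossing 1 \<xi> (2 * t + 0) \<sigma>" using 1 by (auto simp: transverse_path_def)
    have "\<forall>\<^sub>F s in nhds t. s < 1/2" using eventually_nhds_in_open[of "{..<1/2}" t] \<open>t < 1/2\<close> by simp
    then have "\<forall>\<^sub>F s in nhds t. ?p s = \<xi> (2 * s + 0)" by eventually_elim (simp add: left)
    then show ?thesis using transverse_crossing_reparametrize[OF s] by auto
  next
    assume "t > 1/2" "2 * t - 1 \<in> crossings \<zeta>"
    then obtain \<sigma> where s: "transverse_crossing 1 \<zeta> (2 * t + (-1)) \<sigma>" using 2 by (auto simp: transverse_path_def)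
    have "\<forall>\<^sub>F s in nhds t. s > 1/2" using eventually_nhds_in_open[of "{1/2<..}" t] \<open>t > 1/2\<close> by simp
    then have "\<forall>\<^sub>F s in nhds t. ?p s = \<zeta> (2 * s + (-1))" by eventually_elim (simp add: right)
    then show ?thesis using transverse_crossing_reparametrize[OF s] by auto
  qed
  moreover have "path ?p" "path_image ?p \<subseteq> Sp"
    using 1 2 j by (auto simp: transverse_path_def path_image_join)
  moreover have "?p 0 = \<xi> 0" "?p 1 = \<zeta> 1" by (simp_all add: joinpaths_def)
  ultimately show ?thesis using 1 2 by (simp add: transverse_path_def)
qed

section \<open>Rank-one perturbations\<close>

definition outer :: "real ^ 'm \<Rightarrow> real ^ 'm \<Rightarrow> real ^ 'm ^ 'm" where
  "outer u w = (\<chi> i j. u $ i * w $ j)"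

lemma outer_mult_left: "A ** outer u w = outer (A *v u) w"
  by (simp add: outer_def matrix_matrix_mult_def matrix_vector_mult_def vec_eq_iff sum_distrib_right mult.assoc)

lemma outer_mult_right: "outer u w ** B = outer u (transpose B *v w)"
  by (simp add: outer_def matrix_matrix_mult_def matrix_vector_mult_def transpose_def vec_eq_iff
      sum_distrib_left algebra_simps del: transpose_matrix_vector)

lemma outer_scaleR: "s *\<^sub>R outer u w = outer (s *\<^sub>R u) w"
  by (simp add: outer_def vec_eq_iff)

lemma transpose_outer: "transpose (outer v v) = outer v v"
  by (simp add: outer_def transpose_def vec_eq_iff mult.commute)

text \<open>After an orthogonal change of basis that makes \<open>u\<close> a multiple of a basis vector, the perturbation affects one row
  only, and the determinant is linear in each row.\<close>

lemma det_rank_one_affine: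
  fixes Y :: "real ^ 'm ^ 'm"
  obtains \<beta> where "\<And>s. det (Y + s *\<^sub>R outer u w) = det Y + s * \<beta>"
proof (cases "u = 0")
  case True
  then have "outer u w = 0" by (simp add: outer_def vec_eq_iff)
  then show ?thesis using that[of 0] by simp
next
  case False
  define k :: 'm where "k = undefined"
  have "norm ((1 / norm u) *\<^sub>R u) = 1" using False by simp
  then obtain E where E: "orthogonal_matrix E" "E *v axis k 1 = (1 / norm u) *\<^sub>R u"
    using orthogonal_matrix_exists_basis by metis
  have EE: "transpose E ** E = mat 1" using E(1) by (simp add: orthogonal_matrix)
  have dE: "det (transpose E) \<noteq> 0"
    using arg_cong[OF EE, of det] by (auto simp: det_mul)
  have "E *v (norm u *\<^sub>R axis k 1) = u" using E(2) False by (simp add: matrix_vector_mult_scaleR)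
  then have "transpose E *v u = (transpose E ** E) *v (norm u *\<^sub>R axis k 1)"
    by (metis matrix_vector_mul_assoc)
  then have Eu: "transpose E *v u = norm u *\<^sub>R axis k 1" unfolding EE by simp
  define Z where "Z = transpose E ** Y"
  define a where "a = norm u *\<^sub>R w"
  have "det (transpose E) * det (Y + s *\<^sub>R outer u w) = det Z + s * det (\<chi> i. if i = k then a else Z $ i)" for s
  proof -
    have "transpose E ** (Y + s *\<^sub>R outer u w) = Z + s *\<^sub>R outer (norm u *\<^sub>R axis k 1) w"
      unfolding matrix_add_ldistrib Z_def outer_scaleR outer_mult_left matrix_vector_mult_scaleR Eu ..
    also have "\<dots> = (\<chi> i. if i = k then Z $ i + s *s a else Z $ i)"
      by (simp add: vec_eq_iff outer_def a_def axis_def)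
    finally have "det (transpose E) * det (Y + s *\<^sub>R outer u w) = det (\<chi> i. if i = k then Z $ i + s *s a else Z $ i)"
      by (metis det_mul)
    also have "\<dots> = det (\<chi> i. if i = k then Z $ i else Z $ i) + det (\<chi> i. if i = k then s *s a else Z $ i)"
      by (rule det_row_add)
    also have "\<dots> = det Z + s * det (\<chi> i. if i = k then a else Z $ i)"
      by (simp add: det_row_mul)
    finally show ?thesis .
  qed
  note * = this
  have "det (Y + s *\<^sub>R outer u w) = det Y + s * (det (\<chi> i. if i = k then a else Z $ i) / det (transpose E))" for s
    using *[of s] *[of 0] dE by (simp add: field_simps)
  then show ?thesis using that by blast
qed

section \<open>Linear solving and the Cayley chart\<close>

text \<open>The solution \<open>Z\<close> of \<open>X ** Z = Y\<close> by Cramer's rule. The explicit formula makes continuity and differentiability in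
  \<open>X\<close> and \<open>Y\<close> immediate.\<close>

definition lsolve :: "real ^ 'm ^ 'm \<Rightarrow> real ^ 'm ^ 'm \<Rightarrow> real ^ 'm ^ 'm" where
  "lsolve X Y = (\<chi> k l. det (\<chi> i j. if j = k then Y $ i $ l else X $ i $ j) / det X)"

lemma matrix_column_eq: "A = B \<longleftrightarrow> (\<forall>l. column l A = column l B)"
  by (simp add: column_def vec_eq_iff) metis

lemma column_mult: "column l (X ** Z) = X *v column l (Z :: 'a::comm_semiring_1 ^ 'm ^ 'm)"
  by (simp add: column_def matrix_matrix_mult_def matrix_vector_mult_def vec_eq_iff)

lemma lsolve:
  assumes "det X \<noteq> 0" shows "X ** Z = Y \<longleftrightarrow> Z = lsolve X Y"
proof -
  have "X ** Z = Y \<longleftrightarrow> (\<forall>l. X *v column l Z = column l Y)"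
    unfolding matrix_column_eq column_mult ..
  also have "\<dots> \<longleftrightarrow> (\<forall>l. column l Z = column l (lsolve X Y))"
    unfolding cramer[OF assms] by (simp add: column_def lsolve_def cong: if_cong)
  finally show ?thesis by (simp add: matrix_column_eq)
qed

lemma continuous_on_lsolve [continuous_intros]:
  assumes "continuous_on S X" "continuous_on S Y" "\<And>x. x \<in> S \<Longrightarrow> det (X x) \<noteq> 0"
  shows "continuous_on S (\<lambda>x. lsolve (X x) (Y x))"
proof -
  have e: "continuous_on S (\<lambda>x. (\<chi> i j. if j = k then Y x $ i $ l else X x $ i $ j))" for k l
  proof (intro continuous_on_vec_lambda)
    show "continuous_on S (\<lambda>x. if j = k then Y x $ i $ l else X x $ i $ j)" for i j
      using assms by (cases "j = k") (auto intro!: continuous_on_vec_nth2)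
  qed
  show ?thesis
    unfolding lsolve_def
    by (rule continuous_on_vec_lambda, rule continuous_on_vec_lambda, rule continuous_on_divide,
        rule continuous_on_det, rule e, rule continuous_on_det, rule assms, use assms(3) in blast)
qed

lemma matrix_differentiable_entrywise:
  fixes f :: "real \<Rightarrow> real ^ 'm ^ 'n"
  assumes "\<And>i j. (\<lambda>s. f s $ i $ j) differentiable (at t)"
  shows "f differentiable (at t)"
  unfolding differentiable_componentwise_within[of f]
proof
  fix b :: "real ^ 'm ^ 'n" assume "b \<in> Basis"
  then obtain i u where "b = axis i u" "u \<in> Basis" by (auto simp: Basis_vec_def)
  then obtain j where "b = axis i (axis j 1)" by (auto simp: Basis_vec_def)
  then have "(\<lambda>s. f s \<bullet> b) = (\<lambda>s. f s $ i $ j)" by (simp add: inner_axis)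
  then show "(\<lambda>s. f s \<bullet> b) differentiable (at t)" using assms by simp
qed

lemma entry_differentiable:
  fixes f :: "real \<Rightarrow> real ^ 'm ^ 'n"
  assumes "f differentiable (at t)"
  shows "(\<lambda>s. f s $ i $ j) differentiable (at t)"
  using assms unfolding differentiable_def
  using bounded_linear.has_derivative[OF bounded_linear_compose[OF bounded_linear_vec_nth bounded_linear_vec_nth]]
  by blast

lemma lsolve_differentiable:
  fixes X Y :: "real \<Rightarrow> real ^ 'm ^ 'm"
  assumes X: "X differentiable (at t)" and Y: "Y differentiable (at t)" and nz: "det (X t) \<noteq> 0"
  shows "(\<lambda>s. lsolve (X s) (Y s)) differentiable (at t)"
proof (rule matrix_differentiable_entrywise)
  fix k l
  have "(\<lambda>s. (\<chi> i j. if j = k then Y s $ i $ l else X s $ i $ j) :: real ^ 'm ^ 'm) differentiable (at t)"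
  proof (rule matrix_differentiable_entrywise)
    fix i j
    show "(\<lambda>s. (\<chi> i j. if j = k then Y s $ i $ l else X s $ i $ j) $ i $ j) differentiable (at t)"
      using entry_differentiable[OF X] entry_differentiable[OF Y] by (cases "j = k") auto
  qed
  from differentiable_compose[OF det_differentiable this] differentiable_compose[OF det_differentiable X] nz
  show "(\<lambda>s. lsolve (X s) (Y s) $ k $ l) differentiable (at t)"
    by (simp add: lsolve_def differentiable_divide)
qed

text \<open>The Cayley transform \<open>(1 - J A) inverse times (1 + J A) M0\<close>, which maps small symmetric matrices \<open>A\<close> to symplectic matrices
  near \<open>M0\<close>. Multiplying by \<open>1 - J A\<close> turns questions about it into polynomial ones.\<close>

definition cayley :: "'n::finite bmat \<Rightarrow> 'n bmat \<Rightarrow> 'n bmat" where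
  "cayley M0 A = lsolve (mat 1 - Jmat ** A) ((mat 1 + Jmat ** A) ** M0)"

lemma transpose_minus_mat: "transpose (A - B) = transpose A - transpose B"
  and transpose_plus_mat: "transpose (A + B) = transpose A + transpose B"
  and transpose_neg_mat: "transpose (- A) = - transpose (A :: 'a::ring_1 ^ 'm ^ 'n)"
  by (simp_all add: transpose_def vec_eq_iff)

lemma Jmat_square_left: "Jmat ** (Jmat ** A) = - (A :: 'n::finite bmat)"
  by (simp add: matrix_mul_assoc Jmat_square matrix_minus_left)

lemma nonsingular_cancel_left:
  fixes X :: "'a::field ^ 'm ^ 'm"
  assumes "det X \<noteq> 0" "X ** A = X ** B" shows "A = B"
proof -
  obtain X' where "X' ** X = mat 1" using assms(1) invertible_det_nz invertible_left_inverse by metis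
  then show ?thesis using assms(2) by (metis matrix_mul_assoc matrix_mul_lid)
qed

lemma nonsingular_cancel_right:
  fixes X :: "'a::field ^ 'm ^ 'm"
  assumes "det X \<noteq> 0" "A ** X = B ** X" shows "A = B"
proof -
  obtain X' where "X ** X' = mat 1" using assms(1) invertible_det_nz invertible_right_inverse by metis
  then show ?thesis using assms(2) by (metis matrix_mul_assoc matrix_mul_rid)
qed

lemma cayley_eq:
  assumes "det (mat 1 - Jmat ** A) \<noteq> 0"
  shows "(mat 1 - Jmat ** A) ** M = (mat 1 + Jmat ** A) ** M0 \<longleftrightarrow> M = cayley M0 A"
  unfolding cayley_def by (rule lsolve[OF assms])

text \<open>For symmetric \<open>A\<close> the matrices \<open>X = 1 - J A\<close> and \<open>Y = 1 + J A\<close> commute and transform \<open>J\<close> into the same matrix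
  \<open>J + A J A\<close>.\<close>

lemma cayley_in_Sp:
  assumes sym: "transpose A = A" and nz: "det (mat 1 - Jmat ** A) \<noteq> 0" and M0: "M0 \<in> Sp"
  shows "cayley M0 A \<in> Sp"
proof -
  define X where "X = mat 1 - Jmat ** A"
  define Y where "Y = mat 1 + Jmat ** A"
  define C where "C = cayley (mat 1) A"
  have XC: "X ** C = Y" using cayley_eq[OF nz, of C "mat 1"] by (simp add: C_def X_def Y_def)
  have comm: "X ** Y = Y ** X" by (simp add: X_def Y_def matrix_ring_simps)
  have "X ** (C ** X) = X ** Y" using XC comm by (simp add: matrix_mul_assoc)
  then have CX: "C ** X = Y" using nonsingular_cancel_left[of X] nz by (simp add: X_def)
  have forms: "transpose X ** Jmat ** X = Jmat + A ** (Jmat ** A)" "transpose Y ** Jmat ** Y = Jmat + A ** (Jmat ** A)"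
    by (simp_all add: X_def Y_def transpose_minus_mat transpose_plus_mat matrix_transpose_mul sym transpose_Jmat
        matrix_ring_simps Jmat_square_left Jmat_square matrix_mul_assoc[symmetric])
  have "transpose X ** ((transpose C ** Jmat ** C) ** X) = transpose (C ** X) ** Jmat ** (C ** X)"
    by (simp add: matrix_transpose_mul matrix_mul_assoc)
  also have "\<dots> = transpose X ** (Jmat ** X)" unfolding CX using forms by (simp add: matrix_mul_assoc)
  finally have "(transpose C ** Jmat ** C) ** X = Jmat ** X"
    by (rule nonsingular_cancel_left[rotated]) (use nz in \<open>simp add: X_def det_transpose\<close>)
  then have "transpose C ** Jmat ** C = Jmat"
    by (rule nonsingular_cancel_right[rotated]) (use nz in \<open>simp add: X_def\<close>)
  then have "C \<in> Sp" by (simp add: Sp_def)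
  moreover have "cayley M0 A = C ** M0"
    using cayley_eq[OF nz, of "C ** M0" M0] XC by (simp add: X_def Y_def matrix_mul_assoc)
  ultimately show ?thesis using Sp_mult[OF _ M0] by simp
qed

lemma Sp_det_nz: "M \<in> Sp \<Longrightarrow> det M \<noteq> 0"
proof -
  assume M: "M \<in> Sp"
  have "det (cmat M) \<noteq> 0" unfolding det_nz_iff_kernel using Sp_inj[OF M] by blast
  then show ?thesis by (simp add: det_cmat)
qed

definition cayley_inv :: "'n::finite bmat \<Rightarrow> 'n bmat \<Rightarrow> 'n bmat" where
  "cayley_inv M0 M = - (Jmat ** ((M - M0) ** lsolve (M + M0) (mat 1)))"

lemma cayley_inv:
  assumes M0: "M0 \<in> Sp" and M: "M \<in> Sp" and nz: "det (M + M0) \<noteq> 0"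
  shows "transpose (cayley_inv M0 M) = cayley_inv M0 M"
    and "det (mat 1 - Jmat ** cayley_inv M0 M) \<noteq> 0"
    and "cayley M0 (cayley_inv M0 M) = M"
proof -
  define Z where "Z = lsolve (M + M0) (mat 1)"
  define A where "A = cayley_inv M0 M"
  have MZ: "(M + M0) ** Z = mat 1" using lsolve[OF nz, of Z "mat 1"] by (simp add: Z_def)
  then have ZM: "Z ** (M + M0) = mat 1" by (simp add: matrix_left_right_inverse)
  have A: "A = - (Jmat ** ((M - M0) ** Z))" by (simp add: A_def cayley_inv_def Z_def)
  have JA: "Jmat ** A = (M - M0) ** Z" by (simp add: A matrix_minus_right Jmat_square_left)
  define S where "S = transpose (M + M0) ** Jmat ** (M - M0)"
  have MM: "transpose M ** Jmat ** M = Jmat" "transpose M0 ** Jmat ** M0 = Jmat" using M M0 by (auto simp: Sp_def)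
  have S: "S = transpose M0 ** (Jmat ** M) - transpose M ** (Jmat ** M0)"
    using MM by (simp add: S_def transpose_plus_mat matrix_ring_simps matrix_mul_assoc[symmetric])
  have tS: "transpose S = S"
    unfolding S by (simp add: transpose_minus_mat matrix_transpose_mul transpose_Jmat matrix_ring_simps matrix_mul_assoc)
  have "transpose Z ** S ** Z = transpose ((M + M0) ** Z) ** (Jmat ** ((M - M0) ** Z))"
    by (simp add: S_def matrix_transpose_mul matrix_mul_assoc)
  then have A2: "A = - (transpose Z ** S ** Z)" unfolding MZ A by simp
  show "transpose (cayley_inv M0 M) = cayley_inv M0 M"
    unfolding A_def[symmetric] A2 transpose_neg_mat
    by (simp add: matrix_transpose_mul tS matrix_mul_assoc)
  have X: "mat 1 - Jmat ** A = 2 *\<^sub>R (M0 ** Z)"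
  proof -
    have "mat 1 - Jmat ** A = (M + M0) ** Z - (M - M0) ** Z" unfolding JA MZ ..
    then show ?thesis by (simp add: matrix_ring_simps scaleR_2)
  qed
  have Y: "mat 1 + Jmat ** A = 2 *\<^sub>R (M ** Z)"
  proof -
    have "mat 1 + Jmat ** A = (M + M0) ** Z + (M - M0) ** Z" unfolding JA MZ ..
    then show ?thesis by (simp add: matrix_ring_simps scaleR_2)
  qed
  have dZ: "det Z \<noteq> 0" using arg_cong[OF MZ, of det] by (auto simp: det_mul)
  have X2: "mat 1 - Jmat ** A = (2 *\<^sub>R M0) ** Z" unfolding X by (simp add: scalar_matrix_assoc)
  have "det (2 *\<^sub>R M0) \<noteq> 0"
    unfolding det_nz_iff_kernel using Sp_det_nz[OF M0] unfolding det_nz_iff_kernel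
    by (simp add: scaleR_mv)
  then show nzA: "det (mat 1 - Jmat ** cayley_inv M0 M) \<noteq> 0"
    unfolding A_def[symmetric] X2 using dZ by (simp add: det_mul)
  have "M0 ** Z ** M = M ** Z ** M0"
  proof -
    have "M0 ** Z ** M = M0 ** (Z ** (M + M0)) - M0 ** Z ** M0" by (simp add: matrix_ring_simps matrix_mul_assoc)
    also have "\<dots> = ((M + M0) ** Z) ** M0 - M0 ** Z ** M0" unfolding MZ ZM by simp
    also have "\<dots> = M ** Z ** M0" by (simp add: matrix_ring_simps)
    finally show ?thesis .
  qed
  then have "(mat 1 - Jmat ** A) ** M = (mat 1 + Jmat ** A) ** M0"
    unfolding X Y by (simp flip: scalar_matrix_assoc)
  then show "cayley M0 (cayley_inv M0 M) = M"
    using cayley_eq[OF nzA, of M M0] by (simp add: A_def)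
qed

section \<open>Transverse paths in a Cayley chart\<close>

text \<open>A multiple of \<open>det (M - 1)\<close>, \<open>M = cayley M0 A\<close>, by a nonvanishing factor. In contrast to
  \<open>det (M - 1)\<close> itself it is polynomial in \<open>A\<close>.\<close>

definition cayley_crossing :: "'n::finite bmat \<Rightarrow> 'n bmat \<Rightarrow> real" where
  "cayley_crossing M0 A = det ((M0 - mat 1) + Jmat ** A ** (M0 + mat 1))"

lemma cayley_crossing:
  assumes nz: "det (mat 1 - Jmat ** A) \<noteq> 0"
  shows "det (mat 1 - Jmat ** A) * det (cayley M0 A - mat 1) = cayley_crossing M0 A"
proof -
  have "(mat 1 - Jmat ** A) ** (cayley M0 A - mat 1) = (mat 1 + Jmat ** A) ** M0 - (mat 1 - Jmat ** A)"
    using cayley_eq[OF nz, of "cayley M0 A" M0] by (simp add: matrix_diff_ldistrib)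
  also have "\<dots> = (M0 - mat 1) + Jmat ** A ** (M0 + mat 1)"
    by (simp add: matrix_ring_simps)
  finally show ?thesis by (metis cayley_crossing_def det_mul)
qed

lemma cayley_crossing_rank_one:
  obtains \<beta> where "\<And>s. cayley_crossing M0 (A + s *\<^sub>R outer v v) = cayley_crossing M0 A + s * \<beta>"
proof -
  define Y where "Y = (M0 - mat 1) + Jmat ** A ** (M0 + mat 1)"
  define w where "w = transpose (M0 + mat 1) *v v"
  obtain \<beta> where \<beta>: "\<And>s. det (Y + s *\<^sub>R outer (Jmat *v v) w) = det Y + s * \<beta>"
    using det_rank_one_affine by metis
  have *: "(M0 - mat 1) + Jmat ** (A + s *\<^sub>R outer v v) ** (M0 + mat 1) = Y + s *\<^sub>R outer (Jmat *v v) w" for s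
  proof -
    have "Jmat ** (A + s *\<^sub>R outer v v) ** (M0 + mat 1)
        = Jmat ** A ** (M0 + mat 1) + (Jmat ** (s *\<^sub>R outer v v)) ** (M0 + mat 1)"
      by (simp only: matrix_add_ldistrib[of Jmat] matrix_add_rdistrib)
    also have "(Jmat ** (s *\<^sub>R outer v v)) ** (M0 + mat 1) = outer (s *\<^sub>R (Jmat *v v)) w"
      by (simp only: outer_scaleR outer_mult_left outer_mult_right matrix_vector_mult_scaleR w_def)
    finally show ?thesis by (simp add: Y_def outer_scaleR)
  qed
  have "cayley_crossing M0 (A + s *\<^sub>R outer v v) = cayley_crossing M0 A + s * \<beta>" for s
    unfolding cayley_crossing_def * using \<beta>[of s] by (simp only: Y_def)
  then show ?thesis using that by blast
qed

lemma continuous_on_cayley: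
  assumes "continuous_on S f" "\<And>x. x \<in> S \<Longrightarrow> det (mat 1 - Jmat ** f x) \<noteq> 0"
  shows "continuous_on S (\<lambda>x. cayley M0 (f x))"
  unfolding cayley_def using assms by (intro continuous_intros) auto

lemma continuous_on_cayley_crossing [continuous_intros]:
  "continuous_on S f \<Longrightarrow> continuous_on S (\<lambda>x. cayley_crossing M0 (f x))"
  unfolding cayley_crossing_def by (intro continuous_intros)

text \<open>Along the edge the crossing function is affine and does not vanish at the ends, so it has at most one zero, and that
  zero is simple. A simple zero means that the derivative of \<open>det_minus 1\<close> in the direction of the velocity is nonzero; this is
  equivalent to transversality, since this derivative is a multiple of a real quadratic form that does not
  vanish in the co-orienting direction either.\<close>

lemma rank_one_edge_transverse:
  fixes M0 A :: "'n::finite bmat"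
  assumes M0: "M0 \<in> Sp" and sym: "transpose A = A"
    and nz: "\<And>s. s \<in> {0..1} \<Longrightarrow> det (mat 1 - Jmat ** (A + s *\<^sub>R (c *\<^sub>R outer v v))) \<noteq> 0"
    and e0: "cayley_crossing M0 A \<noteq> 0" and e1: "cayley_crossing M0 (A + c *\<^sub>R outer v v) \<noteq> 0"
  shows "transverse_path (\<lambda>s. cayley M0 (A + s *\<^sub>R (c *\<^sub>R outer v v)))"
proof -
  define E where "E = (\<lambda>s::real. A + s *\<^sub>R (c *\<^sub>R outer v v))"
  define \<xi> where "\<xi> = (\<lambda>s. cayley M0 (E s))"
  have Esym: "transpose (E s) = E s" for s
    using sym transpose_outer[of v] by (simp add: E_def transpose_def vec_eq_iff)
  have Ed: "E differentiable (at s)" for s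
    unfolding E_def by (intro derivative_intros)
  have Ec: "continuous_on S E" for S unfolding E_def by (intro continuous_intros)
  have nz': "det (mat 1 - Jmat ** E s) \<noteq> 0" if "s \<in> {0..1}" for s using nz[OF that] by (simp add: E_def)
  obtain \<beta> where "\<And>s. cayley_crossing M0 (A + s *\<^sub>R outer v v) = cayley_crossing M0 A + s * \<beta>"
    using cayley_crossing_rank_one by metis
  then have p: "cayley_crossing M0 (E s) = cayley_crossing M0 A + s * (c * \<beta>)" for s
    by (simp add: E_def algebra_simps)
  have inSp: "\<xi> s \<in> Sp" if "s \<in> {0..1}" for s
    unfolding \<xi>_def by (rule cayley_in_Sp[OF Esym nz'[OF that] M0])
  have cross: "\<xi> s \<in> Sp0 1 \<longleftrightarrow> cayley_crossing M0 (E s) = 0" if "s \<in> {0..1}" for s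
    using cayley_crossing[OF nz'[OF that], of M0] inSp[OF that] nz'[OF that] by (auto simp: Sp0_1 \<xi>_def)
  have path: "path \<xi>" unfolding path_def \<xi>_def by (rule continuous_on_cayley[OF Ec nz'])
  have ends: "\<xi> 0 \<notin> Sp0 1" "\<xi> 1 \<notin> Sp0 1" using cross[of 0] cross[of 1] e0 e1 by (auto simp: E_def)
  have "crossings \<xi> \<subseteq> {- cayley_crossing M0 A / (c * \<beta>)}"
  proof
    fix t assume "t \<in> crossings \<xi>"
    then have "cayley_crossing M0 A + t * (c * \<beta>) = 0" using cross p by (auto simp: crossings_def)
    moreover from this e0 have "c * \<beta> \<noteq> 0" by auto
    ultimately show "t \<in> {- cayley_crossing M0 A / (c * \<beta>)}" by (simp add: field_simps)
  qed
  then have fin: "finite (crossings \<xi>)" by (rule finite_subset) simp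
  have "\<exists>\<sigma>. transverse_crossing 1 \<xi> t \<sigma>" if t: "t \<in> crossings \<xi>" for t
  proof -
    have t01: "t \<in> {0..1}" and tS: "\<xi> t \<in> Sp0 1" using t by (auto simp: crossings_def)
    have "t \<noteq> 0" "t \<noteq> 1" using ends tS by metis+
    then have tin: "t \<in> {0<..<1}" using t01 by auto
    have pt: "cayley_crossing M0 A + t * (c * \<beta>) = 0" using cross[OF t01] tS p by simp
    then have b: "c * \<beta> \<noteq> 0" using e0 by auto
    have "(\<lambda>s. Jmat ** E s) differentiable (at t)"
      using bounded_linear.has_derivative[OF bounded_bilinear.bounded_linear_right[OF bounded_bilinear_matrix_mult]] Ed
      unfolding differentiable_def by blast
    then have JE: "(\<lambda>s. mat 1 - Jmat ** E s) differentiable (at t)" "(\<lambda>s. mat 1 + Jmat ** E s) differentiable (at t)"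
      by (intro differentiable_diff differentiable_add differentiable_const; assumption)+
    have JE2: "(\<lambda>s. (mat 1 + Jmat ** E s) ** M0) differentiable (at t)"
      using bounded_linear.has_derivative[OF bounded_bilinear.bounded_linear_left[OF bounded_bilinear_matrix_mult]] JE(2)
      unfolding differentiable_def by blast
    have "\<xi> differentiable (at t)"
      unfolding \<xi>_def cayley_def by (rule lsolve_differentiable[OF JE(1) JE2 nz'[OF t01]])
    then obtain X where X: "(\<xi> has_vector_derivative X) (at t)" using vector_derivative_works by blast
    define x where "x = (\<lambda>s. det (mat 1 - Jmat ** E s))"
    have "x differentiable (at t)" unfolding x_def by (rule differentiable_compose[OF det_differentiable JE(1)])
    then obtain x' where x': "(x has_vector_derivative x') (at t)" using vector_derivative_works by blast
    define DN where "DN = frechet_derivative (det_minus 1) (at (\<xi> t))"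
    have "(det_minus 1 has_derivative DN) (at (\<xi> t))"
      unfolding DN_def using det_minus_differentiable frechet_derivative_works by blast
    note d0 = has_derivative_compose[OF X[unfolded has_vector_derivative_def] this]
    have d1: "((\<lambda>s. det_minus 1 (\<xi> s)) has_vector_derivative DN X) (at t)"
    proof -
      have "linear DN" unfolding DN_def by (rule linear_frechet_derivative[OF det_minus_differentiable])
      then have "DN (r *\<^sub>R X) = r *\<^sub>R DN X" for r by (rule linear_cmul)
      with d0 show ?thesis unfolding has_vector_derivative_def by simp
    qed
    have d2: "((\<lambda>s. complex_of_real (x s)) has_vector_derivative complex_of_real x') (at t)"
      by (rule bounded_linear.has_vector_derivative[OF bounded_linear_of_real x'])
    have "((\<lambda>s. complex_of_real (x s) * det_minus 1 (\<xi> s)) has_vector_derivative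
        complex_of_real (x t) * DN X + complex_of_real x' * det_minus 1 (\<xi> t)) (at t)"
      by (rule has_vector_derivative_mult[OF d2 d1])
    moreover have "det_minus 1 (\<xi> t) = 0" using tS by (simp add: det_minus_1 Sp0_1)
    ultimately have A1: "((\<lambda>s. complex_of_real (x s) * det_minus 1 (\<xi> s)) has_vector_derivative complex_of_real (x t) * DN X) (at t)"
      by simp
    have A2: "complex_of_real (x s) * det_minus 1 (\<xi> s) = complex_of_real (cayley_crossing M0 A + s * (c * \<beta>))"
      if "s \<in> {0<..<1}" for s
      using cayley_crossing[OF nz'[of s], of M0] that p[of s]
      by (simp add: det_minus_1 x_def \<xi>_def flip: of_real_mult of_real_add)
    have "((\<lambda>s. complex_of_real (cayley_crossing M0 A + s * (c * \<beta>))) has_vector_derivative complex_of_real (x t) * DN X) (at t)"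
      by (rule has_vector_derivative_transform_within_open[OF A1 open_greaterThanLessThan tin A2])
    moreover have "((\<lambda>s. complex_of_real (cayley_crossing M0 A + s * (c * \<beta>))) has_vector_derivative complex_of_real (c * \<beta>)) (at t)"
      by (rule bounded_linear.has_vector_derivative[OF bounded_linear_of_real]) (auto intro!: derivative_eq_intros simp: has_real_derivative_iff_has_vector_derivative[symmetric])
    ultimately have "complex_of_real (x t) * DN X = complex_of_real (c * \<beta>)"
      by (rule vector_derivative_unique_at)
    then have DX: "DN X \<noteq> 0" using b by auto
    obtain D \<kappa> w where w: "w \<noteq> 0" and NJ: "w \<bullet> (Jmat *v ((\<xi> t ** Jmat) *v w)) = - (w \<bullet> w)"
      and DN: "DN = (\<lambda>A. \<kappa> * \<i> * complex_of_real (w \<bullet> (Jmat *v (A *v w))) / det (Ji :: complex ^ ('n + 'n) ^ ('n + 'n)))"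
      using det_derivatives_at_fixed_vector[OF tS] unfolding DN_def by blast
    have ww: "w \<bullet> w > 0" using w by simp
    have k: "\<kappa> \<noteq> 0" and wX: "w \<bullet> (Jmat *v (X *v w)) \<noteq> 0" using DX unfolding DN by auto
    \<comment> \<open>The coefficient for which the velocity is \<open>d\<close> times the co-orienting vector modulo the tangent
      space of the hypersurface.\<close>
    define d where "d = - (w \<bullet> (Jmat *v (X *v w))) / (w \<bullet> w)"
    have d: "d \<noteq> 0" using wX ww by (simp add: d_def)
    have "w \<bullet> (Jmat *v ((X - d *\<^sub>R (\<xi> t ** Jmat)) *v w)) = 0"
    proof -
      have "w \<bullet> (Jmat *v ((X - d *\<^sub>R (\<xi> t ** Jmat)) *v w)) = w \<bullet> (Jmat *v (X *v w)) + d * (w \<bullet> w)"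
        by (simp add: matrix_vector_mult_diff_rdistrib matrix_vector_mult_diff_distrib inner_diff_right NJ
            scaleR_mv matrix_vector_mult_scaleR)
      then show ?thesis using ww by (simp add: d_def)
    qed
    then have "DN (X - d *\<^sub>R (\<xi> t ** Jmat)) = 0" unfolding DN by simp
    moreover have "DN (\<xi> t ** Jmat) \<noteq> 0" unfolding DN NJ using k ww det_Ji[where 'n='n] w by simp
    moreover have "real_of_int (if d > 0 then 1 else -1) = sgn d" using d by (simp add: sgn_if)
    ultimately have "transverse_crossing 1 \<xi> t (if d > 0 then 1 else -1)"
      unfolding transverse_crossing_def Let_def using tS X d unfolding DN_def by blast
    then show ?thesis by blast
  qed
  then have "transverse_path \<xi>"
    unfolding transverse_path_def using path inSp ends fin by (auto simp: path_image_def)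
  then show ?thesis by (simp add: \<xi>_def E_def)
qed

definition deformable :: "(real \<Rightarrow> 'n::finite bmat) \<Rightarrow> bool" where
  "deformable p \<longleftrightarrow> (\<exists>\<xi>. transverse_path \<xi> \<and> homotopic_paths Sp p \<xi>)"

locale cayley_chart =
  fixes M0 :: "'n::finite bmat" and \<rho> :: real
  assumes M0: "M0 \<in> Sp" and \<rho>: "\<rho> > 0"
    and nonsing: "\<And>A :: 'n bmat. norm A < \<rho> \<Longrightarrow> det (mat 1 - Jmat ** A) \<noteq> 0"
begin

definition dom :: "'n bmat set" where
  "dom = {A. transpose A = A \<and> norm A < \<rho>}"

abbreviation chart :: "'n bmat \<Rightarrow> 'n bmat" where
  "chart \<equiv> cayley M0"

lemma convex_dom: "convex dom"
proof -
  have "dom = {A. transpose A = A} \<inter> ball 0 \<rho>" by (auto simp: dom_def)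
  moreover have "convex {A :: 'n bmat. transpose A = A}"
    by (auto simp: convex_def transpose_def vec_eq_iff)
  ultimately show ?thesis by (simp add: convex_Int)
qed

lemma chart_in_Sp: "A \<in> dom \<Longrightarrow> chart A \<in> Sp"
  unfolding dom_def using cayley_in_Sp nonsing M0 by blast

lemma continuous_on_chart: "continuous_on dom chart"
  by (rule continuous_on_cayley[OF continuous_on_id]) (use nonsing in \<open>auto simp: dom_def\<close>)

lemma chart_off_Sp0: "A \<in> dom \<Longrightarrow> chart A \<notin> Sp0 1 \<longleftrightarrow> cayley_crossing M0 A \<noteq> 0"
  using cayley_crossing[of A M0] chart_in_Sp[of A] nonsing[of A] by (auto simp: dom_def Sp0_1)

text \<open>The path is required to exist in the chart and not only in \<open>Sp\<close>, so that the convexity of \<open>dom\<close> provides homotopies.\<close>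

definition joined :: "'n bmat \<Rightarrow> 'n bmat \<Rightarrow> bool" where
  "joined A B \<longleftrightarrow> (\<exists>\<zeta>. path \<zeta> \<and> path_image \<zeta> \<subseteq> dom \<and> pathstart \<zeta> = A \<and> pathfinish \<zeta> = B \<and>
     transverse_path (chart \<circ> \<zeta>))"

lemma joined_trans:
  assumes "joined A B" "joined B C" shows "joined A C"
proof -
  obtain \<zeta> \<eta> where 1: "path \<zeta>" "path_image \<zeta> \<subseteq> dom" "pathstart \<zeta> = A" "pathfinish \<zeta> = B" "transverse_path (chart \<circ> \<zeta>)"
    and 2: "path \<eta>" "path_image \<eta> \<subseteq> dom" "pathstart \<eta> = B" "pathfinish \<eta> = C" "transverse_path (chart \<circ> \<eta>)"
    using assms unfolding joined_def by blast
  have "transverse_path (chart \<circ> (\<zeta> +++ \<eta>))"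
    unfolding path_compose_join by (rule transverse_path_join) (use 1 2 in \<open>auto simp: pathfinish_compose pathstart_compose\<close>)
  then show ?thesis
    unfolding joined_def using 1 2 by (intro exI[of _ "\<zeta> +++ \<eta>"]) (auto simp: path_image_join)
qed

lemma joined_rank_one:
  assumes A: "A \<in> dom" "A + c *\<^sub>R outer v v \<in> dom"
    and nz: "cayley_crossing M0 A \<noteq> 0" "cayley_crossing M0 (A + c *\<^sub>R outer v v) \<noteq> 0"
  shows "joined A (A + c *\<^sub>R outer v v)"
proof -
  let ?B = "A + c *\<^sub>R outer v v"
  have seg: "closed_segment A ?B \<subseteq> dom" using A convex_dom by (simp add: closed_segment_subset)
  have lin: "linepath A ?B s = A + s *\<^sub>R (c *\<^sub>R outer v v)" for s
    by (simp add: linepath_def algebra_simps)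
  have "A + s *\<^sub>R (c *\<^sub>R outer v v) \<in> dom" if "s \<in> {0..1}" for s
    using seg linepath_in_path[OF that, of A ?B] unfolding lin by blast
  then have "transverse_path (\<lambda>s. chart (A + s *\<^sub>R (c *\<^sub>R outer v v)))"
    using A nz nonsing by (intro rank_one_edge_transverse M0) (auto simp: dom_def)
  then have "transverse_path (chart \<circ> linepath A ?B)" by (simp add: o_def lin)
  then show ?thesis unfolding joined_def using seg by (intro exI[of _ "linepath A ?B"]) simp
qed

text \<open>A rank-one edge may run inside the hypersurface. Points are therefore only required to be limits of
  points that can be joined to \<open>A\<close>; this is preserved by rank-one steps, because an edge can be perturbed.\<close>

definition reach :: "'n bmat \<Rightarrow> 'n bmat set" where
  "reach A = {B \<in> dom. \<forall>U. open U \<longrightarrow> B \<in> U \<longrightarrow>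
     (\<exists>B' \<in> U \<inter> dom. cayley_crossing M0 B' \<noteq> 0 \<and> joined A B')}"

lemma reach_refl:
  assumes "A \<in> dom" "cayley_crossing M0 A \<noteq> 0" shows "A \<in> reach A"
proof -
  have "joined A A" using joined_rank_one[of A 0 0] assms by simp
  then show ?thesis using assms unfolding reach_def by blast
qed

text \<open>Near \<open>B\<close> there is a joined point \<open>B'\<close> off the hypersurface. On the line through \<open>B'\<close> in the direction of \<open>outer v v\<close> the crossing
  function is affine and not identically zero, so that arbitrarily close to \<open>B' + c *\<^sub>R outer v v\<close> there is a point of this line where it does not vanish.\<close>

lemma reach_rank_one:
  assumes B: "B \<in> reach A" and C: "B + c *\<^sub>R outer v v \<in> dom"
  shows "B + c *\<^sub>R outer v v \<in> reach A"
  unfolding reach_def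
proof (intro CollectI conjI C allI impI)
  fix U assume U: "open U" "B + c *\<^sub>R outer v v \<in> U"
  define V where "V = U \<inter> ball 0 \<rho>"
  have V: "open V" "B + c *\<^sub>R outer v v \<in> V" using U C by (auto simp: V_def dom_def)
  define W where "W = (\<lambda>X. X + c *\<^sub>R outer v v) -` V"
  have "open W" unfolding W_def using V(1) by (intro open_vimage continuous_intros)
  moreover have "B \<in> W" using V by (simp add: W_def)
  ultimately obtain B' where B': "B' \<in> W" "B' \<in> dom" "cayley_crossing M0 B' \<noteq> 0" "joined A B'"
    using B unfolding reach_def by blast
  define S where "S = (\<lambda>s. B' + s *\<^sub>R outer v v) -` V"
  have S: "open S" "c \<in> S" using V B'(1) unfolding S_def W_def by (auto intro!: open_vimage continuous_intros)
  obtain \<beta> where \<beta>: "\<And>s. cayley_crossing M0 (B' + s *\<^sub>R outer v v) = cayley_crossing M0 B' + s * \<beta>"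
    using cayley_crossing_rank_one by metis
  obtain e where e: "e > 0" "ball c e \<subseteq> S" using S open_contains_ball by blast
  have "\<exists>s \<in> S. cayley_crossing M0 (B' + s *\<^sub>R outer v v) \<noteq> 0"
  proof (rule ccontr)
    assume *: "\<not> (\<exists>s \<in> S. cayley_crossing M0 (B' + s *\<^sub>R outer v v) \<noteq> 0)"
    have "c + e/2 \<in> S" using e by (auto simp: dist_real_def)
    then have "cayley_crossing M0 B' + c * \<beta> = 0" "cayley_crossing M0 B' + (c + e/2) * \<beta> = 0"
      using * S(2) \<beta> by auto
    moreover have "e * \<beta> = 2 * ((cayley_crossing M0 B' + (c + e/2) * \<beta>) - (cayley_crossing M0 B' + c * \<beta>))"
      by (simp add: algebra_simps)
    ultimately have "e * \<beta> = 0" by simp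
    then have "\<beta> = 0" using e by simp
    then show False using B'(3) \<open>cayley_crossing M0 B' + c * \<beta> = 0\<close> by simp
  qed
  then obtain s where s: "s \<in> S" "cayley_crossing M0 (B' + s *\<^sub>R outer v v) \<noteq> 0" by blast
  have inV: "B' + s *\<^sub>R outer v v \<in> V" using s(1) by (simp add: S_def)
  moreover have "transpose (B' + s *\<^sub>R outer v v) = B' + s *\<^sub>R outer v v"
    using B'(2) transpose_outer[of v] by (simp add: dom_def transpose_def vec_eq_iff)
  ultimately have d: "B' + s *\<^sub>R outer v v \<in> dom" by (simp add: V_def dom_def)
  have "joined B' (B' + s *\<^sub>R outer v v)" by (rule joined_rank_one[OF B'(2) d B'(3) s(2)])
  then have "joined A (B' + s *\<^sub>R outer v v)" using B'(4) joined_trans by blast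
  then show "\<exists>B' \<in> U \<inter> dom. cayley_crossing M0 B' \<noteq> 0 \<and> joined A B'"
    using inV d s(2) by (auto simp: V_def)
qed

text \<open>A segment near \<open>B\<close> that avoids the hypersurface completes the path.\<close>

lemma reach_off_Sp0:
  assumes B: "B \<in> reach A" and nz: "cayley_crossing M0 B \<noteq> 0"
  shows "joined A B"
proof -
  have "open {X. cayley_crossing M0 X \<noteq> 0}"
    using continuous_on_cayley_crossing[OF continuous_on_id[of UNIV], of M0]
    by (intro open_Collect_neq continuous_on_const) simp_all
  then obtain e where e: "e > 0" "ball B e \<subseteq> {X. cayley_crossing M0 X \<noteq> 0}"
    using nz open_contains_ball by blast
  have Bd: "B \<in> dom" using B by (simp add: reach_def)
  obtain B' where B': "B' \<in> ball B e" "B' \<in> dom" "joined A B'"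
  proof -
    have "\<exists>B' \<in> ball B e \<inter> dom. cayley_crossing M0 B' \<noteq> 0 \<and> joined A B'"
      using B e(1) unfolding reach_def by simp
    then show ?thesis using that by blast
  qed
  have seg: "closed_segment B' B \<subseteq> dom" using B' Bd convex_dom by (simp add: closed_segment_subset)
  have segb: "closed_segment B' B \<subseteq> ball B e" using B' e by (simp add: closed_segment_subset)
  have "transverse_path (chart \<circ> linepath B' B)"
  proof (rule transverse_path_off_Sp0)
    show "path (chart \<circ> linepath B' B)"
      by (rule path_continuous_image) (use continuous_on_chart seg in \<open>auto intro: continuous_on_subset\<close>)
    have "chart X \<in> Sp - Sp0 1" if "X \<in> closed_segment B' B" for X
      using that seg segb e(2) chart_in_Sp chart_off_Sp0 by blast
    then show "path_image (chart \<circ> linepath B' B) \<subseteq> Sp - Sp0 1" by (auto simp: path_image_compose)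
  qed
  then have "joined B' B" unfolding joined_def using seg by (intro exI[of _ "linepath B' B"]) simp
  with B'(3) show ?thesis by (rule joined_trans)
qed

end

section \<open>Symmetric matrices as sums of rank-one matrices\<close>

text \<open>The decomposition is \<open>a b\<^sup>T + b a\<^sup>T = (a + b)(a + b)\<^sup>T - a a\<^sup>T - b b\<^sup>T\<close> for \<open>a\<close>, \<open>b\<close> in the standard basis; the
  third index selects the summand.\<close>

definition rank_one_coeff :: "real ^ 'm ^ 'm \<Rightarrow> 'm \<times> 'm \<times> nat \<Rightarrow> real" where
  "rank_one_coeff H = (\<lambda>(i, j, k). if k = 0 then H $ i $ j / 2 else - H $ i $ j / 2)"

definition rank_one_vec :: "'m::finite \<times> 'm \<times> nat \<Rightarrow> real ^ 'm" where
  "rank_one_vec = (\<lambda>(i, j, k). if k = 0 then axis i 1 + axis j 1 else if k = 1 then axis i 1 else axis j 1)"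

abbreviation rank_one_index :: "('m::finite \<times> 'm \<times> nat) set" where
  "rank_one_index \<equiv> UNIV \<times> UNIV \<times> {0, 1, 2}"

lemma symmetric_rank_one_sum:
  fixes H :: "real ^ 'm::finite ^ 'm"
  assumes "transpose H = H"
  shows "(\<Sum>\<tau>\<in>rank_one_index. rank_one_coeff H \<tau> *\<^sub>R outer (rank_one_vec \<tau>) (rank_one_vec \<tau>)) = H"
proof -
  have sym: "H $ b $ a = H $ a $ b" for a b
    using arg_cong[OF assms, of "\<lambda>X. X $ a $ b"] by (simp add: transpose_def)
  have "(\<Sum>\<tau>\<in>rank_one_index. rank_one_coeff H \<tau> *\<^sub>R outer (rank_one_vec \<tau>) (rank_one_vec \<tau>)) $ a $ b = H $ a $ b" for a b
  proof -
    have "(\<Sum>\<tau>\<in>rank_one_index. rank_one_coeff H \<tau> *\<^sub>R outer (rank_one_vec \<tau>) (rank_one_vec \<tau>)) $ a $ b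
        = (\<Sum>\<tau>\<in>rank_one_index. rank_one_coeff H \<tau> * (rank_one_vec \<tau> $ a * rank_one_vec \<tau> $ b))"
      by (simp add: outer_def)
    also have "\<dots> = (\<Sum>i\<in>UNIV. \<Sum>j\<in>UNIV. \<Sum>k\<in>{0,1,2}. rank_one_coeff H (i,j,k) * (rank_one_vec (i,j,k) $ a * rank_one_vec (i,j,k) $ b))"
      by (simp only: sum.cartesian_product) simp
    also have "\<dots> = (\<Sum>i\<in>UNIV. \<Sum>j\<in>UNIV. (if i = a \<and> j = b then H $ a $ b / 2 else 0) + (if i = b \<and> j = a then H $ b $ a / 2 else 0))"
    proof (rule sum.cong[OF refl], rule sum.cong[OF refl])
      fix i j :: 'm
      define x y :: "real ^ 'm" where "x = axis i 1" and "y = axis j 1"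
      have "(\<Sum>k\<in>{0,1,2}. rank_one_coeff H (i,j,k) * (rank_one_vec (i,j,k) $ a * rank_one_vec (i,j,k) $ b))
          = H $ i $ j / 2 * (x $ a * y $ b) + H $ i $ j / 2 * (y $ a * x $ b)"
        by (simp add: rank_one_coeff_def rank_one_vec_def algebra_simps flip: x_def y_def)
      also have "H $ i $ j / 2 * (x $ a * y $ b) = (if i = a \<and> j = b then H $ a $ b / 2 else 0)"
        by (simp add: x_def y_def axis_def)
      also have "H $ i $ j / 2 * (y $ a * x $ b) = (if i = b \<and> j = a then H $ b $ a / 2 else 0)"
        by (simp add: x_def y_def axis_def)
      finally show "(\<Sum>k\<in>{0,1,2}. rank_one_coeff H (i,j,k) * (rank_one_vec (i,j,k) $ a * rank_one_vec (i,j,k) $ b))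
          = (if i = a \<and> j = b then H $ a $ b / 2 else 0) + (if i = b \<and> j = a then H $ b $ a / 2 else 0)" .
    qed
    also have "\<dots> = H $ a $ b / 2 + H $ b $ a / 2"
    proof -
      have "(\<Sum>j\<in>(UNIV::'m set). if i = c \<and> j = d then x else 0) = (if i = c then x else 0)" for i c d :: 'm and x :: real
        by (cases "i = c") simp_all
      then show ?thesis by (simp add: sum.distrib)
    qed
    finally show ?thesis by (simp add: sym)
  qed
  then show ?thesis by (simp add: vec_eq_iff)
qed

context cayley_chart
begin

text \<open>So small that all partial sums of the rank-one decomposition of the difference of two matrices of this norm stay in \<open>dom\<close>.\<close>

definition small :: real where
  "small = \<rho> / (1 + 2 * (1 + 2 * (\<Sum>\<tau>\<in>(rank_one_index :: (('n + 'n) \<times> ('n + 'n) \<times> nat) set). norm (outer (rank_one_vec \<tau>) (rank_one_vec \<tau>)))))"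

lemma small_pos: "small > 0" and small_le: "small \<le> \<rho>"
proof -
  have "0 \<le> (\<Sum>\<tau>\<in>(rank_one_index :: (('n + 'n) \<times> ('n + 'n) \<times> nat) set). norm (outer (rank_one_vec \<tau>) (rank_one_vec \<tau>)))"
    by (intro sum_nonneg) simp
  then show "small > 0" "small \<le> \<rho>" using \<rho> by (auto simp: small_def field_simps)
qed

lemma joined_small:
  assumes A: "transpose A = A" "norm A < small" and B: "transpose B = B" "norm B < small"
    and nz: "cayley_crossing M0 A \<noteq> 0" "cayley_crossing M0 B \<noteq> 0"
  shows "joined A B"
proof -
  define H where "H = B - A"
  define r where "r = (\<lambda>\<tau> :: ('n + 'n) \<times> ('n + 'n) \<times> nat. outer (rank_one_vec \<tau>) (rank_one_vec \<tau>))"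
  define C where "C = (\<Sum>\<tau>\<in>rank_one_index. norm (r \<tau>))"
  have C: "C \<ge> 0" by (simp add: C_def sum_nonneg)
  have small: "small = \<rho> / (1 + 2 * (1 + 2 * C))" by (simp add: small_def C_def r_def)
  have symH: "transpose H = H" using A B by (simp add: H_def transpose_minus_mat)
  have normH: "norm H \<le> 2 * small" using norm_triangle_ineq4[of B A] A B by (simp add: H_def)
  have co: "\<bar>rank_one_coeff H \<tau>\<bar> \<le> 2 * small" for \<tau>
  proof -
    obtain i j k where \<tau>: "\<tau> = (i, j, k)" by (cases \<tau>)
    have "\<bar>H $ i $ j\<bar> \<le> norm H"
      using component_le_norm_cart[of "H $ i" j] Finite_Cartesian_Product.norm_nth_le[of H i] by (simp add: order_trans)
    then show ?thesis using normH small_pos by (auto simp: \<tau> rank_one_coeff_def)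
  qed
  have dom: "A + (\<Sum>\<tau>\<in>I. rank_one_coeff H \<tau> *\<^sub>R r \<tau>) \<in> dom" if I: "I \<subseteq> rank_one_index" for I
  proof -
    have "finite I" using I by (rule finite_subset) simp
    have "norm (\<Sum>\<tau>\<in>I. rank_one_coeff H \<tau> *\<^sub>R r \<tau>) \<le> (\<Sum>\<tau>\<in>I. (2 * small) * norm (r \<tau>))"
      by (rule order_trans[OF norm_sum]) (auto intro!: sum_mono mult_right_mono co)
    also have "\<dots> \<le> (\<Sum>\<tau>\<in>rank_one_index. (2 * small) * norm (r \<tau>))"
      using I small_pos by (intro sum_mono2) auto
    also have "\<dots> = 2 * small * C" by (simp add: C_def sum_distrib_left)
    finally have "norm (A + (\<Sum>\<tau>\<in>I. rank_one_coeff H \<tau> *\<^sub>R r \<tau>)) < small + 2 * small * C"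
      using norm_triangle_ineq[of A "\<Sum>\<tau>\<in>I. rank_one_coeff H \<tau> *\<^sub>R r \<tau>"] A(2) by linarith
    also have "\<dots> = small * (1 + 2 * C)" by (simp add: algebra_simps)
    also have "\<dots> \<le> \<rho>" unfolding small using C \<rho> by (simp add: field_simps)
    finally have "norm (A + (\<Sum>\<tau>\<in>I. rank_one_coeff H \<tau> *\<^sub>R r \<tau>)) < \<rho>" .
    moreover have "transpose (A + (\<Sum>\<tau>\<in>I. rank_one_coeff H \<tau> *\<^sub>R r \<tau>)) = A + (\<Sum>\<tau>\<in>I. rank_one_coeff H \<tau> *\<^sub>R r \<tau>)"
      using A(1) by (simp add: transpose_def vec_eq_iff r_def outer_def mult.commute)
    ultimately show ?thesis by (simp add: dom_def)
  qed
  have Adom: "A \<in> dom" using dom[of "{}"] by simp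
  have reach: "A + (\<Sum>\<tau>\<in>I. rank_one_coeff H \<tau> *\<^sub>R r \<tau>) \<in> reach A" if "I \<subseteq> rank_one_index" for I
  proof -
    have "finite I" using that by (rule finite_subset) simp
    then show ?thesis using that
    proof (induction I)
      case empty then show ?case using reach_refl[OF Adom nz(1)] by simp
    next
      case (insert \<tau> I)
      have e: "A + (\<Sum>\<tau>\<in>insert \<tau> I. rank_one_coeff H \<tau> *\<^sub>R r \<tau>)
          = (A + (\<Sum>\<tau>\<in>I. rank_one_coeff H \<tau> *\<^sub>R r \<tau>)) + rank_one_coeff H \<tau> *\<^sub>R outer (rank_one_vec \<tau>) (rank_one_vec \<tau>)"
        using insert.hyps by (simp add: r_def algebra_simps)
      show ?case unfolding e
        by (rule reach_rank_one[OF _ dom[OF insert.prems, unfolded e]]) (use insert in auto)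
    qed
  qed
  have "B = A + (\<Sum>\<tau>\<in>rank_one_index. rank_one_coeff H \<tau> *\<^sub>R r \<tau>)"
    unfolding r_def symmetric_rank_one_sum[OF symH] by (simp add: H_def)
  then have "B \<in> reach A" using reach[of rank_one_index] by simp
  then show ?thesis using nz(2) by (rule reach_off_Sp0)
qed

text \<open>Such a path lies in the image of a ball in the chart. Its ends can be joined in the ball by a path with transverse image, and any two paths with the same ends are
  homotopic in the convex set \<open>dom\<close>.\<close>

lemma deformable_in_chart:
  obtains U where "open U" "M0 \<in> U"
    "\<And>p. \<lbrakk>path p; path_image p \<subseteq> Sp \<inter> U; pathstart p \<notin> Sp0 1; pathfinish p \<notin> Sp0 1\<rbrakk> \<Longrightarrow> deformable p"
proof -
  define V where "V = {M :: 'n bmat. det (M + M0) \<noteq> 0}"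
  have oV: "open V" unfolding V_def
    by (intro open_Collect_neq continuous_intros)
  have cV: "continuous_on V (cayley_inv M0)"
    unfolding cayley_inv_def by (intro continuous_intros) (simp add: V_def)
  define U where "U = V \<inter> cayley_inv M0 -` ball 0 small"
  have oU: "open U" unfolding U_def by (rule continuous_open_preimage[OF cV oV]) simp
  have "det (M0 + M0) \<noteq> 0"
    unfolding det_nz_iff_kernel
  proof (intro allI impI)
    fix x assume "(M0 + M0) *v x = 0"
    then have "2 *\<^sub>R (M0 *v x) = 0" unfolding matrix_vector_mult_add_rdistrib scaleR_2 .
    then show "x = 0" using Sp_det_nz[OF M0] unfolding det_nz_iff_kernel by simp
  qed
  then have "M0 \<in> V" by (simp add: V_def)
  moreover have "cayley_inv M0 M0 = 0" by (simp add: cayley_inv_def)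
  ultimately have "M0 \<in> U" using small_pos by (simp add: U_def)
  moreover have "deformable p" if p: "path p" "path_image p \<subseteq> Sp \<inter> U" "pathstart p \<notin> Sp0 1" "pathfinish p \<notin> Sp0 1" for p
  proof -
    define q where "q = cayley_inv M0 \<circ> p"
    have pt: "p t \<in> Sp" "p t \<in> V" "norm (q t) < small" if "t \<in> {0..1}" for t
    proof -
      have "p t \<in> Sp \<inter> U" using p(2) that unfolding path_image_def by blast
      then show "p t \<in> Sp" "p t \<in> V" "norm (q t) < small" by (auto simp: U_def q_def)
    qed
    have qsym: "transpose (q t) = q t" and cq: "chart (q t) = p t" if "t \<in> {0..1}" for t
      using cayley_inv[OF M0 pt(1)[OF that]] pt(2)[OF that] by (auto simp: V_def q_def)
    have qdom: "q t \<in> dom" if "t \<in> {0..1}" for t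
      using qsym[OF that] pt(3)[OF that] small_le by (simp add: dom_def)
    have pq: "path q" unfolding q_def
      by (rule path_continuous_image[OF p(1)]) (use cV p(2) in \<open>auto intro: continuous_on_subset simp: U_def\<close>)
    have imq: "path_image q \<subseteq> dom" using qdom by (auto simp: path_image_def)
    have nz: "cayley_crossing M0 (q 0) \<noteq> 0" "cayley_crossing M0 (q 1) \<noteq> 0"
      using chart_off_Sp0[OF qdom[of 0]] chart_off_Sp0[OF qdom[of 1]] cq[of 0] cq[of 1] p(3,4)
      by (auto simp: pathstart_def pathfinish_def)
    have "joined (q 0) (q 1)"
      by (rule joined_small) (use qsym pt(3) nz in auto)
    then obtain \<zeta> where \<zeta>: "path \<zeta>" "path_image \<zeta> \<subseteq> dom" "pathstart \<zeta> = q 0" "pathfinish \<zeta> = q 1"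
        "transverse_path (chart \<circ> \<zeta>)"
      unfolding joined_def by blast
    have "homotopic_paths dom q \<zeta>"
      using convex_imp_simply_connected[OF convex_dom] pq imq \<zeta>
      unfolding simply_connected_eq_homotopic_paths by (simp add: pathstart_def pathfinish_def)
    then have "homotopic_paths Sp (chart \<circ> q) (chart \<circ> \<zeta>)"
      by (rule homotopic_paths_continuous_image[OF _ continuous_on_chart]) (use chart_in_Sp in auto)
    moreover have "homotopic_paths Sp p (chart \<circ> q)"
      by (rule homotopic_paths_eq[OF p(1)]) (use p(2) cq in auto)
    ultimately show ?thesis unfolding deformable_def using \<zeta>(5) homotopic_paths_trans by blast
  qed
  ultimately show ?thesis using oU that by blast
qed

end

lemma locally_deformable:
  fixes M0 :: "'n::finite bmat"
  assumes "M0 \<in> Sp"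
  obtains U where "open U" "M0 \<in> U"
    "\<And>p. \<lbrakk>path p; path_image p \<subseteq> Sp \<inter> U; pathstart p \<notin> Sp0 1; pathfinish p \<notin> Sp0 1\<rbrakk> \<Longrightarrow> deformable p"
proof -
  have "open {A :: 'n bmat. det (mat 1 - Jmat ** A) \<noteq> 0}"
    by (intro open_Collect_neq continuous_intros)
  then obtain \<rho> where \<rho>: "\<rho> > 0" "ball 0 \<rho> \<subseteq> {A :: 'n bmat. det (mat 1 - Jmat ** A) \<noteq> 0}"
    unfolding open_contains_ball by (metis (mono_tags, lifting) det_I diff_zero mem_Collect_eq times0_right zero_neq_one)
  interpret cayley_chart M0 \<rho>
    by unfold_locales (use assms \<rho> in \<open>auto simp: subset_iff\<close>)
  show ?thesis using deformable_in_chart that by blast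
qed

section \<open>Every path with admissible ends is homotopic to a transverse one\<close>

lemma deformable_join:
  assumes "deformable p" "deformable q" "pathfinish p = pathstart q"
  shows "deformable (p +++ q)"
proof -
  obtain \<xi> \<zeta> where 1: "transverse_path \<xi>" "homotopic_paths Sp p \<xi>" and 2: "transverse_path \<zeta>" "homotopic_paths Sp q \<zeta>"
    using assms unfolding deformable_def by blast
  have "homotopic_paths Sp (p +++ q) (\<xi> +++ \<zeta>)" by (rule homotopic_paths_join[OF 1(2) 2(2) assms(3)])
  moreover have "pathfinish \<xi> = pathstart \<zeta>"
    using homotopic_paths_imp_pathfinish[OF 1(2)] homotopic_paths_imp_pathstart[OF 2(2)] assms(3) by simp
  ultimately show ?thesis unfolding deformable_def using transverse_path_join[OF 1(1) 2(1)] by blast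
qed

lemma deformable_homotopic: "homotopic_paths Sp p q \<Longrightarrow> deformable q \<Longrightarrow> deformable p"
  unfolding deformable_def using homotopic_paths_trans by blast

lemma homotopic_paths_backtrack:
  fixes q R :: "real \<Rightarrow> 'a::real_normed_vector"
  assumes q: "path q" "path_image q \<subseteq> S" and R: "path R" "path_image R \<subseteq> S" "pathstart R = pathstart q"
  shows "homotopic_paths S (q +++ (reversepath q +++ R)) R"
proof -
  have "homotopic_paths S (q +++ (reversepath q +++ R)) ((q +++ reversepath q) +++ R)"
    by (rule homotopic_paths_assoc) (use q R in auto)
  moreover have "homotopic_paths S ((q +++ reversepath q) +++ R) (linepath (pathstart q) (pathstart q) +++ R)"
    by (rule homotopic_paths_join[OF homotopic_paths_rinv[OF q]]) (use R in auto)
  moreover have "homotopic_paths S (linepath (pathstart q) (pathstart q) +++ R) R"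
    by (rule homotopic_paths_lid') (use R in auto)
  ultimately show ?thesis using homotopic_paths_trans by blast
qed

text \<open>A short piece of the rotation \<open>\<epsilon> \<mapsto> rot \<epsilon> ** M\<close> leaves the hypersurface.\<close>

lemma escape_Sp0:
  assumes M: "M \<in> Sp" and U: "open U" "M \<in> U"
  obtains q where "path q" "path_image q \<subseteq> Sp \<inter> U" "pathstart q = M" "pathfinish q \<notin> Sp0 1"
proof -
  have "open ((\<lambda>\<epsilon>. rot \<epsilon> ** M) -` U)"
    by (rule open_vimage[OF U(1)]) (intro continuous_intros)
  moreover have "0 \<in> (\<lambda>\<epsilon>. rot \<epsilon> ** M) -` U" using U by (simp add: rot_0)
  ultimately obtain e where e: "e > 0" "ball 0 e \<subseteq> (\<lambda>\<epsilon>. rot \<epsilon> ** M) -` U" by (meson open_contains_ball)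
  obtain d where d: "d > 0" "\<And>\<epsilon>. 0 < \<epsilon> \<Longrightarrow> \<epsilon> < d \<Longrightarrow> rot \<epsilon> ** M \<notin> Sp0 1"
    using rot_off_Sp0[OF M] unfolding eventually_at_right_field by auto
  define \<epsilon> where "\<epsilon> = min (e/2) (d/2)"
  have \<epsilon>: "0 < \<epsilon>" "\<epsilon> < e" "\<epsilon> < d" using e d by (auto simp: \<epsilon>_def)
  show ?thesis
  proof (rule that[of "\<lambda>s. rot (s * \<epsilon>) ** M"])
    show "path (\<lambda>s. rot (s * \<epsilon>) ** M)" unfolding path_def by (intro continuous_intros)
    have "rot (s * \<epsilon>) ** M \<in> Sp \<inter> U" if "s \<in> {0..1}" for s
    proof -
      have "s * \<epsilon> \<le> 1 * \<epsilon>" using that \<epsilon> by (intro mult_right_mono) auto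
      moreover have "0 \<le> s * \<epsilon>" using that \<epsilon> by (intro mult_nonneg_nonneg) auto
      ultimately have "0 \<le> s * \<epsilon>" "s * \<epsilon> < e" using \<epsilon> by linarith+
      then have "s * \<epsilon> \<in> ball 0 e" by (simp add: dist_real_def)
      then show ?thesis using e(2) Sp_mult[OF rot_in_Sp M] by auto
    qed
    then show "path_image (\<lambda>s. rot (s * \<epsilon>) ** M) \<subseteq> Sp \<inter> U" by (auto simp: path_image_def)
    show "pathstart (\<lambda>s. rot (s * \<epsilon>) ** M) = M" by (simp add: pathstart_def rot_0)
    show "pathfinish (\<lambda>s. rot (s * \<epsilon>) ** M) \<notin> Sp0 1" using d(2) \<epsilon> by (simp add: pathfinish_def)
  qed
qed

text \<open>The set of times \<open>t\<close> at which the initial piece of \<open>\<eta>\<close> is deformable, once it is prolonged by an arbitrarily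
  short path \<open>q\<close> to a point off the hypersurface, is open and closed. To pass from \<open>x\<close> to a nearby \<open>y\<close>, travel back along \<open>q\<close>, follow \<open>\<eta>\<close> and leave along a
  new escape path: this detour lies in one chart, and its ends are off the hypersurface.\<close>

lemma deformable_path:
  assumes \<eta>: "path \<eta>" "path_image \<eta> \<subseteq> Sp" "\<eta> 0 \<notin> Sp0 1" "\<eta> 1 \<notin> Sp0 1"
  shows "deformable \<eta>"
proof -
  have inSp: "\<eta> t \<in> Sp" if "t \<in> {0..1}" for t using \<eta>(2) that unfolding path_image_def by blast
  define T where "T = (\<lambda>t. \<forall>U. open U \<longrightarrow> \<eta> t \<in> U \<longrightarrow> (\<exists>q. path q \<and> path_image q \<subseteq> Sp \<inter> U \<and>
      pathstart q = \<eta> t \<and> pathfinish q \<notin> Sp0 1 \<and> deformable (subpath 0 t \<eta> +++ q)))"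
  have sub: "path (subpath s t \<eta>)" "path_image (subpath s t \<eta>) \<subseteq> Sp" if "s \<in> {0..1}" "t \<in> {0..1}" for s t
    using that \<eta>(1,2) path_image_subpath_subset[OF that(1,2), of \<eta>] by auto
  have "T 1"
  proof (rule connected_induction_simple[where S = "{0..1::real}" and P = T and a = 0])
    show "T 0"
      unfolding T_def
    proof (intro allI impI)
      fix U assume U: "open U" "\<eta> 0 \<in> U"
      have "path_image (subpath 0 0 \<eta> +++ linepath (\<eta> 0) (\<eta> 0)) \<subseteq> Sp - Sp0 1"
        using \<eta>(3) inSp[of 0] by (auto simp: path_image_join subpath_refl)
      then have "transverse_path (subpath 0 0 \<eta> +++ linepath (\<eta> 0) (\<eta> 0))"
        by (intro transverse_path_off_Sp0) (simp_all add: subpath_refl)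
      moreover have "homotopic_paths Sp (subpath 0 0 \<eta> +++ linepath (\<eta> 0) (\<eta> 0)) (subpath 0 0 \<eta> +++ linepath (\<eta> 0) (\<eta> 0))"
        using calculation unfolding transverse_path_def by simp
      ultimately have "deformable (subpath 0 0 \<eta> +++ linepath (\<eta> 0) (\<eta> 0))" unfolding deformable_def by blast
      then show "\<exists>q. path q \<and> path_image q \<subseteq> Sp \<inter> U \<and> pathstart q = \<eta> 0 \<and> pathfinish q \<notin> Sp0 1 \<and>
          deformable (subpath 0 0 \<eta> +++ q)"
        using U \<eta>(3) inSp[of 0] by (intro exI[of _ "linepath (\<eta> 0) (\<eta> 0)"]) auto
    qed
    fix a :: real assume a: "a \<in> {0..1}"
    obtain U where U: "open U" "\<eta> a \<in> U"
      "\<And>p. \<lbrakk>path p; path_image p \<subseteq> Sp \<inter> U; pathstart p \<notin> Sp0 1; pathfinish p \<notin> Sp0 1\<rbrakk> \<Longrightarrow> deformable p"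
      using locally_deformable[OF inSp[OF a]] by blast
    obtain e where e: "e > 0" "\<And>t. t \<in> {0..1} \<Longrightarrow> dist t a < e \<Longrightarrow> \<eta> t \<in> U"
    proof -
      obtain e' where e': "e' > 0" "ball (\<eta> a) e' \<subseteq> U" using U open_contains_ball by blast
      obtain d where "d > 0" "\<forall>t\<in>{0..1}. dist t a < d \<longrightarrow> dist (\<eta> t) (\<eta> a) < e'"
        using \<eta>(1) a e'(1) unfolding path_def continuous_on_iff by blast
      then show ?thesis using e'(2) that[of d] by (auto simp: dist_commute subset_iff)
    qed
    show "\<exists>X. openin (top_of_set {0..1}) X \<and> a \<in> X \<and> (\<forall>x\<in>X. \<forall>y\<in>X. T x \<longrightarrow> T y)"
    proof (intro exI[of _ "{0..1} \<inter> ball a e"] conjI ballI impI)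
      show "openin (top_of_set {0..1}) ({0..1} \<inter> ball a e)" by (simp add: openin_open_Int)
      show "a \<in> {0..1} \<inter> ball a e" using a e by simp
      fix x y assume x: "x \<in> {0..1} \<inter> ball a e" and y: "y \<in> {0..1} \<inter> ball a e" and Tx: "T x"
      have xU: "\<eta> x \<in> U" and yU: "\<eta> y \<in> U" using x y e by (auto simp: dist_commute)
      have "closed_segment x y \<subseteq> {0..1} \<inter> ball a e"
        using x y by (intro closed_segment_subset convex_Int convex_real_interval convex_ball)
      then have "\<eta> z \<in> U" if "z \<in> closed_segment x y" for z
        using that e(2)[of z] by (auto simp: dist_commute subset_iff)
      then have "\<eta> ` closed_segment x y \<subseteq> U" by blast
      moreover have "path_image (subpath x y \<eta>) = \<eta> ` closed_segment x y"
        by (auto simp: path_image_subpath_gen)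
      ultimately have sU: "path_image (subpath x y \<eta>) \<subseteq> Sp \<inter> U" using sub(2)[of x y] x y by auto
      show "T y"
        unfolding T_def
      proof (intro allI impI)
        fix V assume V: "open V" "\<eta> y \<in> V"
        obtain q' where q': "path q'" "path_image q' \<subseteq> Sp \<inter> (U \<inter> V)" "pathstart q' = \<eta> y" "pathfinish q' \<notin> Sp0 1"
          using escape_Sp0[of "\<eta> y" "U \<inter> V"] inSp[of y] y yU V U(1) by (metis IntD1 IntI open_Int)
        obtain q where q: "path q" "path_image q \<subseteq> Sp \<inter> U" "pathstart q = \<eta> x" "pathfinish q \<notin> Sp0 1"
            "deformable (subpath 0 x \<eta> +++ q)"
          using Tx U(1) xU unfolding T_def by blast
        define A B C where "A = subpath 0 x \<eta>" and "B = subpath x y \<eta>" and "C = subpath 0 y \<eta>"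
        have A: "path A" "path_image A \<subseteq> Sp" "pathfinish A = \<eta> x" and B: "path B" "path_image B \<subseteq> Sp" "pathstart B = \<eta> x" "pathfinish B = \<eta> y"
          using sub[of 0 x] sub[of x y] x y by (auto simp: A_def B_def)
        have BU: "path_image B \<subseteq> Sp \<inter> U" using sU by (simp add: B_def)
        have "deformable (reversepath q +++ (B +++ q'))"
        proof (rule U(3))
          show "path_image (reversepath q +++ (B +++ q')) \<subseteq> Sp \<inter> U"
            using q(2) q'(2) BU by (intro subset_path_image_join) auto
        qed (use q q' B in auto)
        then have d: "deformable ((A +++ q) +++ (reversepath q +++ (B +++ q')))"
          by (rule deformable_join[OF q(5)[folded A_def]]) (use q in simp)
        have qS: "path_image q \<subseteq> Sp" "path_image q' \<subseteq> Sp" using q(2) q'(2) by auto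
        have BqS: "path_image (B +++ q') \<subseteq> Sp" using qS B(2) by (intro subset_path_image_join)
        have RS: "path_image (reversepath q +++ (B +++ q')) \<subseteq> Sp" using qS B(2) by (intro subset_path_image_join) auto
        have h1: "homotopic_paths Sp (A +++ (q +++ (reversepath q +++ (B +++ q')))) ((A +++ q) +++ (reversepath q +++ (B +++ q')))"
          by (rule homotopic_paths_assoc) (use q q' A B qS RS in auto)
        have h2: "homotopic_paths Sp (A +++ (q +++ (reversepath q +++ (B +++ q')))) (A +++ (B +++ q'))"
        proof (rule homotopic_paths_join)
          show "homotopic_paths Sp A A" using A by simp
          show "homotopic_paths Sp (q +++ (reversepath q +++ (B +++ q'))) (B +++ q')"
            by (rule homotopic_paths_backtrack) (use q q' B qS BqS in auto)
        qed (use A q in auto)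
        have h3: "homotopic_paths Sp (A +++ (B +++ q')) ((A +++ B) +++ q')"
          by (rule homotopic_paths_assoc) (use q' A B qS in auto)
        have h4: "homotopic_paths Sp ((A +++ B) +++ q') (C +++ q')"
        proof (rule homotopic_paths_join)
          show "homotopic_paths Sp (A +++ B) C"
            unfolding A_def B_def C_def by (rule homotopic_join_subpaths) (use \<eta> x y in auto)
          show "homotopic_paths Sp q' q'" using q'(1) qS by simp
        qed (use A B q' in auto)
        have "homotopic_paths Sp (C +++ q') ((A +++ q) +++ (reversepath q +++ (B +++ q')))"
          using h1 h2 h3 h4 by (meson homotopic_paths_sym homotopic_paths_trans)
        then have "deformable (C +++ q')" using d deformable_homotopic by blast
        then show "\<exists>q. path q \<and> path_image q \<subseteq> Sp \<inter> V \<and> pathstart q = \<eta> y \<and> pathfinish q \<notin> Sp0 1 \<and>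
            deformable (subpath 0 y \<eta> +++ q)"
          using q' by (intro exI[of _ q']) (auto simp: C_def)
      qed
    qed
  qed auto
  obtain U where U: "open U" "\<eta> 1 \<in> U"
      "\<And>p. \<lbrakk>path p; path_image p \<subseteq> Sp \<inter> U; pathstart p \<notin> Sp0 1; pathfinish p \<notin> Sp0 1\<rbrakk> \<Longrightarrow> deformable p"
    using locally_deformable[OF inSp[of 1]] by auto
  obtain q where q: "path q" "path_image q \<subseteq> Sp \<inter> U" "pathstart q = \<eta> 1" "pathfinish q \<notin> Sp0 1"
      "deformable (subpath 0 1 \<eta> +++ q)"
    using \<open>T 1\<close> U(1,2) unfolding T_def by blast
  have qS: "path_image q \<subseteq> Sp" using q(2) by auto
  have "deformable (reversepath q)" by (rule U(3)) (use q \<eta>(4) in auto)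
  then have d: "deformable ((\<eta> +++ q) +++ reversepath q)"
    by (rule deformable_join[rotated]) (use q(5) in simp_all)
  have e1: "pathfinish \<eta> = \<eta> 1" by (simp add: pathfinish_def)
  have "homotopic_paths Sp (\<eta> +++ (q +++ reversepath q)) ((\<eta> +++ q) +++ reversepath q)"
    by (rule homotopic_paths_assoc) (use \<eta> q qS e1 in auto)
  moreover have "homotopic_paths Sp (\<eta> +++ (q +++ reversepath q)) (\<eta> +++ linepath (\<eta> 1) (\<eta> 1))"
    using homotopic_paths_rinv[OF q(1) qS] \<eta>(1,2) q(3) e1 by (intro homotopic_paths_join) auto
  moreover have "homotopic_paths Sp (\<eta> +++ linepath (\<eta> 1) (\<eta> 1)) \<eta>"
    by (rule homotopic_paths_rid') (use \<eta> e1 in auto)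
  ultimately have "homotopic_paths Sp \<eta> ((\<eta> +++ q) +++ reversepath q)"
    by (meson homotopic_paths_sym homotopic_paths_trans)
  then show ?thesis using d deformable_homotopic by blast
qed

section \<open>The Maslov-type index up to a bounded error\<close>

lemma has_intersection_number_exists:
  assumes l: "0 \<le> l" and \<eta>: "continuous_on {0..l} \<eta>" "\<And>t. t \<in> {0..l} \<Longrightarrow> \<eta> t \<in> Sp"
    and ends: "\<eta> 0 \<notin> Sp0 1" "\<eta> l \<notin> Sp0 1"
  shows "\<exists>m. has_intersection_number 1 \<eta> 0 l m"
proof -
  define p where "p = \<eta> \<circ> linepath 0 l"
  have im: "linepath 0 l t \<in> {0..l}" if "t \<in> {0..1}" for t
    using that l by (auto simp: linepath_def mult_left_le_one_le)
  have "path p"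
    unfolding p_def path_def by (rule continuous_on_compose) (use im in \<open>auto intro!: continuous_intros intro: continuous_on_subset[OF \<eta>(1)]\<close>)
  moreover have "path_image p \<subseteq> Sp" using im \<eta>(2) by (auto simp: p_def path_image_def)
  moreover have "p 0 \<notin> Sp0 1" "p 1 \<notin> Sp0 1" using ends by (simp_all add: p_def linepath_def)
  ultimately have "deformable p" by (rule deformable_path)
  then obtain \<xi> where \<xi>: "transverse_path \<xi>" "homotopic_paths Sp p \<xi>" unfolding deformable_def by blast
  then have "\<forall>t\<in>crossings \<xi>. \<exists>\<sigma>. transverse_crossing 1 \<xi> t \<sigma>" by (simp add: transverse_path_def)
  then obtain \<sigma> where "\<forall>t\<in>crossings \<xi>. transverse_crossing 1 \<xi> t (\<sigma> t)" by metis
  then have "has_intersection_number 1 \<eta> 0 l (\<Sum>t\<in>crossings \<xi>. \<sigma> t)"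
    using \<xi> ends unfolding has_intersection_number_def p_def transverse_path_def crossings_def by blast
  then show ?thesis by blast
qed

lemma pdet_1_nz: "M \<in> Sp \<Longrightarrow> pdet 1 M \<noteq> 0"
  using pdet_nz[of M 1] by simp

lemma has_intersection_number_formula:
  assumes "has_intersection_number 1 \<eta> a b m"
  shows "- pi * real_of_int m
    = arg_change (\<lambda>t. pdet 1 (\<eta> (linepath a b t))) + end_angle (\<eta> b) - end_angle (\<eta> a)"
proof -
  obtain \<xi> \<sigma> where ends: "\<eta> a \<notin> Sp0 1" "\<eta> b \<notin> Sp0 1" and hom: "homotopic_paths Sp (\<eta> \<circ> linepath a b) \<xi>"
    and fin: "finite (crossings \<xi>)" and tr: "\<And>t. t \<in> crossings \<xi> \<Longrightarrow> transverse_crossing 1 \<xi> t (\<sigma> t)"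
    and m: "m = (\<Sum>t\<in>crossings \<xi>. \<sigma> t)"
    using assms unfolding has_intersection_number_def crossings_def by blast
  have \<xi>: "path \<xi>" "path_image \<xi> \<subseteq> Sp" using homotopic_paths_imp_path[OF hom] homotopic_paths_imp_subset[OF hom] by auto
  have e: "\<xi> 0 = \<eta> a" "\<xi> 1 = \<eta> b"
    using homotopic_paths_imp_pathstart[OF hom] homotopic_paths_imp_pathfinish[OF hom]
    by (simp_all add: pathstart_def pathfinish_def linepath_def)
  have "homotopic_paths (- {0}) (pdet 1 \<circ> (\<eta> \<circ> linepath a b)) (pdet 1 \<circ> \<xi>)"
    by (rule homotopic_paths_continuous_image[OF hom]) (use pdet_1_nz in \<open>auto intro!: continuous_intros\<close>)
  from arg_change_homotopic[OF this]
  have "arg_change (\<lambda>t. pdet 1 (\<eta> (linepath a b t))) = arg_change (\<lambda>t. pdet 1 (\<xi> t))" by (simp add: o_def)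
  then show ?thesis using crossing_formula[OF \<xi> _ _ fin tr] ends by (simp add: e m)
qed

lemma arg_change_real_multiple:
  fixes x :: "real \<Rightarrow> real"
  assumes x: "continuous_on {0..1} x" "\<And>t. t \<in> {0..1} \<Longrightarrow> x t \<noteq> 0" and z: "z \<noteq> 0"
  shows "arg_change (\<lambda>t. z * complex_of_real (x t)) = 0"
proof -
  have "is_interval (x ` {0..1})"
    unfolding is_interval_connected_1 by (rule connected_continuous_image[OF x(1)]) simp
  then have same: "\<not> (x s < 0 \<and> 0 < x t)" if "s \<in> {0..1}" "t \<in> {0..1}" for s t
    using that x(2) mem_is_interval_1_I[of "x ` {0..1}" "x s" "x t" 0] by force
  define u where "u = sgn (x 0)"
  have u: "u \<noteq> 0" using x(2)[of 0] by (simp add: u_def sgn_eq_0_iff)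
  have sg: "u * x t > 0" if "t \<in> {0..1}" for t
    using same[of 0 t] same[of t 0] x(2)[of 0] x(2)[OF that] that
    by (auto simp: u_def sgn_if zero_less_mult_iff) 
  have "arg_change (\<lambda>t. z * complex_of_real (x t)) = arg_change (\<lambda>t. (z / complex_of_real u) * complex_of_real (u * x t))"
    using u by simp
  also have "\<dots> = arg_change (\<lambda>t. complex_of_real (u * x t))"
  proof (rule arg_change_cmult)
    show "continuous_on {0..1} (\<lambda>t. complex_of_real (u * x t))" by (intro continuous_intros x)
    show "complex_of_real (u * x t) \<noteq> 0" if "t \<in> {0..1}" for t
      using sg[OF that] by (simp only: of_real_eq_0_iff)
  qed (use z u in simp)
  also have "\<dots> = Im (complex_of_real (ln (u * x 1))) - Im (complex_of_real (ln (u * x 0)))"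
  proof (rule arg_change_eq)
    show "continuous_on {0..1} (\<lambda>t. complex_of_real (ln (u * x t)))"
      using sg by (intro continuous_intros x) force
    show "complex_of_real (u * x t) = exp (complex_of_real (ln (u * x t)))" if "t \<in> {0..1}" for t
      using sg[OF that] by (simp only: exp_of_real exp_ln)
  qed
  finally show ?thesis by simp
qed

text \<open>On the square spanned by \<open>\<epsilon>\<close> and \<open>q\<close> the edge \<open>q = 0\<close> contributes nothing, since the determinant there is a nonvanishing
  real multiple of a constant. The edge \<open>q = 1\<close> gives an amount that does not depend on \<open>M\<close>, so it
  cancels in the difference of the two ends of a path.\<close>

lemma end_angle_rot_difference:
  fixes M :: "'n::finite bmat"
  assumes M: "M \<in> Sp" and off: "\<And>\<epsilon>. \<epsilon> \<in> {a..b} \<Longrightarrow> rot \<epsilon> ** M \<notin> Sp0 1" and ab: "a \<le> b"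
  shows "end_angle (rot b ** M) - end_angle (rot a ** M)
    = - arg_change (\<lambda>r. pdet 1 (rot (linepath a b r) :: 'n bmat) / pdet 1 (mat 1 :: 'n bmat))"
proof -
  define F where "F = (\<lambda>x. pdet (complex_of_real (1 - snd x)) (rot (linepath a b (fst x)) ** M))"
  have lp: "linepath a b r \<in> {a..b}" if "r \<in> {0..1}" for r
    using linepath_in_path[OF that, of a b] ab by (simp add: closed_segment_eq_real_ivl)
  have inSp: "rot \<epsilon> ** M \<in> Sp" for \<epsilon> using Sp_mult[OF rot_in_Sp M] .
  have nz: "F x \<noteq> 0" if "x \<in> {0..1} \<times> {0..1}" for x
    unfolding F_def by (rule pdet_nz'[OF inSp]) (use that off[OF lp] in auto)
  have lpc: "continuous_on S (\<lambda>x. linepath a b (f x))" if "continuous_on S f" for S and f :: "real \<times> real \<Rightarrow> real"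
    unfolding linepath_def by (intro continuous_intros that)
  have cont: "continuous_on ({0..1} \<times> {0..1}) F"
    unfolding F_def by (intro continuous_intros lpc)
  from arg_change_square[OF cont nz]
  have sq: "end_angle (rot b ** M) - end_angle (rot a ** M)
      = arg_change (\<lambda>r. F (r, 1)) - arg_change (\<lambda>r. F (r, 0))"
    by (simp add: F_def end_angle_def linepath_def)
  have lpc1: "continuous_on {0..1} (linepath a b)" unfolding linepath_def by (intro continuous_intros)
  have "arg_change (\<lambda>r. F (r, 1)) = arg_change (\<lambda>r. det (Ji :: complex ^ ('n + 'n) ^ ('n + 'n)) * complex_of_real (det (rot (linepath a b r) ** M - mat 1)))"
    by (simp add: F_def pdet_0)
  also have "\<dots> = 0"
    by (rule arg_change_real_multiple[OF _ _ det_Ji])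
      (use off[OF lp] inSp in \<open>auto intro!: continuous_intros lpc1 simp: Sp0_1\<close>)
  finally have 1: "arg_change (\<lambda>r. F (r, 1)) = 0" .
  have nz1: "pdet 1 (mat 1 :: 'n bmat) \<noteq> 0" by (rule pdet_1_nz[OF mat_1_in_Sp])
  have c: "pdet 1 (rot \<epsilon> ** M) = pdet 1 M * (pdet 1 (rot \<epsilon> :: 'n bmat) / pdet 1 (mat 1 :: 'n bmat))" for \<epsilon>
  proof -
    obtain k where k: "\<And>M :: 'n bmat. pdet 1 (rot \<epsilon> ** M) = k * pdet 1 M" using pdet_1_rot by blast
    show ?thesis using k[of M] k[of "mat 1"] nz1 by simp
  qed
  have "arg_change (\<lambda>r. F (r, 0)) = arg_change (\<lambda>r. pdet 1 M * (pdet 1 (rot (linepath a b r) :: 'n bmat) / pdet 1 (mat 1 :: 'n bmat)))"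
    by (simp add: F_def c)
  also have "\<dots> = arg_change (\<lambda>r. pdet 1 (rot (linepath a b r) :: 'n bmat) / pdet 1 (mat 1 :: 'n bmat))"
    by (rule arg_change_cmult) (use pdet_1_nz[OF M] pdet_1_nz[OF rot_in_Sp] nz1 in \<open>auto intro!: continuous_intros lpc1\<close>)
  finally show ?thesis using sq 1 by simp
qed

text \<open>For small \<open>\<epsilon>\<close> the perturbed ends are off the hypersurface, so an intersection number exists, and by the crossing formula it is
  determined by the angle and the end angles. The difference of the end angles does not depend on \<open>\<epsilon>\<close>; hence the intersection
  number is eventually constant and is the value of the definite description.\<close>

lemma maslov_iota_bound:
  fixes \<gamma> :: "real \<Rightarrow> 'n::finite bmat"
  assumes l: "0 \<le> l" and cont: "continuous_on {0..l} \<gamma>" and Sp: "\<And>t. t \<in> {0..l} \<Longrightarrow> \<gamma> t \<in> Sp"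
  shows "\<bar>- pi * real_of_int (maslov_iota 1 (mat 1) \<gamma> 0 l) - arg_change (\<lambda>t. pdet 1 (\<gamma> (linepath 0 l t)))\<bar>
    \<le> 2 * CARD('n + 'n) * pi"
proof -
  define \<eta> where "\<eta> = (\<lambda>\<epsilon> t. rot \<epsilon> ** \<gamma> t)"
  have inv1: "matrix_inv (mat 1) = (mat 1 :: 'n bmat)"
    unfolding matrix_inv_def by (rule some_equality) auto
  have ends: "\<gamma> 0 \<in> Sp" "\<gamma> l \<in> Sp" using Sp l by auto
  obtain d where d: "d > 0" "\<And>\<epsilon>. 0 < \<epsilon> \<Longrightarrow> \<epsilon> < d \<Longrightarrow> \<eta> \<epsilon> 0 \<notin> Sp0 1 \<and> \<eta> \<epsilon> l \<notin> Sp0 1"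
    using eventually_conj[OF rot_off_Sp0[OF ends(1)] rot_off_Sp0[OF ends(2)]]
    unfolding eventually_at_right_field \<eta>_def by auto
  have \<eta>Sp: "\<eta> \<epsilon> t \<in> Sp" if "t \<in> {0..l}" for \<epsilon> t unfolding \<eta>_def using Sp_mult[OF rot_in_Sp Sp[OF that]] .
  have lp: "linepath 0 l t \<in> {0..l}" if "t \<in> {0..1}" for t
    using that l by (auto simp: linepath_def mult_left_le_one_le)
  have pc: "continuous_on {0..1} (\<lambda>t. \<gamma> (linepath 0 l t))"
    by (rule continuous_on_compose2[OF cont]) (use lp in \<open>auto intro!: continuous_intros\<close>)
  have ac: "arg_change (\<lambda>t. pdet 1 (\<eta> \<epsilon> (linepath 0 l t))) = arg_change (\<lambda>t. pdet 1 (\<gamma> (linepath 0 l t)))" for \<epsilon>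
  proof -
    obtain k where k: "\<And>M :: 'n bmat. pdet 1 (rot \<epsilon> ** M) = k * pdet 1 M" using pdet_1_rot by blast
    have "k \<noteq> 0" using k[of "mat 1"] pdet_1_nz[OF rot_in_Sp, of \<epsilon>] by auto
    then have "arg_change (\<lambda>t. k * pdet 1 (\<gamma> (linepath 0 l t))) = arg_change (\<lambda>t. pdet 1 (\<gamma> (linepath 0 l t)))"
      by (intro arg_change_cmult) (use pc lp Sp pdet_1_nz in \<open>auto intro!: continuous_intros\<close>)
    then show ?thesis by (simp add: \<eta>_def k)
  qed
  have ex: "\<exists>m. has_intersection_number 1 (\<eta> \<epsilon>) 0 l m" if "0 < \<epsilon>" "\<epsilon> < d" for \<epsilon>
    by (rule has_intersection_number_exists[OF l]) (use d(2)[OF that] \<eta>Sp cont in \<open>auto simp: \<eta>_def intro!: continuous_intros\<close>)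
  obtain m where m: "has_intersection_number 1 (\<eta> (d/2)) 0 l m" using ex[of "d/2"] d by auto
  have form: "- pi * real_of_int m' = arg_change (\<lambda>t. pdet 1 (\<gamma> (linepath 0 l t))) + end_angle (\<eta> \<epsilon> l) - end_angle (\<eta> \<epsilon> 0)"
    if "has_intersection_number 1 (\<eta> \<epsilon>) 0 l m'" for \<epsilon> m'
    using has_intersection_number_formula[OF that] unfolding ac .
  have same: "m' = m" if h: "has_intersection_number 1 (\<eta> \<epsilon>) 0 l m'" and \<epsilon>: "0 < \<epsilon>" "\<epsilon> < d" for \<epsilon> m'
  proof -
    define a b where "a = min \<epsilon> (d/2)" and "b = max \<epsilon> (d/2)"
    have ab: "a \<le> b" "0 < a" "b < d" using \<epsilon> by (auto simp: a_def b_def)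
    have "end_angle (\<eta> b t) - end_angle (\<eta> a t)
        = - arg_change (\<lambda>r. pdet 1 (rot (linepath a b r) :: 'n bmat) / pdet 1 (mat 1 :: 'n bmat))" if "t = 0 \<or> t = l" for t
      unfolding \<eta>_def
      by (rule end_angle_rot_difference) (use that ends ab d(2) in \<open>auto simp: \<eta>_def\<close>)
    from this[of 0] this[of l]
    have "end_angle (\<eta> b l) - end_angle (\<eta> b 0) = end_angle (\<eta> a l) - end_angle (\<eta> a 0)" by simp
    then have "end_angle (\<eta> \<epsilon> l) - end_angle (\<eta> \<epsilon> 0) = end_angle (\<eta> (d/2) l) - end_angle (\<eta> (d/2) 0)"
      by (cases "\<epsilon> \<le> d/2") (auto simp: a_def b_def min_def max_def)
    then have "- pi * real_of_int m' = - pi * real_of_int m" using form[OF h] form[OF m] by simp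
    then show ?thesis by simp
  qed
  have path: "(\<lambda>t. mexp ((- \<epsilon>) *\<^sub>R Jmat) ** \<gamma> t ** matrix_inv (mat 1)) = \<eta> \<epsilon>" for \<epsilon>
    by (simp add: \<eta>_def rot_def inv1)
  have "maslov_iota 1 (mat 1) \<gamma> 0 l = m"
    unfolding maslov_iota_def path
  proof (rule the_equality)
    have "has_intersection_number 1 (\<eta> \<epsilon>) 0 l m" if "0 < \<epsilon>" "\<epsilon> < d" for \<epsilon>
      using ex[OF that] same[OF _ that] by blast
    then show "\<forall>\<^sub>F \<epsilon> in at_right 0. has_intersection_number 1 (\<eta> \<epsilon>) 0 l m"
      unfolding eventually_at_right_field using d(1) by auto
    fix m' assume "\<forall>\<^sub>F \<epsilon> in at_right 0. has_intersection_number 1 (\<eta> \<epsilon>) 0 l m'"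
    then obtain e where e: "e > 0" "\<And>\<epsilon>. 0 < \<epsilon> \<Longrightarrow> \<epsilon> < e \<Longrightarrow> has_intersection_number 1 (\<eta> \<epsilon>) 0 l m'"
      unfolding eventually_at_right_field by auto
    show "m' = m" using same[of "min (e/2) (d/2)" m'] e d(1) by auto
  qed
  moreover have "\<bar>end_angle (\<eta> (d/2) t)\<bar> \<le> CARD('n + 'n) * pi" if "t = 0 \<or> t = l" for t
    using d(1) d(2)[of "d/2"] \<eta>Sp[of t "d/2"] that l by (intro end_angle_bound) auto
  from this[of 0] this[of l] form[OF m]
  have "\<bar>- pi * real_of_int m - arg_change (\<lambda>t. pdet 1 (\<gamma> (linepath 0 l t)))\<bar> \<le> 2 * CARD('n + 'n) * pi"
    by (simp add: abs_if split: if_splits)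
  ultimately show ?thesis by simp
qed

section \<open>Angle of a product\<close>

lemma Ji_eigen_form:
  assumes "Ji *v z = c *\<^sub>R z" shows "z \<bullet> (Ji *v z) = c * (norm z)\<^sup>2"
  using assms by (simp add: power2_norm_eq_inner)

lemma Sp_inverse:
  assumes N: "N \<in> Sp" obtains R where "R \<in> Sp" "N ** R = mat 1" "R ** N = mat 1"
proof -
  obtain R where R: "R ** N = mat 1"
    using Sp_det_nz[OF N] invertible_det_nz invertible_left_inverse by metis
  then have NR: "N ** R = mat 1" by (simp add: matrix_left_right_inverse)
  have "transpose R ** Jmat ** R = transpose R ** (transpose N ** Jmat ** N) ** R" using N by (simp add: Sp_def)
  also have "\<dots> = transpose (N ** R) ** Jmat ** (N ** R)" by (simp add: matrix_transpose_mul matrix_mul_assoc)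
  finally have "R \<in> Sp" unfolding NR by (simp add: Sp_def)
  then show ?thesis using that R NR by blast
qed

text \<open>For \<open>N\<close> with inverse \<open>R\<close> this family connects, up to constant nonsingular factors, the pencil of \<open>M\<close> at \<open>r = 0\<close> with
  that of \<open>M ** N\<close> at \<open>r = 1\<close>. At \<open>r = 1\<close> it is \<open>2 ((mat 1 + Ji) ** M + (mat 1 - Ji) ** R)\<close>; the factor
  \<open>(mat 1 - Ji) + r (mat 1 + Ji)\<close> fades out, as \<open>r\<close> decreases to \<open>0\<close>, the part of \<open>R\<close> that mixes the positive and negative
  subspaces of the Krein form.\<close>

definition mixed :: "real \<Rightarrow> 'n::finite bmat \<Rightarrow> 'n bmat \<Rightarrow> complex ^ ('n + 'n) ^ ('n + 'n)" where
  "mixed r R M = mat 2 ** ((mat 1 + Ji) ** cmat M)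
     + (mat 1 - Ji) ** cmat R ** ((mat 1 - Ji) + mat (complex_of_real r) ** (mat 1 + Ji))"

lemma mv_scaleR: "A *v (c *\<^sub>R x) = c *\<^sub>R (A *v x)" for A :: "'a::real_normed_field ^ 'm ^ 'n"
  by (simp add: matrix_vector_mult_def vec_eq_iff scaleR_sum_right)

lemma mat_commute: "X ** mat z = mat z ** X" for X :: "'a::comm_semiring_1 ^ 'm ^ 'm"
  by (simp add: vec_eq_iff mat_mult_nth)
     (simp add: matrix_matrix_mult_def mat_def if_distrib if_distribR mult.commute cong: if_cong)

lemma one_pm_Ji_mv: "(mat 1 + Ji) *v x = x + Ji *v x" "(mat 1 - Ji) *v x = x - Ji *v x"
  by (simp_all add: matrix_vector_mult_add_rdistrib matrix_vector_mult_diff_rdistrib)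

lemma mixed_mv:
  "mixed r R M *v x = 2 *\<^sub>R (cmat M *v x + Ji *v (cmat M *v x))
     + (cmat R *v ((1 + r) *\<^sub>R x - (1 - r) *\<^sub>R (Ji *v x)) - Ji *v (cmat R *v ((1 + r) *\<^sub>R x - (1 - r) *\<^sub>R (Ji *v x))))"
proof -
  have u: "(x - Ji *v x) + complex_of_real r *s (x + Ji *v x) = (1 + r) *\<^sub>R x - (1 - r) *\<^sub>R (Ji *v x)"
    by (simp add: vec_eq_iff scaleR_conv_of_real[where 'a=complex] algebra_simps)
  have t: "(2::complex) *s z = 2 *\<^sub>R z" for z :: "complex ^ ('a + 'a)"
    by (simp add: vec_eq_iff scaleR_conv_of_real[where 'a=complex])
  show ?thesis
    unfolding mixed_def matrix_vector_mult_add_rdistrib[of "mat 2 ** _"] matrix_vector_mul_assoc[symmetric]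
      matrix_vector_mult_add_rdistrib[of "mat 1 - Ji" "mat _ ** _"] mat_vector_mult one_pm_Ji_mv u t ..
qed

text \<open>The two summands lie in complementary eigenspaces of \<open>Ji\<close>, so for a kernel vector \<open>x\<close> both vanish: \<open>M x\<close> is in the negative subspace and
  \<open>R u\<close> in the positive one, where \<open>u = (1 - Ji) x + r (1 + Ji) x\<close>. Since \<open>M\<close> preserves the Krein form, its value at \<open>x\<close> is
  nonpositive, and so is its value at \<open>u\<close>, whose positive part is shrunk by the factor \<open>r \<le> 1\<close>. As \<open>R\<close> preserves the form as well and \<open>R u\<close>
  is in the positive subspace, both values are \<open>0\<close>, and \<open>M x = 0\<close>.\<close>

lemma mixed_nz:
  assumes M: "M \<in> Sp" and R: "R \<in> Sp" and r: "0 \<le> r" "r \<le> 1"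
  shows "det (mixed r R M) \<noteq> 0"
  unfolding det_nz_iff_kernel
proof (intro allI impI)
  fix x assume 0: "mixed r R M *v x = 0"
  define y where "y = cmat M *v x"
  define u where "u = (1 + r) *\<^sub>R x - (1 - r) *\<^sub>R (Ji *v x)"
  define z where "z = cmat R *v u"
  have 1: "2 *\<^sub>R (y + Ji *v y) + (z - Ji *v z) = 0"
    using 0 unfolding mixed_mv y_def z_def u_def .
  have lin: "Ji *v (a + b) = Ji *v a + Ji *v b" "Ji *v (a - b) = Ji *v a - Ji *v b" "Ji *v (c *\<^sub>R a) = c *\<^sub>R (Ji *v a)"
    for a b :: "complex ^ ('a + 'a)" and c
    by (simp_all add: matrix_vector_right_distrib matrix_vector_mult_diff_distrib mv_scaleR)
  have 2: "2 *\<^sub>R (Ji *v y + y) + (Ji *v z - z) = 0"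
    using arg_cong[OF 1, of "\<lambda>w. Ji *v w"] by (simp add: lin Ji_square)
  have "4 *\<^sub>R (y + Ji *v y) = (2 *\<^sub>R (y + Ji *v y) + (z - Ji *v z)) + (2 *\<^sub>R (Ji *v y + y) + (Ji *v z - z))"
    by (simp add: vec_eq_iff scaleR_conv_of_real[where 'a=complex] algebra_simps)
  then have "4 *\<^sub>R (y + Ji *v y) = 0" unfolding 1 2 by simp
  then have Jy: "Ji *v y = (-1) *\<^sub>R y" by (simp add: add_eq_0_iff)
  then have Jz: "Ji *v z = 1 *\<^sub>R z" using 1 by simp
  have hx: "x \<bullet> (Ji *v x) = - (norm y)\<^sup>2"
    using Sp_form[OF M, of x] Ji_eigen_form[OF Jy] by (simp add: y_def)
  have hu: "u \<bullet> (Ji *v u) = (norm z)\<^sup>2"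
    using Sp_form[OF R, of u] Ji_eigen_form[OF Jz] by (simp add: z_def)
  have JJ: "(Ji *v x) \<bullet> (Ji *v x) = x \<bullet> x" using inner_Ji[of "Ji *v x" x] by (simp add: Ji_square)
  have c: "(Ji *v x) \<bullet> x = x \<bullet> (Ji *v x)" by (rule inner_commute)
  have "u \<bullet> (Ji *v u) = ((1 + r)\<^sup>2 + (1 - r)\<^sup>2) * (x \<bullet> (Ji *v x)) - 2 * ((1 + r) * (1 - r)) * (x \<bullet> x)"
    unfolding u_def lin Ji_square inner_diff_left inner_diff_right inner_scaleR_left inner_scaleR_right JJ c
    by (simp add: power2_eq_square algebra_simps)
  also have "\<dots> \<le> ((1 + r)\<^sup>2 + (1 - r)\<^sup>2) * (x \<bullet> (Ji *v x))"
    using r by (simp add: mult_nonneg_nonneg)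
  also have "\<dots> = - (((1 + r)\<^sup>2 + (1 - r)\<^sup>2) * (norm y)\<^sup>2)" by (simp add: hx)
  finally have le: "(norm z)\<^sup>2 \<le> - (((1 + r)\<^sup>2 + (1 - r)\<^sup>2) * (norm y)\<^sup>2)" unfolding hu .
  have "(1 + r)\<^sup>2 + (1 - r)\<^sup>2 > 0" using r by (intro add_pos_nonneg) (auto simp: zero_less_power2)
  then have "norm y = 0" using le by (smt (verit) mult_pos_pos zero_le_power2 zero_less_power2)
  then have "y = 0" by simp
  then show "x = 0" using Sp_inj[OF M] by (simp add: y_def)
qed

lemma continuous_on_mixed [continuous_intros]:
  "continuous_on S f \<Longrightarrow> continuous_on S A \<Longrightarrow> continuous_on S (\<lambda>x. mixed (f x) R (A x))"
  unfolding mixed_def by (intro continuous_intros)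

lemma mixed_poly:
  fixes M :: "'n::finite bmat"
  obtains p where "degree p \<le> CARD('n + 'n)" "\<And>r. poly p (complex_of_real r) = det (mixed r R M)"
proof -
  define A B where "A = mat 2 ** ((mat 1 + Ji) ** cmat M) + (mat 1 - Ji) ** cmat R ** (mat 1 - Ji)"
    and "B = (mat 1 - Ji) ** cmat R ** (mat 1 + Ji)"
  obtain p where p: "degree p \<le> CARD('n + 'n)" "\<And>z. poly p z = det (\<chi> i j. A $ i $ j + z * B $ i $ j)"
    using det_affine_poly by blast
  have comm: "X ** (mat z ** Y) = mat z ** (X ** Y)" for z and X Y :: "complex ^ ('n + 'n) ^ ('n + 'n)"
    by (metis mat_commute matrix_mul_assoc)
  have "mixed r R M = A + mat (complex_of_real r) ** B" for r
    unfolding mixed_def A_def B_def by (simp only: matrix_add_ldistrib[of "(mat 1 - Ji) ** cmat R"] comm add.assoc)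
  then have "(\<chi> i j. A $ i $ j + complex_of_real r * B $ i $ j) = mixed r R M" for r
    by (simp add: vec_eq_iff mat_mult_nth)
  with p show ?thesis using that[of p] by simp
qed

lemma mixed_1:
  assumes "R ** N = mat 1" "N \<in> Sp"
  obtains c where "c \<noteq> 0" "\<And>M :: 'n::finite bmat. det (mixed 1 R M) = c * pdet 1 (M ** (N :: 'n bmat))"
proof -
  have "(mixed 1 R M ** cmat N) *v x = (mat 2 ** pencil 1 (M ** N)) *v x" for M :: "'n bmat" and x
  proof -
    have RN: "cmat R *v (cmat N *v x) = x" for x
      using assms(1) by (simp add: matrix_vector_mul_assoc flip: cmat_mult)
    have "(mixed 1 R M ** cmat N) *v x = 2 *\<^sub>R (cmat M *v (cmat N *v x) + Ji *v (cmat M *v (cmat N *v x)))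
        + (cmat R *v (2 *\<^sub>R (cmat N *v x)) - Ji *v (cmat R *v (2 *\<^sub>R (cmat N *v x))))"
      by (simp add: mixed_mv flip: matrix_vector_mul_assoc)
    also have "cmat R *v (2 *\<^sub>R (cmat N *v x)) = 2 *\<^sub>R x"
      by (simp add: mv_scaleR RN)
    also have "2 *\<^sub>R (cmat M *v (cmat N *v x) + Ji *v (cmat M *v (cmat N *v x))) + (2 *\<^sub>R x - Ji *v (2 *\<^sub>R x))
        = (mat 2 ** pencil 1 (M ** N)) *v x"
      by (simp add: pencil_mv mat_vector_mult cmat_mult mv_scaleR matrix_vector_mult_diff_distrib
          vec_eq_iff scaleR_conv_of_real[where 'a=complex] algebra_simps flip: matrix_vector_mul_assoc)
    finally show ?thesis .
  qed
  then have "mixed 1 R M ** cmat N = mat 2 ** pencil 1 (M ** N)" for M :: "'n bmat" using matrix_eq by blast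
  then have e: "det (mixed 1 R M) * det (cmat N) = det (mat 2 :: complex ^ ('n + 'n) ^ ('n + 'n)) * pdet 1 (M ** N)" for M :: "'n bmat"
    by (metis det_mul pdet_def)
  have N: "det (cmat N) \<noteq> 0" using Sp_det_nz[OF assms(2)] by (simp add: det_cmat)
  have d2: "det (mat 2 :: complex ^ ('n + 'n) ^ ('n + 'n)) \<noteq> 0"
    unfolding det_nz_iff_kernel by (simp add: mat_vector_mult vec_eq_iff)
  show ?thesis
    by (rule that[of "det (mat 2 :: complex ^ ('n + 'n) ^ ('n + 'n)) / det (cmat N)"])
       (use e N d2 in \<open>simp_all add: field_simps\<close>)
qed

lemma mixed_0:
  assumes R: "R \<in> Sp"
  obtains c where "c \<noteq> 0" "\<And>M :: 'n::finite bmat. pdet 1 M = c * det (mixed 0 (R :: 'n bmat) M)"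
proof -
  define X :: "complex ^ ('n + 'n) ^ ('n + 'n)" where "X = (mat 1 - Ji) ** cmat R ** (mat 1 - Ji) + mat 2 ** (mat 1 + Ji)"
  have "(X ** pencil 1 M) *v x = (mat 2 ** mixed 0 R M) *v x" for M :: "'n bmat" and x
  proof -
    define y where "y = cmat M *v x"
    define j where "j = (\<lambda>v. Ji *v (v :: complex ^ ('n + 'n)))"
    define R' where "R' = (\<lambda>v. cmat R *v v)"
    have lin: "j (a + b) = j a + j b" "j (a - b) = j a - j b" "j (j a) = a" "R' (a + b) = R' a + R' b" for a b
      by (simp_all add: j_def R'_def matrix_vector_right_distrib matrix_vector_mult_diff_distrib Ji_square)
    have p: "pencil 1 M *v x = (y + j y) + (x - j x)"
      by (simp add: pencil_mv y_def j_def matrix_vector_mult_diff_distrib)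
    have "(X ** pencil 1 M) *v x = (R' ((pencil 1 M *v x) - j (pencil 1 M *v x)) - j (R' ((pencil 1 M *v x) - j (pencil 1 M *v x))))
        + 2 *s ((pencil 1 M *v x) + j (pencil 1 M *v x))"
      by (simp add: X_def matrix_vector_mult_add_rdistrib[of "(mat 1 - Ji) ** cmat R ** (mat 1 - Ji)"] one_pm_Ji_mv mat_vector_mult j_def R'_def
          flip: matrix_vector_mul_assoc)
    also have "(pencil 1 M *v x) - j (pencil 1 M *v x) = (x - j x) + (x - j x)"
      unfolding p lin by (simp add: algebra_simps)
    also have "(pencil 1 M *v x) + j (pencil 1 M *v x) = (y + j y) + (y + j y)"
      unfolding p lin by (simp add: algebra_simps)
    also have "(R' ((x - j x) + (x - j x)) - j (R' ((x - j x) + (x - j x)))) + 2 *s ((y + j y) + (y + j y))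
        = 2 *s (2 *\<^sub>R (y + j y) + (R' (x - j x) - j (R' (x - j x))))"
      unfolding lin by (simp add: vec_eq_iff scaleR_2)
    also have "\<dots> = (mat 2 ** mixed 0 R M) *v x"
      by (simp add: mixed_mv mat_vector_mult j_def R'_def y_def flip: matrix_vector_mul_assoc)
    finally show ?thesis .
  qed
  then have "X ** pencil 1 M = mat 2 ** mixed 0 R M" for M :: "'n bmat" using matrix_eq by blast
  then have e: "det X * pdet 1 M = det (mat 2 :: complex ^ ('n + 'n) ^ ('n + 'n)) * det (mixed 0 R M)" for M :: "'n bmat"
    by (metis det_mul pdet_def)
  have d2: "det (mat 2 :: complex ^ ('n + 'n) ^ ('n + 'n)) \<noteq> 0"
    unfolding det_nz_iff_kernel by (simp add: mat_vector_mult vec_eq_iff)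
  have "det X \<noteq> 0" using e[of "mat 1"] d2 mixed_nz[OF mat_1_in_Sp R, of 0] by auto
  then show ?thesis
    by (intro that[of "det (mat 2 :: complex ^ ('n + 'n) ^ ('n + 'n)) / det X"])
       (use e d2 in \<open>simp_all add: field_simps\<close>)
qed

text \<open>On the square spanned by \<open>r\<close> and \<open>t\<close>, the edges \<open>r = 1\<close> and \<open>r = 0\<close> give the two terms on the left, and along
  the other two edges the determinant of \<open>mixed\<close> is a polynomial of degree at most \<open>2d\<close> in \<open>r\<close>.\<close>

lemma arg_change_product:
  fixes M :: "real \<Rightarrow> 'n::finite bmat"
  assumes M: "continuous_on {0..1} M" "\<And>t. t \<in> {0..1} \<Longrightarrow> M t \<in> Sp" and N: "N \<in> Sp"
  shows "\<bar>arg_change (\<lambda>t. pdet 1 (M t ** N)) - arg_change (\<lambda>t. pdet 1 (M t))\<bar> \<le> 2 * CARD('n + 'n) * pi"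
proof -
  obtain R where R: "R \<in> Sp" "R ** N = mat 1" using Sp_inverse[OF N] by metis
  define F where "F = (\<lambda>x. det (mixed (fst x) R (M (snd x))))"
  have cont: "continuous_on ({0..1} \<times> {0..1}) F"
    unfolding F_def by (intro continuous_intros continuous_on_compose2[OF M(1)]) auto
  have nz: "F x \<noteq> 0" if "x \<in> {0..1} \<times> {0..1}" for x
    unfolding F_def by (rule mixed_nz) (use that M(2) R in auto)
  have sq: "arg_change (\<lambda>t. F (1, t)) - arg_change (\<lambda>t. F (0, t)) = arg_change (\<lambda>r. F (r, 1)) - arg_change (\<lambda>r. F (r, 0))"
    by (rule arg_change_square[OF cont nz])
  have edge: "\<bar>arg_change (\<lambda>r. F (r, t))\<bar> \<le> CARD('n + 'n) * pi" if t: "t \<in> {0..1}" for t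
  proof -
    obtain p where p: "degree p \<le> CARD('n + 'n)" "\<And>r. poly p (complex_of_real r) = det (mixed r R (M t))"
      using mixed_poly by blast
    have "poly p (complex_of_real r) \<noteq> 0" if "r \<in> {0..1}" for r
      using nz[of "(r, t)"] that t by (simp add: p(2) F_def)
    from arg_change_poly_bound'[OF p(1) this] show ?thesis by (simp add: p(2) F_def)
  qed
  have MN: "continuous_on {0..1} (\<lambda>t. M t ** N)" "\<And>t. t \<in> {0..1} \<Longrightarrow> M t ** N \<in> Sp"
    using M N Sp_mult by (auto intro!: continuous_intros)
  obtain c1 where c1: "c1 \<noteq> 0" "\<And>M :: 'n bmat. det (mixed 1 R M) = c1 * pdet 1 (M ** N)" using mixed_1[OF R(2) N] by metis
  have "arg_change (\<lambda>t. F (1, t)) = arg_change (\<lambda>t. c1 * pdet 1 (M t ** N))" by (simp add: F_def c1(2))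
  also have "\<dots> = arg_change (\<lambda>t. pdet 1 (M t ** N))"
    by (rule arg_change_cmult) (use MN pdet_1_nz c1 in \<open>auto intro!: continuous_intros\<close>)
  finally have 1: "arg_change (\<lambda>t. F (1, t)) = arg_change (\<lambda>t. pdet 1 (M t ** N))" .
  obtain c0 where c0: "c0 \<noteq> 0" "\<And>M :: 'n bmat. pdet 1 M = c0 * det (mixed 0 R M)" using mixed_0[OF R(1)] by metis
  have "arg_change (\<lambda>t. pdet 1 (M t)) = arg_change (\<lambda>t. c0 * F (0, t))" by (simp add: F_def c0(2))
  also have "\<dots> = arg_change (\<lambda>t. F (0, t))"
    by (rule arg_change_cmult) (use nz c0 in \<open>auto intro!: continuous_on_compose2[OF cont] continuous_intros\<close>)
  finally have 0: "arg_change (\<lambda>t. F (0, t)) = arg_change (\<lambda>t. pdet 1 (M t))" by simp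
  show ?thesis using sq edge[of 0] edge[of 1] unfolding 0 1 by (simp add: abs_if split: if_splits)
qed

section \<open>Linear differential equations\<close>

lemma antiderivative_exists:
  fixes f :: "real \<Rightarrow> 'a::euclidean_space"
  assumes "continuous_on UNIV f"
  obtains F where "F 0 = 0" "\<And>t. (F has_vector_derivative f t) (at t)"
proof -
  have "\<exists>F. \<forall>x. - \<infinity> < ereal x \<longrightarrow> ereal x < \<infinity> \<longrightarrow> (F has_vector_derivative f x) (at x)"
    by (rule einterval_antiderivative) (use assms in \<open>auto simp: continuous_on_eq_continuous_at\<close>)
  then obtain F where F: "\<And>t. (F has_vector_derivative f t) (at t)" by auto
  have "((\<lambda>t. F t - F 0) has_vector_derivative f t) (at t)" for t
    using has_vector_derivative_diff[OF F[of t] has_vector_derivative_const[of "F 0"]] by simp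
  then show ?thesis using that[of "\<lambda>t. F t - F 0"] by simp
qed

definition antiderivative :: "(real \<Rightarrow> 'a::euclidean_space) \<Rightarrow> real \<Rightarrow> 'a" where
  "antiderivative f = (SOME F. F 0 = 0 \<and> (\<forall>t. (F has_vector_derivative f t) (at t)))"

lemma antiderivative:
  assumes "continuous_on UNIV f"
  shows "antiderivative f 0 = 0" "(antiderivative f has_vector_derivative f t) (at t)"
proof -
  have "\<exists>F. F 0 = 0 \<and> (\<forall>t. (F has_vector_derivative f t) (at t))"
    using antiderivative_exists[OF assms] by metis
  from someI_ex[OF this] show "antiderivative f 0 = 0" "(antiderivative f has_vector_derivative f t) (at t)"
    unfolding antiderivative_def by blast+
qed

lemma has_vector_derivative_imp_continuous_on:
  "(\<And>t. (f has_vector_derivative f' t) (at t)) \<Longrightarrow> continuous_on S f"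
  by (meson continuous_at_imp_continuous_on has_vector_derivative_continuous)

text \<open>Gronwall's inequality for \<open>(norm (y t))\<^sup>2 + q\<close>, whose product with \<open>exp (- c t)\<close> is decreasing. The constant \<open>q\<close> allows for
  an inhomogeneous term in the equation.\<close>

lemma energy_bound:
  fixes y :: "real \<Rightarrow> 'a::real_inner"
  assumes y: "\<And>t. 0 \<le> t \<Longrightarrow> t \<le> T \<Longrightarrow> (y has_vector_derivative y' t) (at t)"
    and le: "\<And>t. 0 \<le> t \<Longrightarrow> t \<le> T \<Longrightarrow> 2 * (y t \<bullet> y' t) \<le> c * ((norm (y t))\<^sup>2 + q)"
    and T: "0 \<le> T"
  shows "(norm (y T))\<^sup>2 + q \<le> exp (c * T) * ((norm (y 0))\<^sup>2 + q)"
proof -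
  define \<phi> where "\<phi> = (\<lambda>t. exp (- c * t) * ((y t \<bullet> y t) + q))"
  have "\<phi> T \<le> \<phi> 0"
  proof (rule DERIV_nonpos_imp_nonincreasing[OF T])
    fix t assume t: "0 \<le> t" "t \<le> T"
    have "((\<lambda>t. y t \<bullet> y t) has_vector_derivative (y t \<bullet> y' t + y' t \<bullet> y t)) (at t)"
      by (rule bounded_bilinear.has_vector_derivative[OF bounded_bilinear_inner y[OF t] y[OF t]])
    then have d: "((\<lambda>t. y t \<bullet> y t) has_real_derivative 2 * (y t \<bullet> y' t)) (at t)"
      by (simp add: has_real_derivative_iff_has_vector_derivative inner_commute)
    have "(\<phi> has_real_derivative exp (- c * t) * (2 * (y t \<bullet> y' t)) + (exp (- c * t) * (- c)) * (y t \<bullet> y t + q)) (at t)"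
      unfolding \<phi>_def by (rule derivative_eq_intros d refl | simp)+
    moreover have "exp (- c * t) * (2 * (y t \<bullet> y' t)) + (exp (- c * t) * (- c)) * (y t \<bullet> y t + q)
        = exp (- c * t) * (2 * (y t \<bullet> y' t) - c * (y t \<bullet> y t + q))"
      by (simp add: algebra_simps)
    moreover have "\<dots> \<le> 0" using le[OF t] by (intro mult_nonneg_nonpos) (auto simp: power2_norm_eq_inner)
    ultimately show "\<exists>d. (\<phi> has_real_derivative d) (at t) \<and> d \<le> 0" by metis
  qed
  then have "exp (c * T) * (exp (- (c * T)) * ((norm (y T))\<^sup>2 + q)) \<le> exp (c * T) * ((norm (y 0))\<^sup>2 + q)"
    by (intro mult_left_mono) (auto simp: \<phi>_def power2_norm_eq_inner)
  then show ?thesis by (simp add: mult.assoc[symmetric] flip: exp_add)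
qed

section \<open>The fundamental solution\<close>

lemma matrix_mult_norm_bound:
  obtains c where "c > 0" "\<And>(A :: real ^ 'm ^ 'm) (B :: real ^ 'm ^ 'm). norm (A ** B) \<le> c * norm A * norm B"
proof -
  have "bounded_bilinear ((**) :: real ^ 'm ^ 'm \<Rightarrow> real ^ 'm ^ 'm \<Rightarrow> real ^ 'm ^ 'm)"
    by (rule bounded_bilinear_matrix_mult)
  from bounded_bilinear.pos_bounded[OF this]
  obtain K where K: "0 < K" "\<And>(A :: real ^ 'm ^ 'm) (B :: real ^ 'm ^ 'm). norm (A ** B) \<le> norm A * norm B * K"
    by blast
  show ?thesis
  proof (rule that[OF K(1)])
    show "norm (A ** B) \<le> K * norm A * norm B" for A B :: "real ^ 'm ^ 'm"
      using K(2)[of A B] by (simp only: mult_ac)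
  qed
qed

lemma norm_le_opnorm: "norm A \<le> (real CARD('m))\<^sup>2 * opnorm A" for A :: "real ^ 'm ^ 'm"
proof -
  have e: "\<bar>A $ i $ j\<bar> \<le> opnorm A" for i j
  proof -
    have "A $ i $ j = (A *v axis j 1) $ i"
      by (simp add: matrix_vector_mult_def axis_def if_distrib cong: if_cong)
    also have "\<bar>\<dots>\<bar> \<le> norm (A *v axis j 1)" by (rule component_le_norm_cart)
    also have "\<dots> \<le> opnorm A * norm (axis j (1::real) :: real ^ 'm)"
      unfolding opnorm_def by (rule onorm) (rule matrix_vector_mul_bounded_linear)
    finally show ?thesis by simp
  qed
  have "norm A \<le> (\<Sum>i\<in>UNIV. norm (A $ i))" unfolding norm_vec_def by (rule L2_set_le_sum) simp
  also have "\<dots> \<le> (\<Sum>i\<in>(UNIV::'m set). \<Sum>j\<in>UNIV. \<bar>A $ i $ j\<bar>)" by (intro sum_mono norm_le_l1_cart)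
  also have "\<dots> \<le> (\<Sum>i\<in>(UNIV::'m set). \<Sum>j\<in>(UNIV::'m set). opnorm A)" by (intro sum_mono e)
  finally show ?thesis by (simp add: power2_eq_square)
qed

text \<open>Linear equations on the whole line with bounded continuous coefficients.\<close>

context
  fixes A :: "real \<Rightarrow> real ^ 'm ^ 'm" and a :: real
  assumes contA: "continuous_on UNIV A"
    and bound: "\<And>t X. norm (A t ** X) \<le> a * norm (X :: real ^ 'm ^ 'm)"
    and a: "a \<ge> 0"
begin

text \<open>The increments of the Picard iteration, so that the solution is their sum.\<close>

fun picard :: "real ^ 'm ^ 'm \<Rightarrow> nat \<Rightarrow> real \<Rightarrow> real ^ 'm ^ 'm" where
  "picard init 0 = (\<lambda>t. init)"
| "picard init (Suc k) = antiderivative (\<lambda>t. A t ** picard init k t)"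

lemma continuous_picard: "continuous_on UNIV (picard init k)"
proof (induction k)
  case (Suc k)
  then have c: "continuous_on UNIV (\<lambda>t. A t ** picard init k t)" by (intro continuous_intros contA)
  show ?case
    unfolding picard.simps by (rule has_vector_derivative_imp_continuous_on[OF antiderivative(2)[OF c]])
qed simp

lemma picard_deriv:
  "picard init (Suc k) 0 = 0" "(picard init (Suc k) has_vector_derivative A t ** picard init k t) (at t)"
proof -
  have c: "continuous_on UNIV (\<lambda>t. A t ** picard init k t)" by (intro continuous_intros contA continuous_picard)
  show "picard init (Suc k) 0 = 0" "(picard init (Suc k) has_vector_derivative A t ** picard init k t) (at t)"
    using antiderivative[OF c] by simp_all
qed

text \<open>The sign \<open>\<sigma>\<close> treats positive and negative times simultaneously.\<close>

lemma picard_bound: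
  assumes "\<sigma> = 1 \<or> \<sigma> = -1" "0 \<le> s"
  shows "norm (picard init k (\<sigma> * s)) \<le> norm init * (a * s) ^ k / fact k"
  using assms
proof (induction k arbitrary: s)
  case (Suc k)
  show ?case
  proof (cases "s = 0")
    case True then show ?thesis using picard_deriv(1)[of init k] by simp
  next
    case False
    then have s: "0 < s" using Suc.prems by simp
    define f where "f = (\<lambda>u. picard init (Suc k) (\<sigma> * u))"
    define \<phi> where "\<phi> = (\<lambda>u. norm init * (a * u) ^ Suc k / fact (Suc k))"
    have f': "(f has_vector_derivative \<sigma> *\<^sub>R (A (\<sigma> * u) ** picard init k (\<sigma> * u))) (at u)" for u
    proof -
      have "((\<lambda>u. \<sigma> * u) has_vector_derivative \<sigma>) (at u)" by (auto intro!: derivative_eq_intros simp: has_real_derivative_iff_has_vector_derivative[symmetric])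
      from vector_diff_chain_at[OF this picard_deriv(2)[of init k "\<sigma> * u"]]
      show ?thesis by (simp add: f_def o_def)
    qed
    have \<phi>': "(\<phi> has_vector_derivative a * (norm init * (a * u) ^ k / fact k)) (at u)" for u
      unfolding \<phi>_def has_real_derivative_iff_has_vector_derivative[symmetric]
      by (rule derivative_eq_intros refl | simp)+
    have "norm (f s - f 0) \<le> \<phi> s - \<phi> 0"
    proof (rule differentiable_bound_general[OF s _ _ f' \<phi>'])
      show "continuous_on {0..s} f" by (rule has_vector_derivative_imp_continuous_on[OF f'])
      show "continuous_on {0..s} \<phi>" by (rule has_vector_derivative_imp_continuous_on[OF \<phi>'])
      fix u assume u: "0 < u" "u < s"
      have "norm (\<sigma> *\<^sub>R (A (\<sigma> * u) ** picard init k (\<sigma> * u))) = norm (A (\<sigma> * u) ** picard init k (\<sigma> * u))"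
        using Suc.prems by auto
      also have "\<dots> \<le> a * norm (picard init k (\<sigma> * u))" by (rule bound)
      also have "\<dots> \<le> a * (norm init * (a * u) ^ k / fact k)"
        using Suc.IH[of u] Suc.prems u a by (intro mult_left_mono) auto
      finally show "norm (\<sigma> *\<^sub>R (A (\<sigma> * u) ** picard init k (\<sigma> * u))) \<le> a * (norm init * (a * u) ^ k / fact k)" .
    qed
    then show ?thesis using picard_deriv(1)[of init k] by (simp add: f_def \<phi>_def)
  qed
qed simp

lemma linear_ode_exists:
  fixes init :: "real ^ 'm ^ 'm"
  obtains y where "y 0 = init" "\<And>t. (y has_vector_derivative A t ** y t) (at t)"
proof -
  define S where "S = (\<lambda>n t. \<Sum>i<n. picard init i t)"
  define y where "y = (\<lambda>t. suminf (\<lambda>i. picard init i t))"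
  have bnd: "norm (picard init k t) \<le> norm init * ((a * r) ^ k / fact k)" if "\<bar>t\<bar> \<le> r" for r t k
  proof -
    have "norm (picard init k t) \<le> norm init * (a * \<bar>t\<bar>) ^ k / fact k"
      using picard_bound[of 1 t init k] picard_bound[of "-1" "-t" init k] by (cases "t \<ge> 0") auto
    also have "\<dots> \<le> norm init * (a * r) ^ k / fact k"
      using that a by (intro divide_right_mono mult_left_mono power_mono) auto
    finally show ?thesis by simp
  qed
  have unif: "uniform_limit {-r..r} S y sequentially" for r
    unfolding S_def y_def
  proof (rule Weierstrass_m_test)
    show "norm (picard init n t) \<le> norm init * ((a * r) ^ n / fact n)" if "t \<in> {-r..r}" for n t
      using bnd[of t r n] that by auto
    have "summable (\<lambda>n. (a * r) ^ n /\<^sub>R fact n)" by (rule summable_exp_generic)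
    then show "summable (\<lambda>n. norm init * ((a * r) ^ n / fact n))"
      by (intro summable_mult) (simp add: divide_inverse mult.commute)
  qed
  have lim: "(\<lambda>n. S n t) \<longlonglongrightarrow> y t" for t
  proof (rule tendsto_uniform_limitI[OF unif[of "\<bar>t\<bar>"]])
    show "t \<in> {- \<bar>t\<bar>..\<bar>t\<bar>}" using abs_ge_self[of t] abs_ge_minus_self[of t] by auto
  qed
  have S': "(S (Suc n) has_vector_derivative A t ** S n t) (at t)" for n t
  proof (induction n)
    case 0 then show ?case by (simp add: S_def)
  next
    case (Suc n)
    have "S (Suc (Suc n)) = (\<lambda>t. S (Suc n) t + picard init (Suc n) t)" by (simp add: S_def fun_eq_iff)
    moreover have "((\<lambda>t. S (Suc n) t + picard init (Suc n) t) has_vector_derivative A t ** S n t + A t ** picard init n t) (at t)"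
      by (rule has_vector_derivative_add[OF Suc picard_deriv(2)])
    ultimately show ?case by (simp add: S_def matrix_add_ldistrib)
  qed
  have init: "y 0 = init"
  proof -
    have "S (Suc n) 0 = init" for n
    proof (induction n)
      case (Suc n)
      then show ?case using picard_deriv(1)[of init n] by (simp add: S_def)
    qed (simp add: S_def)
    then have "(\<lambda>n. S (Suc n) 0) \<longlonglongrightarrow> init" by simp
    then show ?thesis using LIMSEQ_Suc[OF lim[of 0]] LIMSEQ_unique by blast
  qed
  have "(y has_vector_derivative A t ** y t) (at t)" for t
  proof -
    define r where "r = \<bar>t\<bar> + 1"
    have tr: "t \<in> {-r<..<r}" by (auto simp: r_def)
    have "\<exists>g. \<forall>x\<in>{-r<..<r}. (\<lambda>n. S (Suc n) x) \<longlonglongrightarrow> g x \<and> (g has_derivative (\<lambda>h. h *\<^sub>R (A x ** y x))) (at x within {-r<..<r})"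
    proof (rule has_derivative_sequence[where f' = "\<lambda>n x h. h *\<^sub>R (A x ** S n x)"])
      show "convex {-r<..<r}" by simp
      show "(S (Suc n) has_derivative (\<lambda>h. h *\<^sub>R (A x ** S n x))) (at x within {-r<..<r})" for n x
        using S'[of n x] unfolding has_vector_derivative_def by (rule has_derivative_at_withinI)
      show "t \<in> {-r<..<r}" by (rule tr)
      show "(\<lambda>n. S (Suc n) t) \<longlonglongrightarrow> y t" by (rule LIMSEQ_Suc[OF lim])
      fix e :: real assume e: "e > 0"
      have "e / (a + 1) > 0" using e a by simp
      then have "\<forall>\<^sub>F n in sequentially. \<forall>x\<in>{-r..r}. dist (S n x) (y x) < e / (a + 1)"
        using unif[of r] unfolding uniform_limit_iff by blast
      then show "\<forall>\<^sub>F n in sequentially. \<forall>x\<in>{-r<..<r}. \<forall>h. norm (h *\<^sub>R (A x ** S n x) - h *\<^sub>R (A x ** y x)) \<le> e * norm h"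
      proof eventually_elim
        case (elim n)
        show ?case
        proof (intro ballI allI)
          fix x h assume x: "x \<in> {-r<..<r}"
          have "norm (A x ** (S n x - y x)) \<le> a * norm (S n x - y x)" by (rule bound)
          also have "\<dots> \<le> a * (e / (a + 1))"
            using elim x a by (intro mult_left_mono) (auto simp: dist_norm less_imp_le)
          also have "\<dots> \<le> e" using a e by (simp add: field_simps)
          finally have "\<bar>h\<bar> * norm (A x ** (S n x - y x)) \<le> \<bar>h\<bar> * e" by (rule mult_left_mono) simp
          then show "norm (h *\<^sub>R (A x ** S n x) - h *\<^sub>R (A x ** y x)) \<le> e * norm h"
            by (simp add: matrix_diff_ldistrib mult.commute flip: scaleR_diff_right)
        qed
      qed
    qed
    then obtain g where g: "\<And>x. x \<in> {-r<..<r} \<Longrightarrow> (\<lambda>n. S (Suc n) x) \<longlonglongrightarrow> g x"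
      "\<And>x. x \<in> {-r<..<r} \<Longrightarrow> (g has_derivative (\<lambda>h. h *\<^sub>R (A x ** y x))) (at x within {-r<..<r})" by blast
    have gy: "g x = y x" if "x \<in> {-r<..<r}" for x
      using g(1)[OF that] LIMSEQ_Suc[OF lim[of x]] LIMSEQ_unique by blast
    have "(g has_derivative (\<lambda>h. h *\<^sub>R (A t ** y t))) (at t)"
      using g(2)[OF tr] unfolding at_within_open[OF tr open_greaterThanLessThan] .
    then have "(y has_derivative (\<lambda>h. h *\<^sub>R (A t ** y t))) (at t)"
      by (rule has_derivative_transform_within_open[OF _ _ tr]) (use gy in auto)
    then show ?thesis by (simp add: has_vector_derivative_def)
  qed
  then show ?thesis using that init by blast
qed

end

lemma linear_ode_unique_forward:
  fixes A y z :: "real \<Rightarrow> real ^ 'm ^ 'm"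
  assumes bound: "\<And>t X. norm (A t ** X) \<le> a * norm (X :: real ^ 'm ^ 'm)"
    and y: "\<And>t. (y has_vector_derivative A t ** y t) (at t)" and z: "\<And>t. (z has_vector_derivative A t ** z t) (at t)"
    and "y 0 = z 0" "0 \<le> t"
  shows "y t = z t"
proof -
  have "(norm (y t - z t))\<^sup>2 + 0 \<le> exp (2 * a * t) * ((norm (y 0 - z 0))\<^sup>2 + 0)"
  proof (rule energy_bound[where y' = "\<lambda>t. A t ** y t - A t ** z t"])
    fix s
    show "((\<lambda>t. y t - z t) has_vector_derivative A s ** y s - A s ** z s) (at s)"
      by (rule has_vector_derivative_diff[OF y z])
    have "(y s - z s) \<bullet> (A s ** (y s - z s)) \<le> norm (y s - z s) * norm (A s ** (y s - z s))" by (rule norm_cauchy_schwarz)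
    also have "\<dots> \<le> norm (y s - z s) * (a * norm (y s - z s))" by (rule mult_left_mono[OF bound norm_ge_zero])
    finally show "2 * ((y s - z s) \<bullet> (A s ** y s - A s ** z s)) \<le> 2 * a * ((norm (y s - z s))\<^sup>2 + 0)"
      by (simp add: matrix_diff_ldistrib power2_eq_square mult_ac)
  qed fact
  then show ?thesis using assms(4) by simp
qed

lemma reflect_derivative:
  assumes "\<And>t. (y has_vector_derivative f t) (at t)"
  shows "((\<lambda>t. y (- t)) has_vector_derivative - f (- t)) (at t)"
proof -
  have "(uminus has_vector_derivative -1) (at t)"
    by (auto intro!: derivative_eq_intros simp: has_real_derivative_iff_has_vector_derivative[symmetric])
  from vector_diff_chain_at[OF this assms[of "- t"]] show ?thesis by (simp add: o_def)
qed

lemma shift_derivative: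
  assumes "\<And>t. (y has_vector_derivative f t) (at t)"
  shows "((\<lambda>t. y (t + s)) has_vector_derivative f (t + s)) (at t)"
proof -
  have "((\<lambda>t. t + s) has_vector_derivative 1) (at t)"
    by (auto intro!: derivative_eq_intros simp: has_real_derivative_iff_has_vector_derivative[symmetric])
  from vector_diff_chain_at[OF this assms[of "t + s"]] show ?thesis by (simp add: o_def)
qed

text \<open>Negative times reduce to positive ones by reversing time.\<close>

lemma linear_ode_unique:
  fixes A y z :: "real \<Rightarrow> real ^ 'm ^ 'm"
  assumes bound: "\<And>t X. norm (A t ** X) \<le> a * norm (X :: real ^ 'm ^ 'm)"
    and y: "\<And>t. (y has_vector_derivative A t ** y t) (at t)" and z: "\<And>t. (z has_vector_derivative A t ** z t) (at t)"
    and "y 0 = z 0"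
  shows "y = z"
proof
  fix t
  show "y t = z t"
  proof (cases "t \<ge> 0")
    case True then show ?thesis using linear_ode_unique_forward[OF bound y z] assms by blast
  next
    case False
    have b: "norm ((- A (- t)) ** X) \<le> a * norm X" for t and X :: "real ^ 'm ^ 'm"
      using bound[of "- t" X] by (simp add: matrix_minus_left)
    have "y (- (- t)) = z (- (- t))"
      by (rule linear_ode_unique_forward[of "\<lambda>t. - A (- t)" a "\<lambda>t. y (- t)" "\<lambda>t. z (- t)", OF b])
         (use reflect_derivative[OF y] reflect_derivative[OF z] assms False in \<open>auto simp: matrix_minus_left\<close>)
    then show ?thesis by simp
  qed
qed

text \<open>The bound on the coefficients is given in the operator norm, whereas the estimates for
  differential equations use the Euclidean norm of matrices.\<close>

lemma E_set_coefficient_bound: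
  obtains k where "k > 0" "\<And>A X :: 'n::finite bmat. norm (Jmat ** A ** X) \<le> k * opnorm A * norm X"
proof -
  obtain c where c: "c > 0" "\<And>(A :: 'n bmat) (B :: 'n bmat). norm (A ** B) \<le> c * norm A * norm B"
    using matrix_mult_norm_bound by blast
  define N where "N = (real CARD('n + 'n))\<^sup>2"
  define k where "k = c * (c * (norm (Jmat :: 'n bmat) + 1) * N)"
  have "N > 0" by (simp add: N_def)
  then have "k > 0" using c(1) by (simp add: k_def add_nonneg_pos)
  moreover have "norm (Jmat ** A ** X) \<le> k * opnorm A * norm X" for A X :: "'n bmat"
  proof -
    have "norm (Jmat ** A) \<le> c * norm (Jmat :: 'n bmat) * norm A" by (rule c(2))
    also have "\<dots> \<le> c * (norm (Jmat :: 'n bmat) + 1) * (N * opnorm A)"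
      using c(1) norm_le_opnorm[of A] by (intro mult_mono) (auto simp: N_def)
    finally have 1: "norm (Jmat ** A) \<le> c * (norm (Jmat :: 'n bmat) + 1) * (N * opnorm A)" .
    have "norm (Jmat ** A ** X) \<le> c * norm (Jmat ** A) * norm X" by (rule c(2))
    also have "\<dots> \<le> c * (c * (norm (Jmat :: 'n bmat) + 1) * (N * opnorm A)) * norm X"
      using 1 c(1) by (intro mult_right_mono mult_left_mono) auto
    also have "\<dots> = k * opnorm A * norm X" by (simp add: k_def mult_ac)
    finally show ?thesis .
  qed
  ultimately show ?thesis using that by blast
qed

lemma E_set_bound:
  fixes B :: "real \<Rightarrow> 'n::finite bmat" and X :: "'n bmat"
  assumes "B \<in> E_set K" "k > 0" "\<And>A X :: 'n bmat. norm (Jmat ** A ** X) \<le> k * opnorm A * norm X"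
  shows "norm (Jmat ** B t ** X) \<le> (k * K) * norm X"
proof -
  have "opnorm (B t) \<le> K" using assms(1) by (simp add: E_set_def)
  then have "k * opnorm (B t) * norm X \<le> (k * K) * norm X" using assms(2) by (intro mult_right_mono) auto
  with assms(3)[of "B t" X] show ?thesis by (rule order_trans)
qed

lemma fund_sol_unique_solution:
  fixes B y z :: "real \<Rightarrow> 'n::finite bmat"
  assumes B: "B \<in> E_set K" and y: "\<And>t. (y has_vector_derivative Jmat ** B t ** y t) (at t)"
    and z: "\<And>t. (z has_vector_derivative Jmat ** B t ** z t) (at t)" and "y 0 = z 0"
  shows "y = z"
proof -
  obtain k where k: "k > 0" "\<And>A X :: 'n bmat. norm (Jmat ** A ** X) \<le> k * opnorm A * norm X"
    using E_set_coefficient_bound by blast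
  show ?thesis by (rule linear_ode_unique[OF E_set_bound[OF B k] y z assms(4)])
qed

lemma fund_sol:
  fixes B :: "real \<Rightarrow> 'n::finite bmat"
  assumes B: "B \<in> E_set K"
  shows "fund_sol B 0 = mat 1" "(fund_sol B has_vector_derivative Jmat ** B t ** fund_sol B t) (at t)"
proof -
  obtain k where k: "k > 0" "\<And>A X :: 'n bmat. norm (Jmat ** A ** X) \<le> k * opnorm A * norm X"
    using E_set_coefficient_bound by blast
  have "K \<ge> 0" using B opnorm_pos[of "B 0"] by (auto simp: E_set_def intro: order_trans)
  then have kK: "k * K \<ge> 0" using k by simp
  have c: "continuous_on UNIV (\<lambda>t. Jmat ** B t)" using B by (intro continuous_intros) (auto simp: E_set_def)
  obtain y where y: "y 0 = mat 1" "\<And>t. (y has_vector_derivative Jmat ** B t ** y t) (at t)"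
    using linear_ode_exists[where A = "\<lambda>t. Jmat ** B t" and init = "mat 1", OF c E_set_bound[OF B k] kK] by blast
  have "fund_sol B = y"
    unfolding fund_sol_def
  proof (rule the_equality)
    fix z assume z: "z 0 = mat 1 \<and> (\<forall>t. (z has_vector_derivative Jmat ** B t ** z t) (at t))"
    show "z = y" by (rule fund_sol_unique_solution[OF B _ y(2)]) (use z y(1) in auto)
  qed (use y in blast)
  then show "fund_sol B 0 = mat 1" "(fund_sol B has_vector_derivative Jmat ** B t ** fund_sol B t) (at t)"
    using y by auto
qed

lemma fund_sol_eqI:
  fixes B y :: "real \<Rightarrow> 'n::finite bmat"
  assumes "B \<in> E_set K" "y 0 = mat 1" "\<And>t. (y has_vector_derivative Jmat ** B t ** y t) (at t)"
  shows "fund_sol B = y"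
  by (rule fund_sol_unique_solution[OF assms(1) fund_sol(2)[OF assms(1)] assms(3)])
     (simp add: fund_sol(1)[OF assms(1)] assms(2))

lemma continuous_on_fund_sol: "B \<in> E_set K \<Longrightarrow> continuous_on S (fund_sol B)"
  by (rule has_vector_derivative_imp_continuous_on[OF fund_sol(2)])

text \<open>The derivative of \<open>transpose \<gamma> ** Jmat ** \<gamma>\<close> vanishes, because \<open>B\<close> is symmetric.\<close>

lemma fund_sol_in_Sp:
  fixes B :: "real \<Rightarrow> 'n::finite bmat"
  assumes B: "B \<in> E_set K"
  shows "fund_sol B t \<in> Sp"
proof -
  define y where "y = fund_sol B"
  have y: "y 0 = mat 1" "\<And>t. (y has_vector_derivative Jmat ** B t ** y t) (at t)"
    using fund_sol[OF B] by (simp_all add: y_def)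
  have sym: "transpose (B t) = B t" for t using B by (simp add: E_set_def)
  have tr: "bounded_linear (transpose :: 'n bmat \<Rightarrow> _)"
    unfolding linear_conv_bounded_linear[symmetric] by (rule linearI) (simp_all add: transpose_def vec_eq_iff)
  have "((\<lambda>t. transpose (y t) ** (Jmat ** y t)) has_vector_derivative 0) (at t)" for t
  proof -
    have "((\<lambda>t. transpose (y t)) has_vector_derivative transpose (Jmat ** B t ** y t)) (at t)"
      by (rule bounded_linear.has_vector_derivative[OF tr y(2)])
    moreover have "((\<lambda>t. Jmat ** y t) has_vector_derivative Jmat ** (Jmat ** B t ** y t)) (at t)"
      by (rule bounded_linear.has_vector_derivative[OF bounded_bilinear.bounded_linear_right[OF bounded_bilinear_matrix_mult] y(2)])
    ultimately have "((\<lambda>t. transpose (y t) ** (Jmat ** y t)) has_vector_derivative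
        transpose (y t) ** (Jmat ** (Jmat ** B t ** y t)) + transpose (Jmat ** B t ** y t) ** (Jmat ** y t)) (at t)"
      by (rule bounded_bilinear.has_vector_derivative[OF bounded_bilinear_matrix_mult])
    moreover have "Jmat ** (Jmat ** B t ** y t) = - (B t ** y t)"
      by (simp add: matrix_mul_assoc[symmetric] Jmat_square_left)
    moreover have "transpose (Jmat ** B t ** y t) ** (Jmat ** y t) = transpose (y t) ** (B t ** y t)"
      by (simp add: matrix_transpose_mul sym transpose_Jmat matrix_ring_simps matrix_mul_assoc[symmetric] Jmat_square_left)
    ultimately show ?thesis by (simp add: matrix_minus_right)
  qed
  then have "\<exists>c. \<forall>t\<in>UNIV. transpose (y t) ** (Jmat ** y t) = c"
    by (intro has_derivative_zero_constant) (auto simp: has_vector_derivative_def)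
  then obtain c where c: "\<And>t. transpose (y t) ** (Jmat ** y t) = c" by auto
  from c[of 0] y(1) have "c = Jmat" by simp
  then show ?thesis using c[of t] by (simp add: Sp_def y_def matrix_mul_assoc)
qed

text \<open>Both sides solve the equation with coefficients \<open>B(\<cdot> + s)\<close> and agree at \<open>t = 0\<close>.\<close>

lemma fund_sol_shift:
  assumes B: "B \<in> E_set K"
  shows "(\<lambda>t. B (t + s)) \<in> E_set K" "fund_sol B (t + s) = fund_sol (\<lambda>t. B (t + s)) t ** fund_sol B s"
proof -
  show Bs: "(\<lambda>t. B (t + s)) \<in> E_set K"
    using B by (auto simp: E_set_def intro!: continuous_intros continuous_on_compose2[of UNIV B])
  have "(\<lambda>t. fund_sol B (t + s)) = (\<lambda>t. fund_sol (\<lambda>t. B (t + s)) t ** fund_sol B s)"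
  proof (rule fund_sol_unique_solution[OF Bs])
    show "((\<lambda>t. fund_sol B (t + s)) has_vector_derivative Jmat ** B (t + s) ** fund_sol B (t + s)) (at t)" for t
      by (rule shift_derivative[OF fund_sol(2)[OF B]])
    show "((\<lambda>t. fund_sol (\<lambda>t. B (t + s)) t ** fund_sol B s) has_vector_derivative
        Jmat ** B (t + s) ** (fund_sol (\<lambda>t. B (t + s)) t ** fund_sol B s)) (at t)" for t
      unfolding matrix_mul_assoc
      by (rule bounded_linear.has_vector_derivative[OF bounded_bilinear.bounded_linear_left[OF bounded_bilinear_matrix_mult] fund_sol(2)[OF Bs]])
  qed (simp add: fund_sol(1)[OF Bs])
  then show "fund_sol B (t + s) = fund_sol (\<lambda>t. B (t + s)) t ** fund_sol B s" by meson
qed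

lemma opnorm_uminus: "opnorm (- A) = opnorm A"
  using opnorm_minus_commute[of 0 A] by simp

lemma fund_sol_reflect:
  assumes B: "B \<in> E_set K"
  shows "(\<lambda>t. - B (- t)) \<in> E_set K" "(\<lambda>t. fund_sol B (- t)) = fund_sol (\<lambda>t. - B (- t))"
proof -
  show Bs: "(\<lambda>t. - B (- t)) \<in> E_set K"
    using B by (auto simp: E_set_def opnorm_uminus transpose_neg_mat intro!: continuous_intros continuous_on_compose2[of UNIV B])
  have "fund_sol (\<lambda>t. - B (- t)) = (\<lambda>t. fund_sol B (- t))"
  proof (rule fund_sol_eqI[OF Bs])
    show "((\<lambda>t. fund_sol B (- t)) has_vector_derivative Jmat ** (- B (- t)) ** fund_sol B (- t)) (at t)" for t
      using reflect_derivative[OF fund_sol(2)[OF B], of t] by (simp add: matrix_minus_left matrix_minus_right)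
  qed (simp add: fund_sol(1)[OF B])
  then show "(\<lambda>t. fund_sol B (- t)) = fund_sol (\<lambda>t. - B (- t))" by simp
qed

section \<open>The angle of a fundamental solution\<close>

definition angle :: "(real \<Rightarrow> 'n::finite bmat) \<Rightarrow> real \<Rightarrow> real" where
  "angle B t = arg_change (\<lambda>s. pdet 1 (fund_sol B (s * t)))"

lemma angle_lift:
  fixes B :: "real \<Rightarrow> 'n::finite bmat"
  assumes B: "B \<in> E_set K"
  obtains g where "continuous_on UNIV g" "\<And>t. pdet 1 (fund_sol B t) = exp (g t)"
    "\<And>s t. arg_change (\<lambda>u. pdet 1 (fund_sol B (s + u * t))) = Im (g (s + t)) - Im (g s)"
proof -
  have "continuous_on UNIV (\<lambda>t. pdet 1 (fund_sol B t))"
    by (intro continuous_intros continuous_on_fund_sol[OF B])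
  moreover have "pdet 1 (fund_sol B t) \<noteq> 0" for t by (rule pdet_1_nz[OF fund_sol_in_Sp[OF B]])
  ultimately obtain g where g: "continuous_on UNIV g" "\<And>t. pdet 1 (fund_sol B t) = exp (g t)"
    using continuous_logarithm_on_contractible[of UNIV "\<lambda>t. pdet 1 (fund_sol B t)"] convex_imp_contractible[OF convex_UNIV]
    by (metis UNIV_I)
  have "arg_change (\<lambda>u. pdet 1 (fund_sol B (s + u * t))) = Im (g (s + 1 * t)) - Im (g (s + 0 * t))" for s t
    by (rule arg_change_eq) (auto intro!: continuous_on_compose2[OF g(1)] continuous_intros g(2))
  then show ?thesis using that[of g] g by simp
qed

lemma angle_eq_lift:
  assumes "\<And>s t. arg_change (\<lambda>u. pdet 1 (fund_sol B (s + u * t))) = Im (g (s + t)) - Im (g s)"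
  shows "angle B t = Im (g t) - Im (g 0)"
  using assms[of 0 t] by (simp add: angle_def)

text \<open>By the cocycle property the second part of the solution is the fundamental solution of the shifted system
  multiplied by a fixed symplectic matrix.\<close>

lemma angle_quasi_additive:
  fixes B :: "real \<Rightarrow> 'n::finite bmat"
  assumes B: "B \<in> E_set K"
  shows "\<bar>angle B (s + t) - angle B s - angle (\<lambda>u. B (u + s)) t\<bar> \<le> 2 * CARD('n + 'n) * pi"
proof -
  obtain g where g: "\<And>s t. arg_change (\<lambda>u. pdet 1 (fund_sol B (s + u * t))) = Im (g (s + t)) - Im (g s)"
    using angle_lift[OF B] by metis
  have "angle B (s + t) - angle B s = arg_change (\<lambda>u. pdet 1 (fund_sol B (s + u * t)))"
    using angle_eq_lift[OF g] g[of s t] by simp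
  also have "\<dots> = arg_change (\<lambda>u. pdet 1 (fund_sol (\<lambda>t. B (t + s)) (u * t) ** fund_sol B s))"
    by (simp add: add.commute[of s] fund_sol_shift(2)[OF B])
  finally have e: "angle B (s + t) - angle B s = arg_change (\<lambda>u. pdet 1 (fund_sol (\<lambda>t. B (t + s)) (u * t) ** fund_sol B s))" .
  have Bs: "(\<lambda>t. B (t + s)) \<in> E_set K" by (rule fund_sol_shift(1)[OF B])
  have "continuous_on {0..1} (\<lambda>u. fund_sol (\<lambda>t. B (t + s)) (u * t))"
    by (rule continuous_on_compose2[OF continuous_on_fund_sol[OF Bs, of UNIV]]) (auto intro!: continuous_intros)
  from arg_change_product[OF this fund_sol_in_Sp[OF Bs] fund_sol_in_Sp[OF B, of s]]
  show ?thesis unfolding e unfolding angle_def .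
qed

text \<open>Comparing two systems removes the half dimension of the kernel from the definition of the index.\<close>

lemma maslov_index_angle:
  fixes B B' :: "real \<Rightarrow> 'n::finite bmat"
  assumes B: "B \<in> E_set K" and B': "B' \<in> E_set K" and l: "0 \<le> l"
  shows "\<bar>maslov_index 1 (fund_sol B) l - maslov_index 1 (fund_sol B') l\<bar>
    \<le> \<bar>angle B l - angle B' l\<bar> / pi + 4 * CARD('n + 'n)"
proof -
  define m where "m = (\<lambda>B :: real \<Rightarrow> 'n bmat. real_of_int (maslov_iota 1 (mat 1) (fund_sol B) 0 l))"
  have b: "\<bar>- pi * m C - angle C l\<bar> \<le> 2 * CARD('n + 'n) * pi" if C: "C \<in> E_set K" for C
    using maslov_iota_bound[OF l continuous_on_fund_sol[OF C] fund_sol_in_Sp[OF C]]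
    by (simp add: m_def angle_def linepath_def)
  have "pi * \<bar>m B - m B'\<bar> = \<bar>pi * m B - pi * m B'\<bar>" by (simp add: abs_mult flip: right_diff_distrib)
  also have "\<dots> \<le> \<bar>angle B l - angle B' l\<bar> + 4 * CARD('n + 'n) * pi"
    using b[OF B] b[OF B'] by (simp add: abs_if algebra_simps split: if_splits)
  also have "\<dots> = pi * (\<bar>angle B l - angle B' l\<bar> / pi + 4 * CARD('n + 'n))" by (simp add: field_simps)
  finally have "\<bar>m B - m B'\<bar> \<le> \<bar>angle B l - angle B' l\<bar> / pi + 4 * CARD('n + 'n)" by simp
  then show ?thesis by (simp add: maslov_index_def m_def)
qed

section \<open>Comparison of two systems\<close>

lemma fund_sol_norm_bound:
  fixes T :: real
  assumes T: "T > 0" and K: "K > 0"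
  obtains r where "\<And>B t. B \<in> (E_set K :: (real \<Rightarrow> 'n::finite bmat) set) \<Longrightarrow> 0 \<le> t \<Longrightarrow> t \<le> T \<Longrightarrow> norm (fund_sol B t) \<le> r"
proof -
  obtain k where k: "k > 0" "\<And>A X :: 'n bmat. norm (Jmat ** A ** X) \<le> k * opnorm A * norm X"
    using E_set_coefficient_bound by blast
  define r where "r = sqrt (exp (2 * (k * K) * T) * (norm (mat 1 :: 'n bmat))\<^sup>2)"
  have "norm (fund_sol B t) \<le> r" if B: "B \<in> (E_set K :: (real \<Rightarrow> 'n bmat) set)" and t: "0 \<le> t" "t \<le> T" for B t
  proof -
    define y where "y = fund_sol B"
    have "(norm (y t))\<^sup>2 + 0 \<le> exp (2 * (k * K) * t) * ((norm (y 0))\<^sup>2 + 0)"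
    proof (rule energy_bound[where y' = "\<lambda>t. Jmat ** B t ** y t"])
      fix s
      show "(y has_vector_derivative Jmat ** B s ** y s) (at s)" unfolding y_def by (rule fund_sol(2)[OF B])
      have "y s \<bullet> (Jmat ** B s ** y s) \<le> norm (y s) * norm (Jmat ** B s ** y s)" by (rule norm_cauchy_schwarz)
      also have "\<dots> \<le> norm (y s) * ((k * K) * norm (y s))"
        by (rule mult_left_mono[OF E_set_bound[OF B k] norm_ge_zero])
      finally show "2 * (y s \<bullet> (Jmat ** B s ** y s)) \<le> 2 * (k * K) * ((norm (y s))\<^sup>2 + 0)"
        by (simp add: power2_eq_square mult_ac)
    qed (rule t)
    also have "\<dots> \<le> exp (2 * (k * K) * T) * ((norm (y 0))\<^sup>2 + 0)"
      using k(1) K t by (intro mult_right_mono) auto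
    finally have "(norm (y t))\<^sup>2 \<le> exp (2 * (k * K) * T) * (norm (mat 1 :: 'n bmat))\<^sup>2"
      by (simp add: y_def fund_sol(1)[OF B])
    then show ?thesis unfolding r_def y_def by (rule real_le_rsqrt)
  qed
  then show ?thesis using that by blast
qed

text \<open>The difference of two solutions satisfies a linear equation with an inhomogeneous term of size \<open>M * \<delta>\<close>, and it
  vanishes at \<open>0\<close>.\<close>

lemma fund_sol_continuous_dependence:
  fixes T :: real
  assumes T: "T > 0" and K: "K > 0" and e: "e > 0"
  obtains \<delta> where "\<delta> > 0" "\<And>B1 B2 t. \<lbrakk>B1 \<in> (E_set K :: (real \<Rightarrow> 'n::finite bmat) set); B2 \<in> E_set K;
      \<And>t. opnorm (B1 t - B2 t) \<le> \<delta>; 0 \<le> t; t \<le> T\<rbrakk> \<Longrightarrow> norm (fund_sol B1 t - fund_sol B2 t) < e"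
proof -
  obtain k where k: "k > 0" "\<And>A X :: 'n bmat. norm (Jmat ** A ** X) \<le> k * opnorm A * norm X"
    using E_set_coefficient_bound by blast
  obtain r where r: "\<And>B t. B \<in> (E_set K :: (real \<Rightarrow> 'n bmat) set) \<Longrightarrow> 0 \<le> t \<Longrightarrow> t \<le> T \<Longrightarrow> norm (fund_sol B t) \<le> r"
    using fund_sol_norm_bound[OF T K] by blast
  define c where "c = 2 * (k * K) + 1"
  have c: "c \<ge> 1" using k K by (simp add: c_def)
  define M where "M = k * (\<bar>r\<bar> + 1)"
  have M: "M > 0" using k by (simp add: M_def)
  define \<delta> where "\<delta> = e / (2 * M * exp (c * T))"
  have \<delta>: "\<delta> > 0" using e M by (simp add: \<delta>_def)
  have "norm (fund_sol B1 t - fund_sol B2 t) < e"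
    if B1: "B1 \<in> (E_set K :: (real \<Rightarrow> 'n bmat) set)" and B2: "B2 \<in> E_set K"
      and d: "\<And>t. opnorm (B1 t - B2 t) \<le> \<delta>" and t: "0 \<le> t" "t \<le> T" for B1 B2 t
  proof -
    define y where "y = (\<lambda>t. fund_sol B1 t - fund_sol B2 t)"
    define y' where "y' = (\<lambda>t. Jmat ** B1 t ** fund_sol B1 t - Jmat ** B2 t ** fund_sol B2 t)"
    define q where "q = (M * \<delta>)\<^sup>2"
    have q: "q \<ge> 0" by (simp add: q_def)
    have "(norm (y t))\<^sup>2 + q \<le> exp (c * t) * ((norm (y 0))\<^sup>2 + q)"
    proof (rule energy_bound[where y' = y'])
      fix s assume s: "0 \<le> s" "s \<le> t"
      show "(y has_vector_derivative y' s) (at s)"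
        unfolding y_def y'_def by (intro has_vector_derivative_diff fund_sol(2)[OF B1] fund_sol(2)[OF B2])
      have split: "y' s = Jmat ** B1 s ** y s + Jmat ** (B1 s - B2 s) ** fund_sol B2 s"
        by (simp add: y'_def y_def matrix_ring_simps)
      have "norm (Jmat ** (B1 s - B2 s) ** fund_sol B2 s) \<le> k * opnorm (B1 s - B2 s) * norm (fund_sol B2 s)" by (rule k(2))
      also have "\<dots> \<le> k * \<delta> * (\<bar>r\<bar> + 1)"
        using d[of s] r[OF B2, of s] s t k(1) \<delta> opnorm_pos[of "B1 s - B2 s"] by (intro mult_mono) auto
      also have "\<dots> = M * \<delta>" by (simp add: M_def)
      finally have n2: "norm (Jmat ** (B1 s - B2 s) ** fund_sol B2 s) \<le> M * \<delta>" .
      have n1: "norm (Jmat ** B1 s ** y s) \<le> (k * K) * norm (y s)" by (rule E_set_bound[OF B1 k])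
      have "norm (y' s) \<le> (k * K) * norm (y s) + M * \<delta>"
        unfolding split using norm_triangle_ineq n1 n2 by (meson add_mono order_trans)
      then have "norm (y s) * norm (y' s) \<le> norm (y s) * ((k * K) * norm (y s) + M * \<delta>)"
        by (rule mult_left_mono) simp
      then have "2 * (y s \<bullet> y' s) \<le> 2 * (norm (y s) * ((k * K) * norm (y s) + M * \<delta>))"
        using norm_cauchy_schwarz[of "y s" "y' s"] by linarith
      also have "\<dots> = 2 * (k * K) * (norm (y s))\<^sup>2 + 2 * norm (y s) * (M * \<delta>)"
        by (simp add: power2_eq_square algebra_simps)
      also have "\<dots> \<le> 2 * (k * K) * (norm (y s))\<^sup>2 + ((norm (y s))\<^sup>2 + q)"
        using sum_squares_bound[of "norm (y s)" "M * \<delta>"] by (simp add: q_def)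
      also have "\<dots> = c * (norm (y s))\<^sup>2 + 1 * q" by (simp add: c_def algebra_simps)
      also have "\<dots> \<le> c * (norm (y s))\<^sup>2 + c * q" using c q by (intro add_left_mono mult_right_mono) auto
      finally show "2 * (y s \<bullet> y' s) \<le> c * ((norm (y s))\<^sup>2 + q)" by (simp add: algebra_simps)
    qed (rule t)
    also have "y 0 = 0" by (simp add: y_def fund_sol(1)[OF B1] fund_sol(1)[OF B2])
    finally have "(norm (y t))\<^sup>2 \<le> exp (c * t) * q" using q by simp
    also have "\<dots> \<le> exp (c * T) * q" using c q t by (intro mult_right_mono) auto
    also have "\<dots> \<le> exp (c * T) * exp (c * T) * q"
    proof -
      have "1 \<le> exp (c * T)" using c T by simp
      then have "exp (c * T) * 1 \<le> exp (c * T) * exp (c * T)" by (intro mult_left_mono) auto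
      then show ?thesis using q by (intro mult_right_mono) auto
    qed
    also have "\<dots> = (exp (c * T) * (M * \<delta>))\<^sup>2" by (simp add: q_def power2_eq_square mult_ac)
    also have "exp (c * T) * (M * \<delta>) = e / 2" using M by (simp add: \<delta>_def field_simps)
    finally have "norm (y t) \<le> e / 2" using e by (intro power2_le_imp_le[of "norm (y t)" "e/2"]) auto
    then show ?thesis using e by (simp add: y_def)
  qed
  then show ?thesis using that \<delta> by blast
qed

text \<open>On \<open>[0, T]\<close> all fundamental solutions stay in a compact subset of \<open>Sp\<close>, where \<open>pdet 1\<close> is bounded away from \<open>0\<close> and uniformly
  continuous. For close coefficients the quotient of the two values therefore stays in the right half plane, and the
  angles differ by the change of its principal argument.\<close>

lemma angle_window:
  fixes T :: real
  assumes T: "T > 0" and K: "K > 0"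
  obtains \<delta> where "\<delta> > 0" "\<And>B1 B2 t. \<lbrakk>B1 \<in> (E_set K :: (real \<Rightarrow> 'n::finite bmat) set); B2 \<in> E_set K;
      \<And>t. opnorm (B1 t - B2 t) \<le> \<delta>; 0 \<le> t; t \<le> T\<rbrakk> \<Longrightarrow> \<bar>angle B1 t - angle B2 t\<bar> \<le> 2 * pi"
proof -
  obtain r where r: "\<And>B t. B \<in> (E_set K :: (real \<Rightarrow> 'n bmat) set) \<Longrightarrow> 0 \<le> t \<Longrightarrow> t \<le> T \<Longrightarrow> norm (fund_sol B t) \<le> r"
    using fund_sol_norm_bound[OF T K] by blast
  define C where "C = {M :: 'n bmat. M \<in> Sp \<and> norm M \<le> r}"
  have "closed {M :: 'n bmat. transpose M ** Jmat ** M = Jmat}"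
  proof (rule closed_Collect_eq)
    have "continuous_on UNIV (transpose :: 'n bmat \<Rightarrow> _)"
      unfolding transpose_def by (intro continuous_intros continuous_on_vec_nth2)
    then show "continuous_on UNIV (\<lambda>M :: 'n bmat. transpose M ** Jmat ** M)" by (intro continuous_intros)
  qed simp
  then have "closed (Sp :: 'n bmat set)" by (simp add: Sp_def)
  moreover have "C = Sp \<inter> cball 0 r" by (auto simp: C_def)
  ultimately have "compact C" by (simp add: closed_Int_compact)
  have pc: "continuous_on C (pdet 1)" by (rule continuous_on_pdet[OF continuous_on_const continuous_on_id])
  obtain m where m: "m > 0" "\<And>M. M \<in> C \<Longrightarrow> m \<le> norm (pdet 1 M)"
  proof (cases "C = {}")
    case False
    have "continuous_on C (\<lambda>M. norm (pdet 1 M))" by (intro continuous_on_norm pc)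
    from continuous_attains_inf[OF \<open>compact C\<close> False this]
    obtain M0 where "M0 \<in> C" "\<forall>M\<in>C. norm (pdet 1 M0) \<le> norm (pdet 1 M)" by blast
    then show ?thesis using that[of "norm (pdet 1 M0)"] pdet_1_nz by (auto simp: C_def)
  qed (use that[of 1] in simp)
  have "uniformly_continuous_on C (pdet 1)" by (rule compact_uniformly_continuous[OF pc \<open>compact C\<close>])
  then obtain e where e: "e > 0" "\<And>M N. M \<in> C \<Longrightarrow> N \<in> C \<Longrightarrow> dist N M < e \<Longrightarrow> dist (pdet 1 N) (pdet 1 M) < m"
    unfolding uniformly_continuous_on_def using m(1) by metis
  obtain \<delta> where \<delta>: "\<delta> > 0" "\<And>B1 B2 t. \<lbrakk>B1 \<in> (E_set K :: (real \<Rightarrow> 'n::finite bmat) set); B2 \<in> E_set K;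
      \<And>t. opnorm (B1 t - B2 t) \<le> \<delta>; 0 \<le> t; t \<le> T\<rbrakk> \<Longrightarrow> norm (fund_sol B1 t - fund_sol B2 t) < e"
    using fund_sol_continuous_dependence[OF T K e(1)] by blast
  have "\<bar>angle B1 t - angle B2 t\<bar> \<le> 2 * pi"
    if B1: "B1 \<in> (E_set K :: (real \<Rightarrow> 'n bmat) set)" and B2: "B2 \<in> E_set K"
      and d: "\<And>t. opnorm (B1 t - B2 t) \<le> \<delta>" and t: "0 \<le> t" "t \<le> T" for B1 B2 t
  proof -
    define p where "p = (\<lambda>B :: real \<Rightarrow> 'n bmat. \<lambda>s. pdet 1 (fund_sol B (s * t)))"
    have pnz: "p B s \<noteq> 0" if "B \<in> E_set K" for B s unfolding p_def by (rule pdet_1_nz[OF fund_sol_in_Sp[OF that]])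
    have pcont: "continuous_on {0..1} (p B)" if "B \<in> E_set K" for B
      unfolding p_def
      by (intro continuous_on_pdet continuous_on_const continuous_on_compose2[OF continuous_on_fund_sol[OF that, of UNIV]])
         (auto intro!: continuous_intros)
    have close: "p B1 s / p B2 s \<notin> \<real>\<^sub>\<le>\<^sub>0" if s: "s \<in> {0..1}" for s
    proof -
      have st: "0 \<le> s * t" "s * t \<le> T"
        using s t mult_mono[of s 1 t T] T by auto
      have C: "fund_sol B1 (s * t) \<in> C" "fund_sol B2 (s * t) \<in> C"
        using st r[OF B1] r[OF B2] fund_sol_in_Sp[OF B1] fund_sol_in_Sp[OF B2] by (auto simp: C_def)
      have "dist (p B1 s) (p B2 s) < m"
        unfolding p_def by (rule e(2)[OF C(2,1)]) (use \<delta>(2)[OF B1 B2 d st] in \<open>simp add: dist_norm\<close>)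
      also have "m \<le> norm (p B2 s)" unfolding p_def by (rule m(2)[OF C(2)])
      finally have "norm ((p B1 s - p B2 s) / p B2 s) < 1"
        using pnz[OF B2, of s] by (simp add: norm_divide dist_norm)
      then have "norm (p B1 s / p B2 s - 1) < 1" using pnz[OF B2, of s] by (simp add: diff_divide_distrib)
      then have "Re (p B1 s / p B2 s) > 0"
        using abs_Re_le_cmod[of "p B1 s / p B2 s - 1"] by simp
      then show ?thesis by (auto simp: complex_nonpos_Reals_iff)
    qed
    have rc: "continuous_on {0..1} (\<lambda>s. p B1 s / p B2 s)"
      by (intro continuous_on_divide pcont B1 B2) (use pnz[OF B2] in auto)
    have "arg_change (p B1) = arg_change (\<lambda>s. p B1 s / p B2 s * p B2 s)" using pnz[OF B2] by simp
    also have "\<dots> = arg_change (\<lambda>s. p B1 s / p B2 s) + arg_change (p B2)"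
      by (rule arg_change_mult[OF rc _ pcont[OF B2]]) (use pnz[OF B1] pnz[OF B2] in auto)
    also have "arg_change (\<lambda>s. p B1 s / p B2 s) = Im (Ln (p B1 1 / p B2 1)) - Im (Ln (p B1 0 / p B2 0))"
      by (rule arg_change_eq[OF continuous_on_Ln'[OF rc close]]) (use pnz[OF B1] pnz[OF B2] in auto)
    finally have "arg_change (p B1) - arg_change (p B2) = Im (Ln (p B1 1 / p B2 1)) - Im (Ln (p B1 0 / p B2 0))" by simp
    moreover have "\<bar>Im (Ln (p B1 s / p B2 s))\<bar> \<le> pi" for s
      using mpi_less_Im_Ln[of "p B1 s / p B2 s"] Im_Ln_le_pi[of "p B1 s / p B2 s"] pnz[OF B1, of s] pnz[OF B2, of s] by simp
    from this[of 0] this[of 1]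
    have "\<bar>Im (Ln (p B1 1 / p B2 1)) - Im (Ln (p B1 0 / p B2 0))\<bar> \<le> 2 * pi" by linarith
    ultimately show ?thesis by (simp add: angle_def p_def)
  qed
  then show ?thesis using that \<delta>(1) by blast
qed

text \<open>Each window contributes at most \<open>2 \<pi>\<close> from the comparison on it and \<open>2d \<cdot> 2 \<pi>\<close> from each of the two uses of quasi-additivity.
  All shifts of the coefficients remain in \<open>E_set K\<close> and remain close, so the same \<open>\<delta>\<close> serves for every window.\<close>

lemma angle_comparison:
  fixes T :: real
  assumes T: "T > 0" and K: "K > 0"
  obtains \<delta> where "\<delta> > 0" "\<And>B1 B2 l. \<lbrakk>B1 \<in> (E_set K :: (real \<Rightarrow> 'n::finite bmat) set); B2 \<in> E_set K;
      \<And>t. opnorm (B1 t - B2 t) \<le> \<delta>; 0 \<le> l\<rbrakk>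
      \<Longrightarrow> \<bar>angle B1 l - angle B2 l\<bar> \<le> (l / T + 1) * ((4 * CARD('n + 'n) + 2) * pi)"
proof -
  define c where "c = (4 * real CARD('n + 'n) + 2) * pi"
  have c: "c \<ge> 2 * pi" by (simp add: c_def algebra_simps)
  obtain \<delta> where \<delta>: "\<delta> > 0" and win: "\<And>B1 B2 t. \<lbrakk>B1 \<in> (E_set K :: (real \<Rightarrow> 'n bmat) set); B2 \<in> E_set K;
      \<And>t. opnorm (B1 t - B2 t) \<le> \<delta>; 0 \<le> t; t \<le> T\<rbrakk> \<Longrightarrow> \<bar>angle B1 t - angle B2 t\<bar> \<le> 2 * pi"
    using angle_window[OF T K] by blast
  have main: "\<bar>angle B1 (real k * T + s) - angle B2 (real k * T + s)\<bar> \<le> (real k + 1) * c"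
    if "B1 \<in> (E_set K :: (real \<Rightarrow> 'n bmat) set)" "B2 \<in> E_set K" "\<And>t. opnorm (B1 t - B2 t) \<le> \<delta>" "0 \<le> s" "s \<le> T"
    for B1 B2 k s
    using that
  proof (induction k arbitrary: B1 B2)
    case 0
    then show ?case using win[of B1 B2 s] c by simp
  next
    case (Suc k)
    define B1' B2' where "B1' = (\<lambda>u. B1 (u + T))" and "B2' = (\<lambda>u. B2 (u + T))"
    have B': "B1' \<in> E_set K" "B2' \<in> E_set K"
      using fund_sol_shift(1)[OF Suc.prems(1)] fund_sol_shift(1)[OF Suc.prems(2)] by (simp_all add: B1'_def B2'_def)
    have 1: "\<bar>angle B1' (real k * T + s) - angle B2' (real k * T + s)\<bar> \<le> (real k + 1) * c"
      by (rule Suc.IH[OF B' _ Suc.prems(4,5)]) (simp add: B1'_def B2'_def Suc.prems(3))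
    have 2: "\<bar>angle B1 T - angle B2 T\<bar> \<le> 2 * pi" using win[OF Suc.prems(1,2,3), of T] T by simp
    have 3: "\<bar>angle B1 (T + (real k * T + s)) - angle B1 T - angle B1' (real k * T + s)\<bar> \<le> 2 * CARD('n + 'n) * pi"
      unfolding B1'_def by (rule angle_quasi_additive[OF Suc.prems(1)])
    have 4: "\<bar>angle B2 (T + (real k * T + s)) - angle B2 T - angle B2' (real k * T + s)\<bar> \<le> 2 * CARD('n + 'n) * pi"
      unfolding B2'_def by (rule angle_quasi_additive[OF Suc.prems(2)])
    have e: "real (Suc k) * T + s = T + (real k * T + s)" by (simp add: algebra_simps)
    have "\<bar>angle B1 (T + (real k * T + s)) - angle B2 (T + (real k * T + s))\<bar>
        \<le> (real k + 1) * c + 2 * pi + (2 * CARD('n + 'n) * pi + 2 * CARD('n + 'n) * pi)"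
      using 1 2 3 4 by linarith
    also have "\<dots> = (real (Suc k) + 1) * c" by (simp add: c_def algebra_simps)
    finally show ?case unfolding e .
  qed
  have "\<bar>angle B1 l - angle B2 l\<bar> \<le> (l / T + 1) * c"
    if "B1 \<in> (E_set K :: (real \<Rightarrow> 'n bmat) set)" "B2 \<in> E_set K" "\<And>t. opnorm (B1 t - B2 t) \<le> \<delta>" "0 \<le> l" for B1 B2 l
  proof -
    define k where "k = nat \<lfloor>l / T\<rfloor>"
    have "0 \<le> l / T" using that T by simp
    then have k: "real k \<le> l / T" "l / T < real k + 1" by (auto simp: k_def of_nat_nat floor_le_iff; linarith)+
    have s: "0 \<le> l - real k * T" "l - real k * T \<le> T" using k T by (auto simp: field_simps)
    have "\<bar>angle B1 l - angle B2 l\<bar> \<le> (real k + 1) * c"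
      using main[OF that(1-3) s, of k] by simp
    also have "\<dots> \<le> (l / T + 1) * c" using k(1) order_trans[OF _ c, of 0] by (intro mult_right_mono) auto
    finally show ?thesis .
  qed
  then have "\<bar>angle B1 l - angle B2 l\<bar> \<le> (l / T + 1) * ((4 * CARD('n + 'n) + 2) * pi)"
    if "B1 \<in> (E_set K :: (real \<Rightarrow> 'n bmat) set)" "B2 \<in> E_set K" "\<And>t. opnorm (B1 t - B2 t) \<le> \<delta>" "0 \<le> l" for B1 B2 l
    using that unfolding c_def of_nat_add of_nat_mult of_nat_numeral by blast
  then show ?thesis using that[OF \<delta>] by blast
qed

section \<open>Uniform continuity of the mean indices\<close>

lemma maslov_index_comparison:
  fixes T K :: real
  assumes T: "T > 0" and K: "K > 0"
  obtains \<delta> where "\<delta> > 0" "\<And>B1 B2 l. \<lbrakk>B1 \<in> (E_set K :: (real \<Rightarrow> 'n::finite bmat) set); B2 \<in> E_set K;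
      \<And>t. opnorm (B1 t - B2 t) \<le> \<delta>; 0 \<le> l\<rbrakk>
      \<Longrightarrow> \<bar>maslov_index 1 (fund_sol B1) l - maslov_index 1 (fund_sol B2) l\<bar>
          \<le> (4 * CARD('n + 'n) + 2) * (l / T + 2)"
proof -
  obtain \<delta> where \<delta>: "\<delta> > 0" and cmp: "\<And>B1 B2 l. \<lbrakk>B1 \<in> (E_set K :: (real \<Rightarrow> 'n bmat) set); B2 \<in> E_set K;
      \<And>t. opnorm (B1 t - B2 t) \<le> \<delta>; 0 \<le> l\<rbrakk>
      \<Longrightarrow> \<bar>angle B1 l - angle B2 l\<bar> \<le> (l / T + 1) * ((4 * CARD('n + 'n) + 2) * pi)"
    using angle_comparison[OF T K] by blast
  have "\<bar>maslov_index 1 (fund_sol B1) l - maslov_index 1 (fund_sol B2) l\<bar>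
          \<le> (4 * CARD('n + 'n) + 2) * (l / T + 2)"
    if B: "B1 \<in> (E_set K :: (real \<Rightarrow> 'n bmat) set)" "B2 \<in> E_set K"
      and d: "\<And>t. opnorm (B1 t - B2 t) \<le> \<delta>" and l: "0 \<le> l" for B1 B2 l
  proof -
    have "\<bar>angle B1 l - angle B2 l\<bar> / pi \<le> (l / T + 1) * ((4 * CARD('n + 'n) + 2) * pi) / pi"
      by (intro divide_right_mono cmp[OF B d l]) simp
    then have "\<bar>angle B1 l - angle B2 l\<bar> / pi \<le> (l / T + 1) * (4 * CARD('n + 'n) + 2)" by simp
    with maslov_index_angle[OF B l]
    have "\<bar>maslov_index 1 (fund_sol B1) l - maslov_index 1 (fund_sol B2) l\<bar>
        \<le> (l / T + 1) * (4 * CARD('n + 'n) + 2) + (4 * CARD('n + 'n) + 2)"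
      by linarith
    then show ?thesis by (simp add: algebra_simps)
  qed
  then show ?thesis using that \<delta> by blast
qed

text \<open>Scale \<open>B\<close> down to \<open>0\<close> in \<open>m\<close> steps, each so small that the comparison applies with windows of length \<open>1\<close>. For \<open>B = 0\<close>
  the path is constant and its index is bounded.\<close>

lemma maslov_index_growth:
  fixes B :: "real \<Rightarrow> 'n::finite bmat"
  assumes B: "B \<in> E_set K" and K: "K > 0"
  obtains C where "\<And>l. 0 \<le> l \<Longrightarrow> \<bar>maslov_index 1 (fund_sol B) l\<bar> \<le> C * (l + 1)"
proof -
  define n where "n = real (4 * CARD('n + 'n) + 2)"
  obtain \<delta> where \<delta>: "\<delta> > 0" and cmp: "\<And>B1 B2 l. \<lbrakk>B1 \<in> (E_set K :: (real \<Rightarrow> 'n bmat) set); B2 \<in> E_set K;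
      \<And>t. opnorm (B1 t - B2 t) \<le> \<delta>; 0 \<le> l\<rbrakk>
      \<Longrightarrow> \<bar>maslov_index 1 (fund_sol B1) l - maslov_index 1 (fund_sol B2) l\<bar> \<le> n * (l / 1 + 2)"
    using maslov_index_comparison[OF zero_less_one K] unfolding n_def by blast
  obtain m :: nat where m: "K / \<delta> < real m" using reals_Archimedean2 by blast
  have m0: "real m > 0" using m K \<delta> by (meson divide_pos_pos less_trans)
  define D where "D = (\<lambda>j :: nat. \<lambda>t. (real j / real m) *\<^sub>R B t)"
  have op: "opnorm (r *\<^sub>R A) = \<bar>r\<bar> * opnorm A" for r and A :: "'n bmat"
  proof -
    have "(\<lambda>v. (r *\<^sub>R A) *v v) = (\<lambda>v. r *\<^sub>R (A *v v))" by (simp add: scaleR_mv)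
    then show ?thesis unfolding opnorm_def by (simp add: onorm_scaleR matrix_vector_mul_bounded_linear)
  qed
  have D: "D j \<in> E_set K" if "j \<le> m" for j
  proof -
    have "opnorm (D j t) \<le> K" for t
    proof -
      have "opnorm (D j t) \<le> 1 * opnorm (B t)"
        unfolding D_def op using that m0 opnorm_pos[of "B t"] by (intro mult_right_mono) (auto simp: field_simps)
      also have "\<dots> \<le> K" using B by (simp add: E_set_def)
      finally show ?thesis .
    qed
    moreover have "continuous_on UNIV (D j)" unfolding D_def using B by (intro continuous_intros) (simp add: E_set_def)
    moreover have "transpose (D j t) = D j t" for t using B by (simp add: D_def E_set_def transpose_scalar)
    ultimately show ?thesis by (simp add: E_set_def)
  qed
  have step: "opnorm (D (Suc j) t - D j t) \<le> \<delta>" for j t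
  proof -
    have "D (Suc j) t - D j t = (1 / real m) *\<^sub>R B t"
      unfolding D_def scaleR_diff_left[symmetric] by (simp add: add_divide_distrib)
    then have "opnorm (D (Suc j) t - D j t) = opnorm (B t) / real m" using m0 by (simp add: op)
    also have "\<dots> \<le> K / real m" using B m0 by (intro divide_right_mono) (auto simp: E_set_def)
    also have "\<dots> \<le> \<delta>" using m m0 \<delta> by (simp add: field_simps)
    finally show ?thesis .
  qed
  have chain: "\<bar>maslov_index 1 (fund_sol (D j)) l - maslov_index 1 (fund_sol (D 0)) l\<bar> \<le> real j * (n * (l + 2))"
    if "j \<le> m" "0 \<le> l" for j l
    using that
  proof (induction j)
    case (Suc j)
    have "\<bar>maslov_index 1 (fund_sol (D (Suc j))) l - maslov_index 1 (fund_sol (D j)) l\<bar> \<le> n * (l / 1 + 2)"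
      using Suc.prems by (intro cmp D step) auto
    then show ?case using Suc by (simp add: algebra_simps)
  qed simp
  define \<nu> where "\<nu> = real (vec.dim {v :: complex ^ ('n + 'n). (mat 1 - mat 1) *v v = 0}) / 2"
  have zero: "\<bar>maslov_index 1 (fund_sol (D 0)) l\<bar> \<le> 2 * CARD('n + 'n) + \<nu>" if l: "0 \<le> l" for l
  proof -
    have D0: "D 0 \<in> E_set K" by (rule D) simp
    have sol: "fund_sol (D 0) = (\<lambda>t. mat 1)"
      by (rule fund_sol_eqI[OF D0]) (simp_all add: D_def)
    have "\<bar>- pi * real_of_int (maslov_iota 1 (mat 1) (\<lambda>t. mat 1 :: 'n bmat) 0 l) - 0\<bar> \<le> 2 * CARD('n + 'n) * pi"
      using maslov_iota_bound[OF l, of "\<lambda>t. mat 1 :: 'n bmat"] mat_1_in_Sp arg_change_const[OF pdet_1_nz[OF mat_1_in_Sp[where 'a='n]]]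
      by simp
    then have "\<bar>real_of_int (maslov_iota 1 (mat 1) (\<lambda>t. mat 1 :: 'n bmat) 0 l)\<bar> * pi \<le> (2 * CARD('n + 'n)) * pi"
      by (simp add: abs_mult mult.commute)
    then have "\<bar>real_of_int (maslov_iota 1 (mat 1) (\<lambda>t. mat 1 :: 'n bmat) 0 l)\<bar> \<le> 2 * CARD('n + 'n)" by simp
    then show ?thesis unfolding sol maslov_index_def \<nu>_def by (simp add: abs_if split: if_splits)
  qed
  have Dm: "D m = B" using m0 by (simp add: D_def)
  define C where "C = real m * n * 2 + (2 * CARD('n + 'n) + \<nu>)"
  have "\<bar>maslov_index 1 (fund_sol B) l\<bar> \<le> C * (l + 1)" if l: "0 \<le> l" for l
  proof -
    have "\<bar>maslov_index 1 (fund_sol B) l\<bar> \<le> real m * (n * (l + 2)) + (2 * CARD('n + 'n) + \<nu>)"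
      using chain[of m l] zero[OF l] l unfolding Dm by linarith
    also have "\<dots> \<le> (real m * n * 2) * (l + 1) + (2 * CARD('n + 'n) + \<nu>) * (l + 1)"
    proof (rule add_mono)
      have "n * (l + 2) \<le> n * (2 * (l + 1))" using l by (intro mult_left_mono) (auto simp: n_def)
      then show "real m * (n * (l + 2)) \<le> (real m * n * 2) * (l + 1)"
        using mult_left_mono[of "n * (l + 2)" "n * (2 * (l + 1))" "real m"] by (simp add: mult_ac)
      have "(2 * CARD('n + 'n) + \<nu>) * 1 \<le> (2 * CARD('n + 'n) + \<nu>) * (l + 1)"
        using l by (intro mult_left_mono) (auto simp: \<nu>_def)
      then show "2 * CARD('n + 'n) + \<nu> \<le> (2 * CARD('n + 'n) + \<nu>) * (l + 1)" by simp
    qed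
    finally show ?thesis by (simp add: C_def algebra_simps)
  qed
  then show ?thesis using that by blast
qed

lemma E_dist_upper:
  fixes A B :: "real \<Rightarrow> 'n::finite bmat"
  assumes "A \<in> E_set K" "B \<in> E_set K"
  shows "opnorm (A t - B t) \<le> E_dist K A B"
proof -
  have "opnorm (A t - B t) \<le> K + K" for t
    using opnorm_triangle[of "A t" "- B t"] assms opnorm_uminus[of "B t"]
    by (simp add: E_set_def) (smt (verit))
  then have "bdd_above (range (\<lambda>t. opnorm (A t - B t)))" by (auto intro!: bdd_aboveI)
  then show ?thesis using assms cSUP_upper[of t UNIV "\<lambda>t. opnorm (A t - B t)"] by (simp add: E_dist_def)
qed

lemma limsup_liminf_bounded:
  fixes x :: "real \<Rightarrow> real"
  assumes "\<forall>\<^sub>F l in at_top. \<bar>x l\<bar> \<le> C"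
  shows "\<bar>Limsup at_top (\<lambda>l. ereal (x l))\<bar> \<noteq> \<infinity>" "\<bar>Liminf at_top (\<lambda>l. ereal (x l))\<bar> \<noteq> \<infinity>"
proof -
  have up: "\<forall>\<^sub>F l in at_top. ereal (x l) \<le> ereal C" and lo: "\<forall>\<^sub>F l in at_top. ereal (- C) \<le> ereal (x l)"
    using assms by (auto elim!: eventually_mono)
  have 1: "Limsup at_top (\<lambda>l. ereal (x l)) \<le> ereal C" using up by (rule Limsup_bounded)
  have 2: "ereal (- C) \<le> Liminf at_top (\<lambda>l. ereal (x l))" using lo by (rule Liminf_bounded)
  have 3: "Liminf at_top (\<lambda>l. ereal (x l)) \<le> Limsup at_top (\<lambda>l. ereal (x l))"
    by (rule Liminf_le_Limsup) simp
  show "\<bar>Limsup at_top (\<lambda>l. ereal (x l))\<bar> \<noteq> \<infinity>" "\<bar>Liminf at_top (\<lambda>l. ereal (x l))\<bar> \<noteq> \<infinity>"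
    using 1 2 3 by (cases "Limsup at_top (\<lambda>l. ereal (x l))"; cases "Liminf at_top (\<lambda>l. ereal (x l))"; auto)+
qed

lemma limsup_liminf_close:
  fixes x y :: "real \<Rightarrow> real"
  assumes c: "\<forall>\<^sub>F l in at_top. \<bar>x l - y l\<bar> \<le> e"
  shows "Limsup at_top (\<lambda>l. ereal (x l)) \<le> Limsup at_top (\<lambda>l. ereal (y l)) + ereal e"
    "Liminf at_top (\<lambda>l. ereal (x l)) \<le> Liminf at_top (\<lambda>l. ereal (y l)) + ereal e"
proof -
  have ev: "\<forall>\<^sub>F l in at_top. ereal (x l) \<le> ereal (y l) + ereal e" using c by eventually_elim auto
  show "Limsup at_top (\<lambda>l. ereal (x l)) \<le> Limsup at_top (\<lambda>l. ereal (y l)) + ereal e"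
    using Limsup_mono[OF ev] Limsup_add_ereal_right[of "at_top :: real filter" "ereal e" "\<lambda>l. ereal (y l)"] by simp
  show "Liminf at_top (\<lambda>l. ereal (x l)) \<le> Liminf at_top (\<lambda>l. ereal (y l)) + ereal e"
    using Liminf_mono[OF ev] Liminf_add_ereal_right[of "at_top :: real filter" "ereal e" "\<lambda>l. ereal (y l)"] by simp
qed

text \<open>The four mean indices are upper or lower limits of quantities \<open>X B l\<close> that depend on \<open>B\<close> uniformly continuously for large
  \<open>l\<close>, although the threshold for \<open>l\<close> may depend on the pair of coefficients; upper and lower limits inherit the estimate.\<close>

lemma uniformly_continuous_asymptotic_limits:
  fixes X :: "(real \<Rightarrow> 'n::finite bmat) \<Rightarrow> real \<Rightarrow> real" and f :: "(real \<Rightarrow> 'n bmat) \<Rightarrow> ereal"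
  assumes f: "f = (\<lambda>B. Limsup at_top (\<lambda>l. ereal (X B l))) \<or> f = (\<lambda>B. Liminf at_top (\<lambda>l. ereal (X B l)))"
    and bnd: "\<And>B. B \<in> E_set K \<Longrightarrow> \<exists>C. \<forall>\<^sub>F l in at_top. \<bar>X B l\<bar> \<le> C"
    and close: "\<And>e. e > 0 \<Longrightarrow> \<exists>\<delta>>0. \<forall>B1\<in>E_set K. \<forall>B2\<in>E_set K. (\<forall>t. opnorm (B1 t - B2 t) \<le> \<delta>) \<longrightarrow>
        (\<forall>\<^sub>F l in at_top. \<bar>X B1 l - X B2 l\<bar> \<le> e)"
  shows "(\<forall>B \<in> E_set K. \<bar>f B\<bar> \<noteq> \<infinity>) \<and>
    uniformly_continuous_map (E_metric K) euclidean_metric (\<lambda>B. real_of_ereal (f B))"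
proof
  show fin: "\<forall>B \<in> E_set K. \<bar>f B\<bar> \<noteq> \<infinity>"
    using f bnd limsup_liminf_bounded by metis
  have le: "f B1 \<le> f B2 + ereal e" if "\<forall>\<^sub>F l in at_top. \<bar>X B1 l - X B2 l\<bar> \<le> e" for B1 B2 :: "real \<Rightarrow> 'n bmat" and e
    using f limsup_liminf_close[OF that] by auto
  show "uniformly_continuous_map (E_metric K) euclidean_metric (\<lambda>B. real_of_ereal (f B))"
    unfolding uniformly_continuous_map_def mspace_E_metric mdist_E_metric
  proof (intro conjI allI impI)
    fix \<epsilon> :: real assume "\<epsilon> > 0"
    then obtain \<delta> where \<delta>: "\<delta> > 0" "\<And>B1 B2. \<lbrakk>B1\<in>E_set K; B2\<in>E_set K; \<forall>t. opnorm (B1 t - B2 t) \<le> \<delta>\<rbrakk> \<Longrightarrow>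
        (\<forall>\<^sub>F l in at_top. \<bar>X B1 l - X B2 l\<bar> \<le> \<epsilon> / 2)"
      using close[of "\<epsilon>/2"] by auto
    show "\<exists>\<delta>>0. \<forall>x\<in>E_set K. \<forall>y\<in>E_set K. E_dist K y x < \<delta> \<longrightarrow>
        mdist euclidean_metric (real_of_ereal (f y)) (real_of_ereal (f x)) < \<epsilon>"
    proof (intro exI[of _ \<delta>] conjI \<delta>(1) ballI impI)
      fix B1 B2 :: "real \<Rightarrow> 'n bmat" assume B: "B1 \<in> E_set K" "B2 \<in> E_set K" and d: "E_dist K B2 B1 < \<delta>"
      have "\<forall>t. opnorm (B2 t - B1 t) \<le> \<delta>" using E_dist_upper[OF B(2,1)] d by (meson less_imp_le order_trans)
      then have 1: "f B2 \<le> f B1 + ereal (\<epsilon>/2)" by (intro le \<delta>(2) B)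
      have "\<forall>t. opnorm (B1 t - B2 t) \<le> \<delta>" using \<open>\<forall>t. opnorm (B2 t - B1 t) \<le> \<delta>\<close> opnorm_minus_commute by metis
      then have 2: "f B1 \<le> f B2 + ereal (\<epsilon>/2)" by (intro le \<delta>(2) B)
      obtain a b where ab: "f B1 = ereal a" "f B2 = ereal b"
        using fin[rule_format, OF B(1)] fin[rule_format, OF B(2)] by (cases "f B1"; cases "f B2") auto
      have "\<bar>b - a\<bar> \<le> \<epsilon> / 2" using 1 2 unfolding ab by (simp add: abs_if)
      then show "mdist euclidean_metric (real_of_ereal (f B2)) (real_of_ereal (f B1)) < \<epsilon>"
        using \<open>\<epsilon> > 0\<close> by (simp add: ab dist_real_def)
    qed
  qed simp
qed

lemma mean_index_bounded:
  fixes B :: "real \<Rightarrow> 'n::finite bmat"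
  assumes B: "B \<in> E_set K" and K: "K > 0"
  shows "\<exists>C. \<forall>\<^sub>F l in at_top. \<bar>maslov_index 1 (fund_sol B) l / l\<bar> \<le> C"
proof -
  obtain C where C: "\<And>l. 0 \<le> l \<Longrightarrow> \<bar>maslov_index 1 (fund_sol B) l\<bar> \<le> C * (l + 1)"
    using maslov_index_growth[OF B K] by blast
  have C0: "0 \<le> C" using C[of 0] by (simp add: order_trans[OF abs_ge_zero])
  have "\<forall>\<^sub>F l in at_top. \<bar>maslov_index 1 (fund_sol B) l / l\<bar> \<le> 2 * C"
    using eventually_ge_at_top[of "1::real"]
  proof eventually_elim
    case (elim l)
    have "\<bar>maslov_index 1 (fund_sol B) l\<bar> \<le> C * (l + 1)" using C elim by simp
    also have "\<dots> \<le> C * (2 * l)" using elim C0 by (intro mult_left_mono) auto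
    finally show ?case using elim by (simp add: abs_divide divide_le_eq mult_ac)
  qed
  then show ?thesis by blast
qed

text \<open>The window length is chosen so that the linear term \<open>n * l / T\<close> of the comparison is \<open>e / 2\<close> times \<open>l\<close>; the constant term is
  absorbed for large \<open>l\<close>.\<close>

lemma mean_index_close:
  fixes K e :: real
  assumes K: "K > 0" and e: "e > 0"
  obtains \<delta> where "\<delta> > 0" "\<And>B1 B2. \<lbrakk>B1 \<in> (E_set K :: (real \<Rightarrow> 'n::finite bmat) set); B2 \<in> E_set K;
      \<And>t. opnorm (B1 t - B2 t) \<le> \<delta>\<rbrakk>
      \<Longrightarrow> \<forall>\<^sub>F l in at_top. \<bar>maslov_index 1 (fund_sol B1) l / l - maslov_index 1 (fund_sol B2) l / l\<bar> \<le> e"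
proof -
  define n where "n = real (4 * CARD('n + 'n) + 2)"
  have n: "n > 0" by (simp add: n_def add_nonneg_pos)
  define T where "T = 2 * n / e"
  have T: "T > 0" using n e by (simp add: T_def)
  obtain \<delta> where \<delta>: "\<delta> > 0" and cmp: "\<And>B1 B2 l. \<lbrakk>B1 \<in> (E_set K :: (real \<Rightarrow> 'n bmat) set); B2 \<in> E_set K;
      \<And>t. opnorm (B1 t - B2 t) \<le> \<delta>; 0 \<le> l\<rbrakk>
      \<Longrightarrow> \<bar>maslov_index 1 (fund_sol B1) l - maslov_index 1 (fund_sol B2) l\<bar> \<le> n * (l / T + 2)"
    using maslov_index_comparison[OF T K] unfolding n_def by blast
  show ?thesis
  proof (rule that[OF \<delta>])
    fix B1 B2 assume B: "B1 \<in> (E_set K :: (real \<Rightarrow> 'n bmat) set)" "B2 \<in> E_set K"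
      and d: "\<And>t. opnorm (B1 t - B2 t) \<le> \<delta>"
    show "\<forall>\<^sub>F l in at_top. \<bar>maslov_index 1 (fund_sol B1) l / l - maslov_index 1 (fund_sol B2) l / l\<bar> \<le> e"
      using eventually_ge_at_top[of "4 * n / e"]
    proof eventually_elim
      case (elim l)
      have "0 < 4 * n / e" using n e by simp
      then have l: "l > 0" using elim by linarith
      have "n * (l / T + 2) = (e / 2) * l + 2 * n" using n by (simp add: T_def field_simps)
      also have "2 * n \<le> (e / 2) * l" using elim e by (simp add: field_simps)
      finally have "\<bar>maslov_index 1 (fund_sol B1) l - maslov_index 1 (fund_sol B2) l\<bar> \<le> e * l"
        using cmp[OF B d, of l] l by simp
      then show ?case using l by (simp add: abs_divide divide_le_eq flip: diff_divide_distrib)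
    qed
  qed
qed

theorem theorem1p2:
  fixes K :: real
  assumes "K > 0"
  shows "\<forall>f \<in> {mean_index_U, mean_index_L, mean_index_U_neg,
                mean_index_L_neg :: (real \<Rightarrow> 'n::finite bmat) \<Rightarrow> ereal}.
           (\<forall>B \<in> E_set K. \<bar>f B\<bar> \<noteq> \<infinity>) \<and>
           uniformly_continuous_map (E_metric K) euclidean_metric (\<lambda>B. real_of_ereal (f B))"
proof
  fix f :: "(real \<Rightarrow> 'n bmat) \<Rightarrow> ereal"
  assume f: "f \<in> {mean_index_U, mean_index_L, mean_index_U_neg, mean_index_L_neg}"
  define X where "X = (\<lambda>B :: real \<Rightarrow> 'n bmat. \<lambda>l. maslov_index 1 (fund_sol B) l / l)"
  define Y where "Y = (\<lambda>B :: real \<Rightarrow> 'n bmat. \<lambda>l. maslov_index 1 (\<lambda>t. fund_sol B (- t)) l / (- l))"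
  \<comment> \<open>Reversing time turns the index for negative times into one for positive times, for a system in the same
    set \<open>E_set K\<close>; the sign comes from dividing by \<open>- l\<close>.\<close>
  have XY: "Y B l = - X (\<lambda>t. - B (- t)) l" if "B \<in> E_set K" for B l
    unfolding X_def Y_def fund_sol_reflect(2)[OF that] by simp
  have Xbnd: "\<exists>C. \<forall>\<^sub>F l in at_top. \<bar>X B l\<bar> \<le> C" if "B \<in> E_set K" for B
    unfolding X_def by (rule mean_index_bounded[OF that assms])
  have Xclose: "\<exists>\<delta>>0. \<forall>B1\<in>E_set K. \<forall>B2\<in>E_set K. (\<forall>t. opnorm (B1 t - B2 t) \<le> \<delta>) \<longrightarrow>
        (\<forall>\<^sub>F l in at_top. \<bar>X B1 l - X B2 l\<bar> \<le> e)" if e: "e > 0" for e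
  proof -
    obtain \<delta> where \<delta>: "\<delta> > 0" "\<And>B1 B2. \<lbrakk>B1 \<in> (E_set K :: (real \<Rightarrow> 'n bmat) set); B2 \<in> E_set K;
        \<And>t. opnorm (B1 t - B2 t) \<le> \<delta>\<rbrakk> \<Longrightarrow> \<forall>\<^sub>F l in at_top. \<bar>X B1 l - X B2 l\<bar> \<le> e"
      using mean_index_close[OF assms e] unfolding X_def by blast
    show ?thesis by (intro exI[of _ \<delta>] conjI \<delta>(1) ballI impI) (simp add: \<delta>(2))
  qed
  have Ybnd: "\<exists>C. \<forall>\<^sub>F l in at_top. \<bar>Y B l\<bar> \<le> C" if "B \<in> E_set K" for B
    using Xbnd[OF fund_sol_reflect(1)[OF that]] by (simp add: XY[OF that])
  have Yclose: "\<exists>\<delta>>0. \<forall>B1\<in>E_set K. \<forall>B2\<in>E_set K. (\<forall>t. opnorm (B1 t - B2 t) \<le> \<delta>) \<longrightarrow>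
        (\<forall>\<^sub>F l in at_top. \<bar>Y B1 l - Y B2 l\<bar> \<le> e)" if e: "e > 0" for e
  proof -
    obtain \<delta> where \<delta>: "\<delta> > 0" "\<And>B1 B2. \<lbrakk>B1\<in>E_set K; B2\<in>E_set K; \<forall>t. opnorm (B1 t - B2 t) \<le> \<delta>\<rbrakk> \<Longrightarrow>
        (\<forall>\<^sub>F l in at_top. \<bar>X B1 l - X B2 l\<bar> \<le> e)" using Xclose[OF e] by blast
    show ?thesis
    proof (intro exI[of _ \<delta>] conjI \<delta>(1) ballI impI)
      fix B1 B2 :: "real \<Rightarrow> 'n bmat"
      assume B: "B1 \<in> E_set K" "B2 \<in> E_set K" and d: "\<forall>t. opnorm (B1 t - B2 t) \<le> \<delta>"
      have "opnorm (- B1 (- t) - - B2 (- t)) \<le> \<delta>" for t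
        using d[rule_format, of "- t"] opnorm_minus_commute[of "B1 (- t)" "B2 (- t)"] by simp
      then have "\<forall>\<^sub>F l in at_top. \<bar>X (\<lambda>t. - B1 (- t)) l - X (\<lambda>t. - B2 (- t)) l\<bar> \<le> e"
        by (intro \<delta>(2) fund_sol_reflect(1) B) auto
      then show "\<forall>\<^sub>F l in at_top. \<bar>Y B1 l - Y B2 l\<bar> \<le> e"
        by (rule eventually_mono) (simp add: XY[OF B(1)] XY[OF B(2)] abs_minus_commute)
    qed
  qed
  have "(f = (\<lambda>B. Limsup at_top (\<lambda>l. ereal (X B l))) \<or> f = (\<lambda>B. Liminf at_top (\<lambda>l. ereal (X B l))))
      \<or> (f = (\<lambda>B. Limsup at_top (\<lambda>l. ereal (Y B l))) \<or> f = (\<lambda>B. Liminf at_top (\<lambda>l. ereal (Y B l))))"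
    using f by (auto simp: fun_eq_iff X_def Y_def mean_index_U_def mean_index_L_def mean_index_U_neg_def mean_index_L_neg_def)
  then show "(\<forall>B \<in> E_set K. \<bar>f B\<bar> \<noteq> \<infinity>) \<and>
           uniformly_continuous_map (E_metric K) euclidean_metric (\<lambda>B. real_of_ereal (f B))"
    by (elim disjE[of "_ \<or> _" "_ \<or> _"])
       (rule uniformly_continuous_asymptotic_limits[OF _ Xbnd Xclose] uniformly_continuous_asymptotic_limits[OF _ Ybnd Yclose]; assumption)+
qed

end
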